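(* Let $0<\lambda<\mu$ and consider the Poisson matching problem $PM(\lambda,\mu)$ (defined in the context), with stable matching $\mathcal{M}_s$. Let $X$ be the matching distance in $\mathcal{M}_s$ of an arbitrary (typical) blue point. Then there exist random variables $B_1,B_2,\dots$, $B_1',B_2',\dots$, $N$, $N'$ on the same probability space such that the $B_i$ and $B_i'$ are i.i.d. with distribution $B(\lambda,\mu)$, $N$ and $N'$ are i.i.d. geometric random variables with parameter $1-\lambda/\mu$, and $$\min\{B_1,B_1'\}\le X\le\max\Bigl\{\sum_{i=1}^{2N-1}B_i,\ \sum_{i=1}^{2N'-1}B_i'\Bigr\}.$$
   Context: Poisson matching problem $PM(\lambda,\mu)$: $\mathcal{B}$ (blue points) and $\mathcal{R}$ (red points) are independent homogeneous Poisson point processes on $\mathbb{R}$ of intensities $\lambda$ and $\mu$ respectively. A matching is a map $\mathcal{M}:\mathcal{B}\cup\mathcal{R}\to\mathcal{B}\cup\mathcal{R}\cup\{\infty\}$ with $\mathcal{M}(r)\in\mathcal{B}\cup\{\infty\}$ for red $r$, $\mathcal{M}(b)\in\mathcal{R}\cup\{\infty\}$ for blue $b$, and $\mathcal{M}(r)=b$ iff $\mathcal{M}(b)=r$; $x$ is unmatched if $\mathcal{M}(x)=\infty$. A matching is stable if there is no pair $(b,r)\in\mathcal{B}\times\mathcal{R}$ with $b\ne\mathcal{M}(r)$ and $|r-b|<\min(|r-\mathcal{M}(r)|,|b-\mathcal{M}(b)|)$. $\mathcal{M}_s$ is the stable matching produced by the following procedure: every blue point simultaneously emits two rays, one in each direction,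 each at distance $t$ from its emitter at time $t$; when a ray hits an unmatched red point $r$, the emitter $b$ is matched to $r$ and both leave the system. The matching distance of $x$ in a matching $\mathcal{M}$ is $|x-\mathcal{M}(x)|$. $B(\lambda,\mu)$ denotes the distribution of the busy cycle (busy period) of a last-come-first-served preemptive-resume single-server queue with Poisson arrivals of rate $\lambda$ and i.i.d. exponential service times of rate $\mu$. A geometric random variable with parameter $p$ takes value $j\in\{1,2,\dots\}$ with probability $(1-p)^{j-1}p$. *)

theory Defs
  imports "HOL-Probability.Probability"
begin

definition locally_finite :: "real set \<Rightarrow> bool" where
  "locally_finite S \<longleftrightarrow> (\<forall>a b. finite (S \<inter> {a..b}))"

definition poisson_matching_problem ::
  "'a measure \<Rightarrow> real \<Rightarrow> real \<Rightarrow> ('a \<Rightarrow> real set) \<Rightarrow> ('a \<Rightarrow> real set) \<Rightarrow> bool" where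
  "poisson_matching_problem M l m Bl Rd \<longleftrightarrow>
     prob_space M \<and>
     (\<forall>\<omega>\<in>space M. locally_finite (Bl \<omega>) \<and> locally_finite (Rd \<omega>)) \<and>
     (\<forall>(I::nat set) (a::nat \<Rightarrow> real) b.
        finite I \<longrightarrow> (\<forall>i\<in>I. a i < b i) \<longrightarrow>
        (\<forall>i\<in>I. \<forall>j\<in>I. i \<noteq> j \<longrightarrow> {a i<..b i} \<inter> {a j<..b j} = {}) \<longrightarrow>
        prob_space.indep_vars M (\<lambda>_. count_space UNIV)
          (\<lambda>(c, i) \<omega>. card ((if c then Bl \<omega> else Rd \<omega>) \<inter> {a i<..b i})) (UNIV \<times> I)) \<and>
     (\<forall>a b. a < b \<longrightarrow>
        distr M (count_space UNIV) (\<lambda>\<omega>. card (Bl \<omega> \<inter> {a<..b}))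
          = measure_pmf (poisson_pmf (l * (b - a))) \<and>
        distr M (count_space UNIV) (\<lambda>\<omega>. card (Rd \<omega> \<inter> {a<..b}))
          = measure_pmf (poisson_pmf (m * (b - a))))"

definition is_matching :: "real set \<Rightarrow> real set \<Rightarrow> (real \<times> real) set \<Rightarrow> bool" where
  "is_matching Bs Rs P \<longleftrightarrow> P \<subseteq> Bs \<times> Rs \<and>
     (\<forall>b r r'. (b, r) \<in> P \<longrightarrow> (b, r') \<in> P \<longrightarrow> r = r') \<and>
     (\<forall>b b' r. (b, r) \<in> P \<longrightarrow> (b', r) \<in> P \<longrightarrow> b = b')"

definition mdist_blue :: "(real \<times> real) set \<Rightarrow> real \<Rightarrow> ereal" where
  "mdist_blue P b = (if \<exists>r. (b, r) \<in> P then ereal \<bar>b - (THE r. (b, r) \<in> P)\<bar> else \<infinity>)"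

definition mdist_red :: "(real \<times> real) set \<Rightarrow> real \<Rightarrow> ereal" where
  "mdist_red P r = (if \<exists>b. (b, r) \<in> P then ereal \<bar>r - (THE b. (b, r) \<in> P)\<bar> else \<infinity>)"

definition stable_matching :: "real set \<Rightarrow> real set \<Rightarrow> (real \<times> real) set \<Rightarrow> bool" where
  "stable_matching Bs Rs P \<longleftrightarrow> is_matching Bs Rs P \<and>
     (\<forall>b\<in>Bs. \<forall>r\<in>Rs. (b, r) \<notin> P \<longrightarrow>
        \<not> (ereal \<bar>r - b\<bar> < mdist_red P r \<and> ereal \<bar>r - b\<bar> < mdist_blue P b))"

text \<open>Outcome of the ray procedure: the matching time of every point equals its matching
distance.  At time t = |r - b| the ray of b reaches r; if at that moment b is still emitting
(not matched before time t) and r is still unmatched (not matched before time t), then b and r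
get matched to each other.\<close>

definition ray_outcome :: "real set \<Rightarrow> real set \<Rightarrow> (real \<times> real) set \<Rightarrow> bool" where
  "ray_outcome Bs Rs P \<longleftrightarrow> is_matching Bs Rs P \<and>
     (\<forall>b\<in>Bs. \<forall>r\<in>Rs. ereal \<bar>r - b\<bar> \<le> mdist_blue P b \<and> ereal \<bar>r - b\<bar> \<le> mdist_red P r
        \<longrightarrow> (b, r) \<in> P)"

definition Ms :: "real set \<Rightarrow> real set \<Rightarrow> (real \<times> real) set" where
  "Ms Bs Rs = (SOME P. stable_matching Bs Rs P \<and> ray_outcome Bs Rs P)"

text \<open>Canonical M/M/1 sample space: at index i a pair (interarrival time before customer i,
service time of customer i), all independent, interarrivals Exp(l), services Exp(m).
Customer 0 arrives at time 0 and starts the busy cycle; customer k >= 1 arrives at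
time sum of the interarrival times with indices 1..k.\<close>

definition exp_meas :: "real \<Rightarrow> real measure" where
  "exp_meas r = density lborel (exponential_density r)"

definition queue_space :: "real \<Rightarrow> real \<Rightarrow> (nat \<Rightarrow> real \<times> real) measure" where
  "queue_space l m = PiM UNIV (\<lambda>_. exp_meas l \<Otimes>\<^sub>M exp_meas m)"

definition arrival_time :: "(nat \<Rightarrow> real \<times> real) \<Rightarrow> nat \<Rightarrow> real" where
  "arrival_time \<omega> k = (\<Sum>i\<in>{1..k}. fst (\<omega> i))"

definition work_arrived :: "(nat \<Rightarrow> real \<times> real) \<Rightarrow> real \<Rightarrow> real" where
  "work_arrived \<omega> t = snd (\<omega> 0) + (\<Sum>k\<in>{k. 1 \<le> k \<and> arrival_time \<omega> k \<le> t}. snd (\<omega> k))"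

text \<open>The server (under any work-conserving discipline, in particular LCFS preemptive-resume)
is busy until the first time the arrived work has been completely served.\<close>

definition busy_cycle :: "(nat \<Rightarrow> real \<times> real) \<Rightarrow> real" where
  "busy_cycle \<omega> = Inf {t. 0 < t \<and> work_arrived \<omega> t \<le> t}"

definition busy_dist :: "real \<Rightarrow> real \<Rightarrow> real measure" where
  "busy_dist l m = distr (queue_space l m) borel busy_cycle"

definition geom1 :: "real \<Rightarrow> nat measure" where
  "geom1 p = measure_pmf (map_pmf Suc (geometric_pmf p))"

end

(*
  To the right of the typical blue point 0 let S(t) be the number of red points minus the number of
  blue points in (0,t], let T_k be the first time S reaches k, and let B_k = T_k - T_{k-1}; do the same
  for the reflected process on the left. By the strong Markov property the B_k are i.i.d., and T_1 is
  a busy cycle: the blue points are the arrivals, and the gaps between red points the service times.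

  In a stable matching without ties the points between two partners are matched among themselves.
  So if 0 is matched to r > 0 then S(r) = 1 and S = 0 just before r, whence r >= T_1. Let N be the
  least j >= 1 such that S stays positive from T_j on. Then r <= T_N, and 0 cannot be unmatched:
  some red point of (0,T_N] would be matched beyond T_N, which forces S <= 0 at its partner. Since
  T_N <= T_{2N-1}, the upper bound follows. Finally P(N > j) is the probability that S drops by j
  after T_j, that is, ever drops by j; by optional stopping of the martingale (l/m)^S it is (l/m)^j.

  Nothing requires N to be independent of the B_k, so all variables live on the original space.
*)
theory Submission
  imports Defs
begin

section \<open>Stable matchings on the line\<close>

text \<open>The typical blue point is realised as a point added at 0; \<open>excess\<close> starts
  at 0 and does not count it. \<open>Ms\<close> is given by a choice operator, so nothing is known
  about it until some stable matching with the ray property is exhibited; this is where the almost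
  sure absence of ties enters. The bounds then use stability alone.

  The hypotheses speak only of counts in half-open intervals. Measurability, the strong Markov
  property and optional stopping are therefore built from finite-dimensional distributions: random
  times are rounded up to dyadic times and right-continuity passes to the limit. The abstract
  process serves three kinds of integer combinations of counts: a single count, whose gaps are the
  exponential times of the queue; the excess S; and -S, whose chance to reach j gives P(N > j).

  Optional stopping needs control of paths that have not reached level j. With z = m/l and y its
  square root, z^k \<le> y^j y^k for k \<le> j, and the mean of y^(-S(t)) is exp(-t (sqrt m - sqrt
  l)^2). So this part vanishes as t grows, and no almost sure divergence of S has to be
  shown.\<close>

definition no_ties :: "real set \<Rightarrow> real set \<Rightarrow> bool" where
  "no_ties U V \<longleftrightarrow> (\<forall>u\<in>U. \<forall>v\<in>V. \<forall>v'\<in>V. \<bar>u - v\<bar> = \<bar>u - v'\<bar> \<longrightarrow> v = v')"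

lemma locally_finite_insert: "locally_finite S \<Longrightarrow> locally_finite (insert x S)"
  unfolding locally_finite_def by (metis Int_insert_left finite_insert)

lemma locally_finite_uminus: "locally_finite S \<Longrightarrow> locally_finite (uminus ` S)"
proof -
  assume S: "locally_finite S"
  have "uminus ` S \<inter> {a..b} = uminus ` (S \<inter> {-b..-a})" for a b :: real
    by force
  then show ?thesis
    using S by (auto simp: locally_finite_def)
qed

text \<open>Only points at distance at most |x - s| from \<open>x\<close> compete, and local
  finiteness leaves finitely many of them.\<close>

lemma locally_finite_nearest:
  assumes "locally_finite S" and "s \<in> S" and "Q s"
  obtains s' where "s' \<in> S" "Q s'" "\<And>t. t \<in> S \<Longrightarrow> Q t \<Longrightarrow> \<bar>x - s'\<bar> \<le> \<bar>x - t\<bar>"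
proof -
  let ?d = "\<bar>x - s\<bar>"
  let ?A = "{t \<in> S \<inter> {x - ?d..x + ?d}. Q t}"
  have fin: "finite ?A"
    using assms(1) unfolding locally_finite_def
    by (intro finite_subset[of ?A "S \<inter> {x - ?d..x + ?d}"]) blast+
  have "s \<in> ?A"
    using assms by (auto simp: abs_if)
  with fin have "Min ((\<lambda>t. \<bar>x - t\<bar>) ` ?A) \<in> (\<lambda>t. \<bar>x - t\<bar>) ` ?A"
      "\<And>t. t \<in> ?A \<Longrightarrow> Min ((\<lambda>t. \<bar>x - t\<bar>) ` ?A) \<le> \<bar>x - t\<bar>"
    by (blast intro: Min_in Min_le finite_imageI)+
  then obtain s' where s': "s' \<in> ?A" "\<And>t. t \<in> ?A \<Longrightarrow> \<bar>x - s'\<bar> \<le> \<bar>x - t\<bar>"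
    by (smt (verit) imageE)
  have "\<bar>x - s'\<bar> \<le> \<bar>x - t\<bar>" if "t \<in> S" "Q t" for t
  proof (cases "\<bar>x - t\<bar> \<le> ?d")
    case True
    then have "t \<in> ?A" using that by (auto simp: abs_if split: if_splits)
    then show ?thesis by (rule s'(2))
  next
    case False
    then show ?thesis using s'(2)[OF \<open>s \<in> ?A\<close>] by linarith
  qed
  then show ?thesis using s'(1) that by blast
qed

text \<open>Deferred acceptance: a pair is rejected once the second point has received a proposal from a
closer point, and a point proposes to its nearest partner that has not rejected it. The least
fixed point exists even though infinitely many points compete.\<close>

definition rejected_step :: "real set \<Rightarrow> real set \<Rightarrow> (real \<times> real) set \<Rightarrow> (real \<times> real) set" where
  "rejected_step U V X = {(u, v). u \<in> U \<and> v \<in> V \<and>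
     (\<exists>u'\<in>U. \<bar>u' - v\<bar> < \<bar>u - v\<bar> \<and> (\<forall>v'\<in>V. \<bar>u' - v'\<bar> < \<bar>u' - v\<bar> \<longrightarrow> (u', v') \<in> X))}"

lemma mono_rejected_step: "mono (rejected_step U V)"
  unfolding mono_def rejected_step_def by blast

definition proposals :: "real set \<Rightarrow> real set \<Rightarrow> (real \<times> real) set" where
  "proposals U V = {(u, v). u \<in> U \<and> v \<in> V \<and> (u, v) \<notin> lfp (rejected_step U V) \<and>
     (\<forall>v'\<in>V. \<bar>u - v'\<bar> < \<bar>u - v\<bar> \<longrightarrow> (u, v') \<in> lfp (rejected_step U V))}"

text \<open>\<open>stable_matching\<close> freed of extended reals and descriptions: a pair outside
  \<open>P\<close> cannot improve because one of the two already has a partner at least as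
  near.\<close>

definition weakly_stable :: "real set \<Rightarrow> real set \<Rightarrow> (real \<times> real) set \<Rightarrow> bool" where
  "weakly_stable U V P \<longleftrightarrow> is_matching U V P \<and> (\<forall>u\<in>U. \<forall>v\<in>V. (u, v) \<notin> P \<longrightarrow>
     (\<exists>v'. (u, v') \<in> P \<and> \<bar>u - v'\<bar> \<le> \<bar>u - v\<bar>) \<or> (\<exists>u'. (u', v) \<in> P \<and> \<bar>u' - v\<bar> \<le> \<bar>u - v\<bar>))"

lemma weakly_stableD:
  assumes "weakly_stable U V P" "u \<in> U" "v \<in> V" "(u, v) \<notin> P"
  shows "(\<exists>v'. (u, v') \<in> P \<and> \<bar>u - v'\<bar> \<le> \<bar>u - v\<bar>) \<or> (\<exists>u'. (u', v) \<in> P \<and> \<bar>u' - v\<bar> \<le> \<bar>u - v\<bar>)"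
  using assms by (simp add: weakly_stable_def)

text \<open>If \<open>(u, v)\<close> is not rejected, the nearest \<open>v'\<close> that does not
  reject \<open>u\<close> is matched to it and is no farther than \<open>v\<close>. If it is
  rejected, \<open>v\<close> has received a nearer proposal, and its nearest proposer is never
  rejected. The absence of ties makes both choices unique: a point has one nearest candidate, and of
  two proposers the nearer would reject the other.\<close>

lemma weakly_stable_proposals:
  assumes U: "locally_finite U" and V: "locally_finite V"
    and UV: "no_ties U V" and VU: "no_ties V U"
  shows "weakly_stable U V (proposals U V)"
proof -
  let ?X = "lfp (rejected_step U V)" and ?P = "proposals U V"
  have X: "?X = rejected_step U V ?X"
    by (rule lfp_unfold[OF mono_rejected_step])
  have XE: "(u, v) \<in> ?X \<longleftrightarrow> u \<in> U \<and> v \<in> V \<and>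
     (\<exists>u'\<in>U. \<bar>u' - v\<bar> < \<bar>u - v\<bar> \<and> (\<forall>v'\<in>V. \<bar>u' - v'\<bar> < \<bar>u' - v\<bar> \<longrightarrow> (u', v') \<in> ?X))" for u v
    by (subst X) (simp add: rejected_step_def)
  have PE: "(u, v) \<in> ?P \<longleftrightarrow> u \<in> U \<and> v \<in> V \<and> (u, v) \<notin> ?X \<and>
     (\<forall>v'\<in>V. \<bar>u - v'\<bar> < \<bar>u - v\<bar> \<longrightarrow> (u, v') \<in> ?X)" for u v
    by (simp add: proposals_def)
  have "v = v'" if "(u, v) \<in> ?P" "(u, v') \<in> ?P" for u v v'
    using that UV unfolding PE no_ties_def by (meson linorder_neqE_linordered_idom)
  moreover have "u = u'" if "(u, v) \<in> ?P" "(u', v) \<in> ?P" for u u' v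
  proof -
    have "\<not> \<bar>u - v\<bar> < \<bar>u' - v\<bar>" "\<not> \<bar>u' - v\<bar> < \<bar>u - v\<bar>"
      using that XE[of u v] XE[of u' v] unfolding PE by blast+
    then have "\<bar>v - u\<bar> = \<bar>v - u'\<bar>" by linarith
    then show ?thesis
      using that VU unfolding PE no_ties_def by blast
  qed
  moreover have "?P \<subseteq> U \<times> V"
    by (auto simp: proposals_def)
  ultimately have "is_matching U V ?P"
    unfolding is_matching_def by blast
  moreover have "(\<exists>v'. (u, v') \<in> ?P \<and> \<bar>u - v'\<bar> \<le> \<bar>u - v\<bar>) \<or> (\<exists>u'. (u', v) \<in> ?P \<and> \<bar>u' - v\<bar> \<le> \<bar>u - v\<bar>)"
    if uv: "u \<in> U" "v \<in> V" for u v
  proof (cases "(u, v) \<in> ?X")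
    case False
    obtain v' where v': "v' \<in> V" "(u, v') \<notin> ?X" "\<And>t. t \<in> V \<Longrightarrow> (u, t) \<notin> ?X \<Longrightarrow> \<bar>u - v'\<bar> \<le> \<bar>u - t\<bar>"
      using locally_finite_nearest[where Q="\<lambda>v. (u, v) \<notin> ?X", OF V uv(2) False] by blast
    then have "(u, v') \<in> ?P"
      unfolding PE using uv by force
    then show ?thesis
      using v'(3)[OF uv(2) False] by blast
  next
    case True
    let ?Q = "\<lambda>u'. \<forall>v'\<in>V. \<bar>u' - v'\<bar> < \<bar>u' - v\<bar> \<longrightarrow> (u', v') \<in> ?X"
    obtain u0 where u0: "u0 \<in> U" "\<bar>u0 - v\<bar> < \<bar>u - v\<bar>" "?Q u0"
      using XE True by blast
    obtain u' where u': "u' \<in> U" "?Q u'" "\<And>t. t \<in> U \<Longrightarrow> ?Q t \<Longrightarrow> \<bar>v - u'\<bar> \<le> \<bar>v - t\<bar>"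
      using locally_finite_nearest[where Q="?Q", OF U u0(1,3), of v] by blast
    \<comment> \<open>A rejection would come from a proposer strictly nearer to \<open>v\<close>
      than the nearest one.\<close>
    have "(u', v) \<notin> ?X"
    proof
      assume "(u', v) \<in> ?X"
      then obtain t where "t \<in> U" "\<bar>t - v\<bar> < \<bar>u' - v\<bar>" "?Q t"
        using XE by blast
      with u'(3)[of t] show False by (simp add: abs_minus_commute)
    qed
    then have "(u', v) \<in> ?P"
      unfolding PE using uv u' by blast
    moreover have "\<bar>u' - v\<bar> \<le> \<bar>u - v\<bar>"
      using u'(3)[OF u0(1,3)] u0(2) by (simp add: abs_minus_commute)
    ultimately show ?thesis by blast
  qed
  ultimately show ?thesis
    unfolding weakly_stable_def by blast
qed

lemma mdist_blue_matched: "is_matching U V P \<Longrightarrow> (u, v) \<in> P \<Longrightarrow> mdist_blue P u = ereal \<bar>u - v\<bar>"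
  unfolding mdist_blue_def is_matching_def by (smt (verit, best) the_equality)

lemma mdist_red_matched: "is_matching U V P \<Longrightarrow> (u, v) \<in> P \<Longrightarrow> mdist_red P v = ereal \<bar>v - u\<bar>"
  unfolding mdist_red_def is_matching_def by (smt (verit, best) the_equality)

text \<open>The value \<infinity> of an unmatched point makes both sides true, so unmatched points
  need no separate treatment in \<open>weakly_stable\<close>.\<close>

lemma less_mdist_blue_iff:
  assumes "is_matching U V P"
  shows "ereal d < mdist_blue P u \<longleftrightarrow> \<not> (\<exists>v. (u, v) \<in> P \<and> \<bar>u - v\<bar> \<le> d)"
proof (cases "\<exists>v. (u, v) \<in> P")
  case True
  then obtain v where v: "(u, v) \<in> P" by blast
  then have "\<And>v'. (u, v') \<in> P \<Longrightarrow> v' = v"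
    using assms by (auto simp: is_matching_def)
  then show ?thesis
    unfolding mdist_blue_matched[OF assms v] using v by (metis less_ereal.simps(1) not_le)
next
  case False
  then have "mdist_blue P u = \<infinity>"
    by (auto simp: mdist_blue_def)
  then show ?thesis
    using False by simp
qed

lemma less_mdist_red_iff:
  assumes "is_matching U V P"
  shows "ereal d < mdist_red P v \<longleftrightarrow> \<not> (\<exists>u. (u, v) \<in> P \<and> \<bar>u - v\<bar> \<le> d)"
proof (cases "\<exists>u. (u, v) \<in> P")
  case True
  then obtain u where u: "(u, v) \<in> P" by blast
  then have "\<And>u'. (u', v) \<in> P \<Longrightarrow> u' = u"
    using assms by (auto simp: is_matching_def)
  then show ?thesis
    unfolding mdist_red_matched[OF assms u] using u by (metis less_ereal.simps(1) not_le abs_minus_commute)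
next
  case False
  then have "mdist_red P v = \<infinity>"
    by (auto simp: mdist_red_def)
  then show ?thesis
    using False by simp
qed

lemma stable_matching_iff_weakly_stable: "stable_matching U V P \<longleftrightarrow> weakly_stable U V P"
  unfolding stable_matching_def weakly_stable_def
proof (rule conj_cong[OF refl], intro ball_cong refl imp_cong)
  fix u v assume "is_matching U V P"
  then show "\<not> (ereal \<bar>v - u\<bar> < mdist_red P v \<and> ereal \<bar>v - u\<bar> < mdist_blue P u) \<longleftrightarrow>
    (\<exists>v'. (u, v') \<in> P \<and> \<bar>u - v'\<bar> \<le> \<bar>u - v\<bar>) \<or> (\<exists>u'. (u', v) \<in> P \<and> \<bar>u' - v\<bar> \<le> \<bar>u - v\<bar>)"
    by (simp only: less_mdist_blue_iff less_mdist_red_iff abs_minus_commute[of v u]) blast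
qed

text \<open>Suppose the rays of \<open>u\<close> reach \<open>v\<close> while neither is matched
  earlier, yet the pair is not in \<open>P\<close>. Stability gives one of them a partner at most as
  far, the ray condition one at least as far; equal distances are a tie.\<close>

lemma ray_outcome_stable_matching:
  assumes "stable_matching U V P" and UV: "no_ties U V" and VU: "no_ties V U"
  shows "ray_outcome U V P"
proof -
  have w: "weakly_stable U V P"
    using assms(1) by (simp add: stable_matching_iff_weakly_stable)
  then have mat: "is_matching U V P"
    by (simp add: weakly_stable_def)
  have "(u, v) \<in> P" if uv: "u \<in> U" "v \<in> V" and
    le: "ereal \<bar>v - u\<bar> \<le> mdist_blue P u" "ereal \<bar>v - u\<bar> \<le> mdist_red P v" for u v
  proof (rule ccontr)
    assume n: "(u, v) \<notin> P"
    from w uv n consider v' where "(u, v') \<in> P" "\<bar>u - v'\<bar> \<le> \<bar>u - v\<bar>"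
      | u' where "(u', v) \<in> P" "\<bar>u' - v\<bar> \<le> \<bar>u - v\<bar>"
      unfolding weakly_stable_def by blast
    then show False
    proof cases
      case 1
      with le(1) mdist_blue_matched[OF mat 1(1)] have "\<bar>u - v'\<bar> = \<bar>u - v\<bar>"
        by (simp add: abs_minus_commute)
      moreover have "v' \<in> V"
        using mat 1 by (auto simp: is_matching_def)
      ultimately show False
        using UV uv 1 n unfolding no_ties_def by blast
    next
      case 2
      with le(2) mdist_red_matched[OF mat 2(1)] have "\<bar>v - u'\<bar> = \<bar>v - u\<bar>"
        by (simp add: abs_minus_commute)
      moreover have "u' \<in> U"
        using mat 2 by (auto simp: is_matching_def)
      ultimately show False
        using VU uv 2 n unfolding no_ties_def by blast
    qed
  qed
  then show ?thesis
    using mat unfolding ray_outcome_def by blast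
qed

text \<open>The choice in \<open>Ms\<close> is governed by its defining property only after a
  witness is supplied; the proposals are the witness.\<close>

lemma weakly_stable_Ms:
  assumes "locally_finite U" "locally_finite V" "no_ties U V" "no_ties V U"
  shows "weakly_stable U V (Ms U V)"
proof -
  have "stable_matching U V (proposals U V)"
    using weakly_stable_proposals assms by (simp add: stable_matching_iff_weakly_stable)
  then have "\<exists>P. stable_matching U V P \<and> ray_outcome U V P"
    using ray_outcome_stable_matching assms by blast
  then show ?thesis
    unfolding Ms_def using someI_ex stable_matching_iff_weakly_stable by (metis (mono_tags, lifting))
qed

text \<open>Stability is symmetric in the two colours, so each statement about partners of one
  colour yields its mirror image.\<close>

lemma weakly_stable_converse:
  assumes "weakly_stable U V P"
  shows "weakly_stable V U (P\<inverse>)"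
  unfolding weakly_stable_def
proof (intro conjI ballI impI)
  show "is_matching V U (P\<inverse>)"
    using assms unfolding weakly_stable_def is_matching_def by blast
  fix v u assume "v \<in> V" "u \<in> U" "(v, u) \<notin> P\<inverse>"
  then have "(\<exists>v'. (u, v') \<in> P \<and> \<bar>u - v'\<bar> \<le> \<bar>u - v\<bar>) \<or> (\<exists>u'. (u', v) \<in> P \<and> \<bar>u' - v\<bar> \<le> \<bar>u - v\<bar>)"
    using weakly_stableD[OF assms] by simp
  then show "(\<exists>u'. (v, u') \<in> P\<inverse> \<and> \<bar>v - u'\<bar> \<le> \<bar>v - u\<bar>) \<or> (\<exists>v'. (v', u) \<in> P\<inverse> \<and> \<bar>v' - u\<bar> \<le> \<bar>v - u\<bar>)"
    unfolding converse_iff by (metis abs_minus_commute)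
qed

section \<open>Nested partners and the balance between them\<close>

definition strictly_between :: "real \<Rightarrow> real \<Rightarrow> real set" where
  "strictly_between x y = {min x y<..<max x y}"

lemma strictly_between_commute: "strictly_between x y = strictly_between y x"
  by (auto simp: strictly_between_def)

text \<open>\<open>u\<close> prefers \<open>v'\<close> to its partner \<open>v\<close>, so
  \<open>v'\<close> has a partner \<open>u'\<close> at least as near as \<open>u\<close>. Were
  \<open>u'\<close> outside the interval, it would lie beyond \<open>v\<close>; then
  \<open>u'\<close> would prefer \<open>v\<close> to \<open>v'\<close>, and \<open>v\<close> would
  prefer \<open>u'\<close> to \<open>u\<close>, a blocking pair.\<close>

lemma weakly_stable_nested:
  assumes w: "weakly_stable U V P" and dj: "U \<inter> V = {}"
    and uv: "(u, v) \<in> P" and v': "v' \<in> V" "v' \<in> strictly_between u v"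
  shows "\<exists>u'\<in>strictly_between u v. (u', v') \<in> P"
proof -
  have mat: "is_matching U V P"
    using w by (simp add: weakly_stable_def)
  have UV: "u \<in> U" "v \<in> V"
    using mat uv by (auto simp: is_matching_def)
  have d: "\<bar>u - v'\<bar> < \<bar>u - v\<bar>" "\<bar>v - v'\<bar> < \<bar>u - v\<bar>" "v' \<noteq> v"
    using v' by (auto simp: strictly_between_def)
  have n: "(u, v') \<notin> P"
    using mat uv d(3) by (auto simp: is_matching_def)
  have "\<not> (\<exists>t. (u, t) \<in> P \<and> \<bar>u - t\<bar> \<le> \<bar>u - v'\<bar>)"
    using mat uv d(1) unfolding is_matching_def by (metis not_le)
  then obtain u' where u': "(u', v') \<in> P" "\<bar>u' - v'\<bar> \<le> \<bar>u - v'\<bar>"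
    using w UV v' n unfolding weakly_stable_def by blast
  have "u' \<in> U" using u' mat by (auto simp: is_matching_def)
  have ne: "u' \<noteq> u" "u' \<noteq> v"
    using u' n dj UV \<open>u' \<in> U\<close> by auto
  have n2: "(u', v) \<notin> P"
    using mat u' d(3) by (auto simp: is_matching_def)
  have "(\<exists>t. (u', t) \<in> P \<and> \<bar>u' - t\<bar> \<le> \<bar>u' - v\<bar>) \<or> (\<exists>t. (t, v) \<in> P \<and> \<bar>t - v\<bar> \<le> \<bar>u' - v\<bar>)"
    using w \<open>u' \<in> U\<close> UV n2 unfolding weakly_stable_def by blast
  then have "\<bar>u' - v'\<bar> \<le> \<bar>u' - v\<bar> \<or> \<bar>u - v\<bar> \<le> \<bar>u' - v\<bar>"
    using mat u' uv unfolding is_matching_def by metis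
  then have "u' \<in> strictly_between u v"
    using u'(2) ne d v'(2) unfolding strictly_between_def by (auto simp: abs_if min_def max_def split: if_splits)
  then show ?thesis
    using u' by blast
qed

lemma weakly_stable_nested':
  assumes w: "weakly_stable U V P" and dj: "U \<inter> V = {}"
    and uv: "(u, v) \<in> P" and u': "u' \<in> U" "u' \<in> strictly_between u v"
  shows "\<exists>v'\<in>strictly_between u v. (u', v') \<in> P"
  using weakly_stable_nested[OF weakly_stable_converse[OF w], of v u u'] assms
  by (auto simp: strictly_between_commute)

lemma finite_locally_finite_Ioo [intro]:
  "locally_finite S \<Longrightarrow> finite (S \<inter> {a<..<b})" "locally_finite S \<Longrightarrow> finite (S \<inter> {a<..b})"
  "locally_finite S \<Longrightarrow> finite (S \<inter> {a..<b})"
  unfolding locally_finite_def by (auto intro: finite_subset[of _ "S \<inter> {a..b}"])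

text \<open>Nesting in both directions makes the matching a bijection between the points of the two
  colours strictly inside.\<close>

lemma weakly_stable_balanced:
  assumes w: "weakly_stable U V P" and dj: "U \<inter> V = {}"
    and fin: "locally_finite U" "locally_finite V" and uv: "(u, v) \<in> P"
  shows "card (U \<inter> strictly_between u v) = card (V \<inter> strictly_between u v)"
proof -
  have mat: "is_matching U V P"
    using w by (simp add: weakly_stable_def)
  let ?I = "strictly_between u v"
  have fin': "finite (U \<inter> ?I)" "finite (V \<inter> ?I)"
    using fin by (auto simp: strictly_between_def)
  let ?f = "\<lambda>x. THE y. (x, y) \<in> P"
  have f: "?f x = y" if "(x, y) \<in> P" for x y
    using that mat unfolding is_matching_def by blast
  have "bij_betw ?f (U \<inter> ?I) (V \<inter> ?I)"
    unfolding bij_betw_def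
  proof
    show "inj_on ?f (U \<inter> ?I)"
    proof (rule inj_onI)
      fix x y assume "x \<in> U \<inter> ?I" "y \<in> U \<inter> ?I" and e: "?f x = ?f y"
      then obtain x' y' where "(x, x') \<in> P" "(y, y') \<in> P"
        using weakly_stable_nested'[OF w dj uv] by blast
      with e f mat show "x = y" unfolding is_matching_def by metis
    qed
    show "?f ` (U \<inter> ?I) = V \<inter> ?I"
    proof (intro set_eqI iffI)
      fix y assume "y \<in> ?f ` (U \<inter> ?I)"
      then obtain x where x: "x \<in> U" "x \<in> ?I" "y = ?f x" by blast
      then obtain y' where "y' \<in> ?I" "(x, y') \<in> P"
        using weakly_stable_nested'[OF w dj uv] by blast
      with x f mat show "y \<in> V \<inter> ?I" unfolding is_matching_def by auto
    next
      fix y assume "y \<in> V \<inter> ?I"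
      then obtain x where "x \<in> ?I" "(x, y) \<in> P"
        using weakly_stable_nested[OF w dj uv] by blast
      with f mat show "y \<in> ?f ` (U \<inter> ?I)"
        unfolding is_matching_def by (auto intro!: image_eqI[of _ _ x])
    qed
  qed
  then show ?thesis
    by (rule bij_betw_same_card)
qed

text \<open>The path S of the overview when \<open>U\<close> is blue and \<open>V\<close> is red.
  The interval is open at 0, so the added blue point is not counted, and closed at \<open>t\<close>,
  so the path is right-continuous.\<close>

definition excess :: "real set \<Rightarrow> real set \<Rightarrow> real \<Rightarrow> int" where
  "excess U V t = int (card (V \<inter> {0<..t})) - int (card (U \<inter> {0<..t}))"

lemma excess_insert_0 [simp]: "excess (insert 0 U) V t = excess U V t"
  by (simp add: excess_def)

text \<open>The two colours balance strictly between 0 and \<open>r\<close>, and the red point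
  \<open>r\<close> itself contributes the 1.\<close>

lemma excess_at_match:
  assumes w: "weakly_stable U V P" and dj: "U \<inter> V = {}"
    and fin: "locally_finite U" "locally_finite V" and uv: "(0, r) \<in> P" and r: "0 < r"
  shows "excess U V r = 1" and "s0 < r \<Longrightarrow> \<exists>s>s0. s < r \<and> excess U V s = 0"
proof -
  have rV: "r \<in> V" "r \<notin> U"
    using w uv dj by (auto simp: weakly_stable_def is_matching_def)
  have eq: "card (U \<inter> {0<..<r}) = card (V \<inter> {0<..<r})"
    using weakly_stable_balanced[OF w dj fin uv] r by (simp add: strictly_between_def)
  have "U \<inter> {0<..r} = U \<inter> {0<..<r}" "V \<inter> {0<..r} = insert r (V \<inter> {0<..<r})"
    using rV r by (auto simp: less_le)
  moreover have "finite (V \<inter> {0<..<r})"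
    using fin by auto
  ultimately show "excess U V r = 1"
    using eq by (simp add: excess_def)
  have finUV: "finite ((U \<union> V) \<inter> {0<..<r})"
    using fin by (auto simp: Int_Un_distrib2)
  \<comment> \<open>The last point before \<open>r\<close>, or the midpoint between
    \<open>max s0 0\<close> and \<open>r\<close> if that is later: the path keeps its value from
    here up to \<open>r\<close>.\<close>
  define s where "s = Max (insert ((max s0 0 + r) / 2) ((U \<union> V) \<inter> {0<..<r}))"
  have "s0 < s \<and> s < r \<and> excess U V s = 0" if "s0 < r"
  proof -
    have ge: "(max s0 0 + r) / 2 \<le> s" "\<And>x. x \<in> (U \<union> V) \<inter> {0<..<r} \<Longrightarrow> x \<le> s"
      unfolding s_def using finUV by (blast intro: Max_ge finite.insertI)+
    have "s < r"
      unfolding s_def using finUV that r by auto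
    moreover have "s0 < s"
      using ge(1) that r by (auto simp: max_def split: if_splits)
    moreover have "U \<inter> {0<..s} = U \<inter> {0<..<r}" "V \<inter> {0<..s} = V \<inter> {0<..<r}"
      using ge(2) \<open>s < r\<close> by auto
    ultimately show ?thesis
      using eq by (simp add: excess_def)
  qed
  then show "s0 < r \<Longrightarrow> \<exists>s>s0. s < r \<and> excess U V s = 0" by blast
qed

text \<open>An unmatched 0 is available to everybody, so each \<open>v > 0\<close> has a partner
  within distance \<open>v\<close>, hence a positive one. As \<open>V\<close> outnumbers
  \<open>U\<close> in (0,T], some \<open>x\<close> there has its partner \<open>y\<close> beyond
  \<open>T\<close>. For the leftmost such \<open>x\<close>, the points of \<open>V\<close> before
  \<open>x\<close> are matched before \<open>x\<close>, the points between \<open>x\<close> and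
  \<open>y\<close> balance, and \<open>x\<close>, \<open>y\<close> cancel; so \<open>V\<close> does
  not outnumber \<open>U\<close> up to \<open>y\<close>.\<close>

lemma unmatched_excess:
  assumes w: "weakly_stable U V P" and dj: "U \<inter> V = {}"
    and fin: "locally_finite U" "locally_finite V"
    and 0: "0 \<in> U" "\<And>v. (0, v) \<notin> P" and T: "0 < T" "1 \<le> excess U V T"
  shows "\<exists>y>T. excess U V y \<le> 0"
proof (rule ccontr)
  assume "\<not> ?thesis"
  then have pos: "1 \<le> excess U V y" if "T \<le> y" for y
    using T that by (cases "y = T") (auto simp: not_le order_le_less)
  have mat: "is_matching U V P"
    using w by (simp add: weakly_stable_def)
  define f where "f v = (THE u. (u, v) \<in> P)" for v
  have f: "f v = u" if "(u, v) \<in> P" for u v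
    unfolding f_def using that mat unfolding is_matching_def by blast
  have fV: "f v \<in> U" "(f v, v) \<in> P" "0 < f v" if v: "v \<in> V" "0 < v" for v
  proof -
    obtain u where u: "(u, v) \<in> P" "\<bar>u - v\<bar> \<le> \<bar>0 - v\<bar>"
      using weakly_stableD[OF w 0(1) v(1) 0(2)] 0(2) by blast
    moreover have "u \<noteq> 0" "u \<in> U"
      using u 0 mat by (auto simp: is_matching_def)
    ultimately show "f v \<in> U" "(f v, v) \<in> P" "0 < f v"
      using f[OF u(1)] v by auto
  qed
  have injf: "inj_on f (V \<inter> {0<..})"
    using fV mat unfolding inj_on_def is_matching_def by (metis IntE greaterThan_iff)
  have cardle: "card (V \<inter> A) \<le> card (U \<inter> B)" if "A \<subseteq> {0<..}" "finite (U \<inter> B)" "f ` (V \<inter> A) \<subseteq> B" for A B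
  proof -
    have "inj_on f (V \<inter> A)"
      using injf by (rule inj_on_subset) (use that in auto)
    moreover have "f ` (V \<inter> A) \<subseteq> U \<inter> B"
      using that fV by auto
    ultimately show ?thesis
      using card_inj_on_le[OF _ _ that(2)] by blast
  qed
  let ?C = "{x \<in> V \<inter> {0<..T}. T < f x}"
  have "?C \<noteq> {}"
  proof
    assume "?C = {}"
    then have "f ` (V \<inter> {0<..T}) \<subseteq> {0<..T}"
      using fV by fastforce
    then have "card (V \<inter> {0<..T}) \<le> card (U \<inter> {0<..T})"
      using fin by (intro cardle) auto
    then show False
      using T by (simp add: excess_def)
  qed
  moreover have "finite ?C"
    using finite_locally_finite_Ioo(2)[OF fin(2)] by (rule finite_subset[rotated]) blast
  \<comment> \<open>The leftmost escaping point: minimality is what confines the partners of all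
    earlier points of \<open>V\<close> to (0,T].\<close>
  ultimately obtain x where x: "x \<in> ?C" "\<And>z. z \<in> ?C \<Longrightarrow> x \<le> z"
    using that[OF Min_in Min_le] by blast
  define y where "y = f x"
  have xy: "x \<in> V" "0 < x" "x \<le> T" "T < y" "(y, x) \<in> P" "y \<in> U"
    using x fV by (auto simp: y_def)
  have bt: "strictly_between y x = {x<..<y}"
    using xy by (auto simp: strictly_between_def)
  have bal: "card (U \<inter> {x<..<y}) = card (V \<inter> {x<..<y})"
    using weakly_stable_balanced[OF w dj fin xy(5)] bt by simp
  \<comment> \<open>Such a partner is at most \<open>T < y\<close> by minimality, differs from
    \<open>x\<close> in colour, and by nesting cannot lie between \<open>x\<close> and
    \<open>y\<close>.\<close>
  have "f ` (V \<inter> {0<..<x}) \<subseteq> {0<..<x}"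
  proof
    fix u assume "u \<in> f ` (V \<inter> {0<..<x})"
    then obtain v where v: "v \<in> V" "0 < v" "v < x" "u = f v" by auto
    note fv = fV[OF v(1,2)]
    have "\<not> T < u"
      using x(2)[of v] v xy by auto
    moreover have "u \<noteq> x"
      using fv v dj xy by auto
    moreover have "\<not> (x < u \<and> u < y)"
    proof
      assume "x < u \<and> u < y"
      then obtain v' where "v' \<in> strictly_between y x" "(u, v') \<in> P"
        using weakly_stable_nested'[OF w dj xy(5), of u] bt fv v by auto
      moreover have "v' = v"
        using \<open>(u, v') \<in> P\<close> fv v mat unfolding is_matching_def by blast
      ultimately show False
        using bt v by auto
    qed
    ultimately show "u \<in> {0<..<x}"
      using fv v xy by auto
  qed
  then have le: "card (V \<inter> {0<..<x}) \<le> card (U \<inter> {0<..<x})"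
    using fin by (intro cardle) auto
  have V: "V \<inter> {0<..y} = insert x (V \<inter> {0<..<x} \<union> V \<inter> {x<..<y})"
   and U: "U \<inter> {0<..y} = insert y (U \<inter> {0<..<x} \<union> U \<inter> {x<..<y})"
    using xy dj by (auto simp: less_le)
  have "card (V \<inter> {0<..y}) = Suc (card (V \<inter> {0<..<x}) + card (V \<inter> {x<..<y}))"
    unfolding V using fin by (subst card_insert_disjoint) (auto intro!: card_Un_disjoint)
  moreover have "card (U \<inter> {0<..y}) = Suc (card (U \<inter> {0<..<x}) + card (U \<inter> {x<..<y}))"
    unfolding U using fin by (subst card_insert_disjoint) (use xy in \<open>auto intro!: card_Un_disjoint\<close>)
  ultimately have "excess U V y \<le> 0"
    using le bal by (simp add: excess_def)
  then show False
    using pos[of y] xy by simp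
qed

text \<open>Reflection moves a partner on the left of 0 to the right, so that the one-sided lemmas
  serve both sides.\<close>

lemma weakly_stable_uminus:
  assumes "weakly_stable U V P"
  shows "weakly_stable (uminus ` U) (uminus ` V) ((\<lambda>(u, v). (- u, - v)) ` P)"
proof -
  have iff: "(u, v) \<in> (\<lambda>(u, v). (- u, - v)) ` P \<longleftrightarrow> (- u, - v) \<in> P" for u v
    by (force simp: image_iff)
  have iff': "u \<in> uminus ` A \<longleftrightarrow> - u \<in> A" for u :: real and A
    by (force simp: image_iff)
  have *: "\<bar>- u - - v\<bar> = \<bar>u - v\<bar>" for u v :: real by simp
  show ?thesis
    unfolding weakly_stable_def
  proof
    show "is_matching (uminus ` U) (uminus ` V) ((\<lambda>(u, v). (- u, - v)) ` P)"
      using assms unfolding weakly_stable_def is_matching_def iff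
      by (auto simp: iff) (metis minus_minus)+
    show "\<forall>u\<in>uminus ` U. \<forall>v\<in>uminus ` V. (u, v) \<notin> (\<lambda>(u, v). (- u, - v)) ` P \<longrightarrow>
      (\<exists>v'. (u, v') \<in> (\<lambda>(u, v). (- u, - v)) ` P \<and> \<bar>u - v'\<bar> \<le> \<bar>u - v\<bar>) \<or>
      (\<exists>u'. (u', v) \<in> (\<lambda>(u, v). (- u, - v)) ` P \<and> \<bar>u' - v\<bar> \<le> \<bar>u - v\<bar>)"
      unfolding iff
    proof (intro ballI impI)
      fix u v assume "u \<in> uminus ` U" "v \<in> uminus ` V" "(- u, - v) \<notin> P"
      then have "(\<exists>v'. (- u, v') \<in> P \<and> \<bar>- u - v'\<bar> \<le> \<bar>- u - - v\<bar>) \<or> (\<exists>u'. (u', - v) \<in> P \<and> \<bar>u' - - v\<bar> \<le> \<bar>- u - - v\<bar>)"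
        using assms unfolding weakly_stable_def iff' by blast
      then show "(\<exists>v'. (- u, - v') \<in> P \<and> \<bar>u - v'\<bar> \<le> \<bar>u - v\<bar>) \<or> (\<exists>u'. (- u', - v) \<in> P \<and> \<bar>u' - v\<bar> \<le> \<bar>u - v\<bar>)"
        by (metis * minus_minus)
    qed
  qed
qed


text \<open>The deterministic part of the theorem. Later \<open>a\<close> and \<open>b\<close> are
  passage times on the right and on the left: to level 1 for the lower bound, to the last record
  level for the upper one.\<close>

lemma mdist_blue_bounds:
  fixes U V :: "real set"
  defines "X \<equiv> mdist_blue (Ms (insert 0 U) V) 0"
  assumes fin: "locally_finite U" "locally_finite V" and dj: "insert 0 U \<inter> V = {}"
    and ties: "no_ties (insert 0 U) V" "no_ties V (insert 0 U)"
  shows mdist_blue_ge: "(\<And>t. 0 < t \<Longrightarrow> excess U V t = 1 \<Longrightarrow> a \<le> t) \<Longrightarrow>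
      (\<And>t. 0 < t \<Longrightarrow> excess (uminus ` U) (uminus ` V) t = 1 \<Longrightarrow> b \<le> t) \<Longrightarrow> ereal (min a b) \<le> X"
    and mdist_blue_le: "0 < a \<Longrightarrow> 0 < b \<Longrightarrow> (\<And>t. a \<le> t \<Longrightarrow> 1 \<le> excess U V t) \<Longrightarrow>
      (\<And>t. b \<le> t \<Longrightarrow> 1 \<le> excess (uminus ` U) (uminus ` V) t) \<Longrightarrow> X \<le> ereal (max a b)"
proof -
  let ?P = "Ms (insert 0 U) V" and ?U = "insert 0 U"
  let ?P' = "(\<lambda>(u, v). (- u, - v)) ` ?P"
  have fin0: "locally_finite ?U"
    using fin(1) by (rule locally_finite_insert)
  have w: "weakly_stable ?U V ?P"
    using fin0 fin ties by (intro weakly_stable_Ms)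
  then have mat: "is_matching ?U V ?P"
    by (simp add: weakly_stable_def)
  have w': "weakly_stable (insert 0 (uminus ` U)) (uminus ` V) ?P'"
    using weakly_stable_uminus[OF w] by simp
  have dj': "insert 0 (uminus ` U) \<inter> uminus ` V = {}"
    using dj by auto
  have fin': "locally_finite (insert 0 (uminus ` U))" "locally_finite (uminus ` V)"
    using fin by (auto intro: locally_finite_uminus locally_finite_insert)
  have P': "(0, - r) \<in> ?P'" if "(0, r) \<in> ?P" for r
    using that by force
  have ne: "r \<noteq> 0" if "(0, r) \<in> ?P" for r
    using that mat dj by (auto simp: is_matching_def)
  note M = excess_at_match[OF w dj fin0 fin(2), simplified excess_insert_0]
    excess_at_match[OF w' dj' fin', simplified excess_insert_0]
  show "ereal (min a b) \<le> X" if a: "\<And>t. 0 < t \<Longrightarrow> excess U V t = 1 \<Longrightarrow> a \<le> t"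
    and b: "\<And>t. 0 < t \<Longrightarrow> excess (uminus ` U) (uminus ` V) t = 1 \<Longrightarrow> b \<le> t"
  proof (cases "\<exists>r. (0, r) \<in> ?P")
    case True
    then obtain r where r: "(0, r) \<in> ?P" by blast
    have "min a b \<le> \<bar>r\<bar>"
    proof (cases "0 < r")
      case True
      then show ?thesis
        using a[OF True M(1)[OF r True]] by simp
    next
      case False
      then have "0 < - r" using ne[OF r] by simp
      then show ?thesis
        using b[OF _ M(3)[OF P'[OF r]]] by simp
    qed
    then show ?thesis
      unfolding X_def using mdist_blue_matched[OF mat r] by (simp del: ereal_min ereal_max)
  next
    case False
    then show ?thesis
      by (simp add: X_def mdist_blue_def)
  qed
  show "X \<le> ereal (max a b)" if ab: "0 < a" "0 < b"
    and a: "\<And>t. a \<le> t \<Longrightarrow> 1 \<le> excess U V t"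
    and b: "\<And>t. b \<le> t \<Longrightarrow> 1 \<le> excess (uminus ` U) (uminus ` V) t"
  proof (cases "\<exists>r. (0, r) \<in> ?P")
    case True
    then obtain r where r: "(0, r) \<in> ?P" by blast
    have "\<bar>r\<bar> \<le> max a b"
    proof (cases "0 < r")
      case True
      have "\<not> a < r"
      proof
        assume "a < r"
        from M(2)[OF r True this] obtain s where "a < s" "excess U V s = 0" by blast
        with a[of s] show False by simp
      qed
      then show ?thesis
        using True by simp
    next
      case False
      then have r': "0 < - r" using ne[OF r] by simp
      have "\<not> b < - r"
      proof
        assume "b < - r"
        from M(4)[OF P'[OF r] r' this] obtain s where "b < s" "excess (uminus ` U) (uminus ` V) s = 0" by blast
        with b[of s] show False by simp
      qed
      then show ?thesis
        using r' by simp
    qed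
    then show ?thesis
      unfolding X_def using mdist_blue_matched[OF mat r] by (simp del: ereal_min ereal_max)
  next
    case False
    \<comment> \<open>An unmatched 0 already contradicts the behaviour on the right after
      \<open>a\<close>; the left side is not consulted.\<close>
    then have "\<exists>y>a. excess ?U V y \<le> 0"
      using a[of a] ab by (intro unmatched_excess[OF w dj fin0 fin(2)]) auto
    then obtain y where "a < y" "excess U V y \<le> 0" by auto
    then show ?thesis
      using a[of y] by simp
  qed
qed

section \<open>Four independent Poisson processes\<close>

text \<open>The limit event is the lower limit of the \<open>E n\<close>, hence measurable, and its
  indicator is a pointwise limit of bounded indicators. Every later passage from shifted intervals,
  dyadic times or finite time sets to the limit goes through this.\<close>

lemma (in prob_space) prob_eventually_eq:
  assumes E: "\<And>n. E n \<in> events" and E': "E' \<subseteq> space M"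
    and ev: "\<And>\<omega>. \<omega> \<in> space M \<Longrightarrow> \<forall>\<^sub>F n in sequentially. \<omega> \<in> E n \<longleftrightarrow> \<omega> \<in> E'"
  shows events_eventually_eq: "E' \<in> events" and "(\<lambda>n. prob (E n)) \<longlonglongrightarrow> prob E'"
proof -
  have "E' = (\<Union>k. \<Inter>n\<in>{k..}. E n)"
  proof (intro set_eqI iffI)
    fix \<omega> assume "\<omega> \<in> E'"
    then have "\<forall>\<^sub>F n in sequentially. \<omega> \<in> E n"
      using ev[OF subsetD[OF E']] by (auto elim: eventually_mono)
    then show "\<omega> \<in> (\<Union>k. \<Inter>n\<in>{k..}. E n)"
      by (auto simp: eventually_sequentially)
  next
    fix \<omega> assume *: "\<omega> \<in> (\<Union>k. \<Inter>n\<in>{k..}. E n)"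
    then have "\<forall>\<^sub>F n in sequentially. \<omega> \<in> E n"
      by (auto simp: eventually_sequentially)
    moreover have "\<omega> \<in> space M"
      using * E sets.sets_into_space by blast
    ultimately have "\<forall>\<^sub>F n in sequentially. \<omega> \<in> E n \<and> (\<omega> \<in> E n \<longleftrightarrow> \<omega> \<in> E')"
      using ev by (intro eventually_conj)
    then show "\<omega> \<in> E'"
      using eventually_happens'[OF sequentially_bot] by blast
  qed
  also have "\<dots> \<in> events"
    using E by (intro sets.countable_UN' sets.countable_INT') auto
  finally show E'_ev: "E' \<in> events" .
  have "(\<lambda>n. \<integral>\<omega>. indicator (E n) \<omega> \<partial>M) \<longlonglongrightarrow> (\<integral>\<omega>. indicat_real E' \<omega> \<partial>M)"
  proof (rule integral_dominated_convergence[where w="\<lambda>_. 1"])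
    show "AE \<omega> in M. (\<lambda>n. indicat_real (E n) \<omega>) \<longlonglongrightarrow> indicator E' \<omega>"
    proof (rule AE_I2)
      fix \<omega> assume "\<omega> \<in> space M"
      from ev[OF this] show "(\<lambda>n. indicat_real (E n) \<omega>) \<longlonglongrightarrow> indicator E' \<omega>"
        by (intro tendsto_eventually) (auto elim!: eventually_mono simp: indicator_def)
    qed
  qed (use E E'_ev in auto)
  then show "(\<lambda>n. prob (E n)) \<longlonglongrightarrow> prob E'"
    using E E'_ev sets.sets_into_space by (simp add: Int_absorb1 Int_absorb2)
qed

lemma (in prob_space) indep_vars_reindex:
  assumes "indep_vars M' X (h ` I)" and h: "inj_on h I"
  shows "indep_vars (\<lambda>i. M' (h i)) (\<lambda>i. X (h i)) I"
proof -
  let ?F = "\<lambda>k. {X k -` A \<inter> space M | A. A \<in> sets (M' k)}"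
  have ind: "indep_sets ?F (h ` I)"
    using assms unfolding indep_vars_def2 by auto
  have "indep_sets (\<lambda>i. ?F (h i)) I"
  proof (rule indep_setsI)
    fix i assume "i \<in> I"
    then show "?F (h i) \<subseteq> events"
      using ind unfolding indep_sets_def by blast
  next
    fix A J assume J: "J \<noteq> {}" "J \<subseteq> I" "finite J" "\<forall>j\<in>J. A j \<in> ?F (h j)"
    let ?B = "\<lambda>k. A (the_inv_into J h k)"
    have hJ: "inj_on h J" using h J(2) by (rule inj_on_subset)
    then have B: "?B (h j) = A j" if "j \<in> J" for j
      using that by (simp add: the_inv_into_f_f)
    have "prob (\<Inter>k\<in>h ` J. ?B k) = (\<Prod>k\<in>h ` J. prob (?B k))"
      using J B by (intro indep_setsD[OF ind]) auto
    also have "(\<Inter>k\<in>h ` J. ?B k) = (\<Inter>j\<in>J. A j)"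
      using B by simp
    also have "(\<Prod>k\<in>h ` J. prob (?B k)) = (\<Prod>j\<in>J. prob (A j))"
      using hJ B by (simp add: prod.reindex)
    finally show "prob (\<Inter>j\<in>J. A j) = (\<Prod>j\<in>J. prob (A j))" .
  qed
  then show ?thesis
    using assms unfolding indep_vars_def2 by auto
qed

lemma card_uminus_Int_Ioc: "card (uminus ` S \<inter> {a<..b}) = card (S \<inter> {- b..<- a :: real})"
proof -
  have "uminus ` S \<inter> {a<..b} = uminus ` (S \<inter> {- b..<- a})"
    by force
  then show ?thesis
    by (simp add: card_image)
qed

text \<open>For a fixed point \<open>y\<close> the strict condition c - 1/(n+1) < y eventually means
  c \<le> y, so open and closed ends change places. All shifted intervals lie in [a-1,b], which
  holds only finitely many points of \<open>S\<close>.\<close>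

lemma eventually_shift_Int:
  fixes a b :: real
  assumes S: "locally_finite S"
  shows "\<forall>\<^sub>F n in sequentially. S \<inter> {a - 1 / real (Suc n)<..b - 1 / real (Suc n)} = S \<inter> {a..<b}"
proof -
  have lim: "(\<lambda>n. c - 1 / real (Suc n)) \<longlonglongrightarrow> c" for c :: real
    using tendsto_diff[OF tendsto_const LIMSEQ_inverse_real_of_nat, of c] by (simp add: inverse_eq_divide)
  have ev: "\<forall>\<^sub>F n in sequentially. c - 1 / real (Suc n) < y \<longleftrightarrow> c \<le> y" for c y :: real
  proof (cases "c \<le> y")
    case True
    have "c - 1 / real (Suc n) < y" for n
      using True by (smt (verit) divide_pos_pos of_nat_0_less_iff zero_less_Suc)
    then show ?thesis using True by simp
  next
    case False
    then show ?thesis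
      using order_tendstoD(1)[OF lim, of y c] by (auto elim!: eventually_mono)
  qed
  have "\<forall>\<^sub>F n in sequentially. \<forall>y\<in>S \<inter> {a - 1..b}.
      (a - 1 / real (Suc n) < y \<longleftrightarrow> a \<le> y) \<and> (b - 1 / real (Suc n) < y \<longleftrightarrow> b \<le> y)"
    using S unfolding locally_finite_def by (intro eventually_ball_finite ballI eventually_conj ev) auto
  then show ?thesis
  proof (rule eventually_mono)
    fix n assume *: "\<forall>y\<in>S \<inter> {a - 1..b}.
      (a - 1 / real (Suc n) < y \<longleftrightarrow> a \<le> y) \<and> (b - 1 / real (Suc n) < y \<longleftrightarrow> b \<le> y)"
    define d where "d = 1 / real (Suc n)"
    have **: "0 < d" "d \<le> 1" by (simp_all add: d_def)
    have "y \<in> S \<inter> {a - d<..b - d} \<longleftrightarrow> y \<in> S \<inter> {a..<b}" for y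
      using *[folded d_def, rule_format, of y] ** by (cases "y \<in> S \<inter> {a - 1..b}") auto
    then have "S \<inter> {a - d<..b - d} = S \<inter> {a..<b}" by blast
    then show "S \<inter> {a - 1 / real (Suc n)<..b - 1 / real (Suc n)} = S \<inter> {a..<b}"
      by (simp only: d_def)
  qed
qed

section \<open>Counts of the two colours on the two half lines\<close>

locale poisson_matching =
  fixes M :: "'a measure" and l m :: real and Bl Rd :: "'a \<Rightarrow> real set"
  assumes l_pos: "0 < l" and m_pos: "0 < m"
    and problem: "poisson_matching_problem M l m Bl Rd"
begin

sublocale prob_space M
  using problem by (simp add: poisson_matching_problem_def)

definition colour :: "bool \<Rightarrow> 'a \<Rightarrow> real set" where
  "colour c \<omega> = (if c then Bl \<omega> else Rd \<omega>)"

definition rate :: "bool \<Rightarrow> real" where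
  "rate c = (if c then l else m)"

text \<open>Reflecting the points to the left of 0 turns the problem into four processes on the positive
half line. The reflection exchanges the two kinds of half-open intervals, so that the law of
the left half is obtained as a limit of shifted intervals.\<close>

definition half :: "bool \<Rightarrow> bool \<Rightarrow> 'a \<Rightarrow> real set" where
  "half s c \<omega> = (if s then colour c \<omega> else uminus ` colour c \<omega>)"

lemma rate_pos: "0 < rate c"
  using l_pos m_pos by (simp add: rate_def)

lemma locally_finite_colour: "\<omega> \<in> space M \<Longrightarrow> locally_finite (colour c \<omega>)"
  using problem by (simp add: poisson_matching_problem_def colour_def)

lemma indep_colour:
  fixes a b :: "nat \<Rightarrow> real"
  assumes "finite I" "\<And>i. i \<in> I \<Longrightarrow> a i < b i"
    "\<And>i j. i \<in> I \<Longrightarrow> j \<in> I \<Longrightarrow> i \<noteq> j \<Longrightarrow> {a i<..b i} \<inter> {a j<..b j} = {}"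
  shows "indep_vars (\<lambda>_. count_space UNIV) (\<lambda>(c, i) \<omega>. card (colour c \<omega> \<inter> {a i<..b i})) (UNIV \<times> I)"
  unfolding colour_def
  by (rule problem[unfolded poisson_matching_problem_def, THEN conjunct2, THEN conjunct2, THEN conjunct1, rule_format])
    (use assms in auto)

lemma distr_colour:
  "a < b \<Longrightarrow> distr M (count_space UNIV) (\<lambda>\<omega>. card (colour c \<omega> \<inter> {a<..b})) = measure_pmf (poisson_pmf (rate c * (b - a)))"
  using problem unfolding poisson_matching_problem_def colour_def rate_def by auto

text \<open>Measurability of the counts is read off from the independence clause of the problem,
  which contains it.\<close>

lemma measurable_colour [measurable]:
  "(\<lambda>\<omega>. card (colour c \<omega> \<inter> {a<..b})) \<in> measurable M (count_space UNIV)"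
proof (cases "a < b")
  case True
  then have "indep_vars (\<lambda>_. count_space UNIV) (\<lambda>(c, i) \<omega>. card (colour c \<omega> \<inter> {a<..b})) (UNIV \<times> {0::nat})"
    by (intro indep_colour) auto
  then show ?thesis
    by (auto simp: indep_vars_def2)
qed auto

lemma measurable_card_Collect_colour: "{\<omega> \<in> space M. card (colour c \<omega> \<inter> {a<..b}) = k} \<in> events"
  by measurable

lemma prob_colour:
  assumes "a < b"
  shows "prob {\<omega> \<in> space M. card (colour c \<omega> \<inter> {a<..b}) = k} = pmf (poisson_pmf (rate c * (b - a))) k"
proof -
  have "prob {\<omega> \<in> space M. card (colour c \<omega> \<inter> {a<..b}) = k} =
      measure (distr M (count_space UNIV) (\<lambda>\<omega>. card (colour c \<omega> \<inter> {a<..b}))) {k}"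
    by (subst measure_distr) (auto intro!: arg_cong[where f=prob])
  then show ?thesis
    by (simp add: distr_colour[OF assms] measure_pmf_single)
qed

lemma eventually_card_half:
  assumes "\<omega> \<in> space M"
  shows "\<forall>\<^sub>F n in sequentially. card (colour c \<omega> \<inter> {- b - 1 / real (Suc n)<..- a - 1 / real (Suc n)}) = card (half False c \<omega> \<inter> {a<..b})"
  using eventually_shift_Int[OF locally_finite_colour[OF assms], of c "- b" "- a"]
  by eventually_elim (simp add: half_def card_uminus_Int_Ioc)

lemma eventually_card_half_eq:
  assumes "\<omega> \<in> space M"
  shows "\<forall>\<^sub>F n in sequentially.
    \<omega> \<in> {\<omega> \<in> space M. card (colour c \<omega> \<inter> {- b - 1 / real (Suc n)<..- a - 1 / real (Suc n)}) = k} \<longleftrightarrow>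
    \<omega> \<in> {\<omega> \<in> space M. card (half False c \<omega> \<inter> {a<..b}) = k}"
  using eventually_card_half[OF assms, of c b a] by eventually_elim (simp only: mem_Collect_eq)

lemma measurable_half [measurable]:
  "(\<lambda>\<omega>. card (half s c \<omega> \<inter> {a<..b})) \<in> measurable M (count_space UNIV)"
proof (cases s)
  case False
  have "{\<omega> \<in> space M. card (half False c \<omega> \<inter> {a<..b}) = k} \<in> events" for k
    by (rule events_eventually_eq[where E="\<lambda>n. {\<omega> \<in> space M. card (colour c \<omega> \<inter> {- b - 1 / real (Suc n)<..- a - 1 / real (Suc n)}) = k}"])
      (rule measurable_card_Collect_colour, blast, rule eventually_card_half_eq)
  then have "(\<lambda>\<omega>. card (half False c \<omega> \<inter> {a<..b})) -` {k} \<inter> space M \<in> events" for k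
    by (rule back_subst[where P="\<lambda>A. A \<in> events"]) auto
  then show ?thesis
    using False by (auto simp: measurable_count_space_eq2_countable)
qed (simp add: half_def)

text \<open>The shifted intervals all have length \<open>b - a\<close>, so the reflected probability
  is the limit of a constant sequence.\<close>

lemma prob_half:
  assumes "a < b"
  shows "prob {\<omega> \<in> space M. card (half s c \<omega> \<inter> {a<..b}) = k} = pmf (poisson_pmf (rate c * (b - a))) k"
proof (cases s)
  case False
  have "(\<lambda>n. prob {\<omega> \<in> space M. card (colour c \<omega> \<inter> {- b - 1 / real (Suc n)<..- a - 1 / real (Suc n)}) = k})
      \<longlonglongrightarrow> prob {\<omega> \<in> space M. card (half False c \<omega> \<inter> {a<..b}) = k}"
    by (rule prob_eventually_eq) (rule measurable_card_Collect_colour, blast, rule eventually_card_half_eq)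
  moreover have "prob {\<omega> \<in> space M. card (colour c \<omega> \<inter> {- b - 1 / real (Suc n)<..- a - 1 / real (Suc n)}) = k} =
      pmf (poisson_pmf (rate c * (b - a))) k" for n
    using assms by (subst prob_colour) auto
  ultimately show ?thesis
    using False by (simp add: LIMSEQ_const_iff)
qed (use prob_colour assms in \<open>simp add: half_def\<close>)

text \<open>A grid of \<open>n\<close> cells on the half line corresponds to 2n disjoint intervals
  of the whole line, the left ones shifted by 1/(N+1). The product formula for these converges to
  the product formula for the reflected cells.\<close>

lemma indep_half:
  fixes x :: "nat \<Rightarrow> real"
  assumes x0: "0 \<le> x 0" and x: "\<And>i. i < n \<Longrightarrow> x i < x (Suc i)" and n: "0 < n"
  shows "indep_vars (\<lambda>_. count_space UNIV)
    (\<lambda>(s, c, i) \<omega>. card (half s c \<omega> \<inter> {x i<..x (Suc i)})) (UNIV \<times> UNIV \<times> {..<n})"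
proof -
  have mono: "x i \<le> x j" if "i \<le> j" "j \<le> n" for i j
    using that
  proof (induction j rule: dec_induct)
    case (step k)
    then show ?case using x[of k] by simp
  qed simp
  let ?K = "(UNIV :: bool set) \<times> {..<2 * n}"
  have K: "?K \<noteq> {}"
    using n by (auto simp: lessThan_empty_iff)
  define d where "d N = 1 / real (Suc N)" for N
  \<comment> \<open>Indices below \<open>n\<close> are the cells on the right, indices from
    \<open>n\<close> on the reflected cells on the left. The shift keeps the latter strictly
    negative, hence disjoint from the former.\<close>
  define lo where "lo N k = (if k < n then x k else - x (Suc (k - n)) - d N)" for N k
  define hi where "hi N k = (if k < n then x (Suc k) else - x (k - n) - d N)" for N k
  have ind: "indep_vars (\<lambda>_. count_space UNIV) (\<lambda>(c, k) \<omega>. card (colour c \<omega> \<inter> {lo N k<..hi N k})) ?K" for N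
  proof (rule indep_colour)
    show "finite {..<2 * n}" by simp
    show "lo N i < hi N i" if "i \<in> {..<2 * n}" for i
      using that x[of i] x[of "i - n"] by (auto simp: lo_def hi_def)
    show "{lo N i<..hi N i} \<inter> {lo N j<..hi N j} = {}" if "i \<in> {..<2 * n}" "j \<in> {..<2 * n}" "i \<noteq> j" for i j
    proof -
      have pos: "0 < d N" by (simp add: d_def)
      have *: "{lo N i<..hi N i} \<inter> {lo N j<..hi N j} = {}" if ij: "i < j" "j < 2 * n" for i j
      proof -
        consider "j < n" | "i < n" "n \<le> j" | "n \<le> i" by linarith
        then show ?thesis
        proof cases
          case 1
          then have "hi N i \<le> lo N j"
            using ij mono[of "Suc i" j] by (auto simp: hi_def lo_def)
          then show ?thesis by auto
        next
          case 2
          then have "x 0 \<le> x i" "x 0 \<le> x (j - n)"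
            using ij by (auto intro!: mono)
          then have "hi N j \<le> lo N i"
            using 2 x0 pos by (simp add: hi_def lo_def)
          then show ?thesis by auto
        next
          case 3
          then have "hi N j \<le> lo N i"
            using ij mono[of "Suc (i - n)" "j - n"] by (auto simp: hi_def lo_def)
          then show ?thesis by auto
        qed
      qed
      then show ?thesis
        using that by (cases i j rule: linorder_cases) (auto simp: Int_commute)
    qed
  qed
  define V where "V k c \<omega> = (if k < n then card (half True c \<omega> \<inter> {x k<..x (Suc k)})
     else card (half False c \<omega> \<inter> {x (k - n)<..x (Suc (k - n))}))" for k c \<omega>
  have V_meas [measurable]: "V k c \<in> measurable M (count_space UNIV)" for k c
    unfolding V_def by (cases "k < n") simp_all
  have ev: "\<forall>\<^sub>F N in sequentially. card (colour c \<omega> \<inter> {lo N k<..hi N k}) = V k c \<omega>" if "\<omega> \<in> space M" for c k \<omega>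
    using eventually_card_half[OF that] by (simp add: lo_def hi_def V_def half_def d_def)
  have "indep_vars (\<lambda>_. count_space UNIV) (\<lambda>(c, k). V k c) ?K"
  proof (subst indep_vars_finite[where E="\<lambda>_. UNIV"])
    show "?K \<noteq> {}" by (rule K)
    show "\<forall>A\<in>?K \<rightarrow> UNIV. prob (\<Inter>j\<in>?K. (case j of (c, k) \<Rightarrow> V k c) -` A j \<inter> space M) =
      (\<Prod>j\<in>?K. prob ((case j of (c, k) \<Rightarrow> V k c) -` A j \<inter> space M))"
    proof
      fix A :: "bool \<times> nat \<Rightarrow> nat set"
      let ?X = "\<lambda>N j \<omega>. card (colour (fst j) \<omega> \<inter> {lo N (snd j)<..hi N (snd j)})"
      let ?V = "\<lambda>j. V (snd j) (fst j)"
      have ev': "\<forall>\<^sub>F N in sequentially. \<forall>j\<in>?K. ?X N j \<omega> = ?V j \<omega>" if "\<omega> \<in> space M" for \<omega>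
        using that by (intro eventually_ball_finite ballI ev) auto
      have "(\<lambda>N. prob (\<Inter>j\<in>?K. ?X N j -` A j \<inter> space M)) \<longlonglongrightarrow> prob (\<Inter>j\<in>?K. ?V j -` A j \<inter> space M)"
      proof (rule prob_eventually_eq)
        show "(\<Inter>j\<in>?K. ?X N j -` A j \<inter> space M) \<in> events" for N
          using K by (intro sets.finite_INT) auto
        show "(\<Inter>j\<in>?K. ?V j -` A j \<inter> space M) \<subseteq> space M"
          using K by auto
        show "\<forall>\<^sub>F N in sequentially. (\<omega> \<in> (\<Inter>j\<in>?K. ?X N j -` A j \<inter> space M)) = (\<omega> \<in> (\<Inter>j\<in>?K. ?V j -` A j \<inter> space M))"
          if "\<omega> \<in> space M" for \<omega>
          using ev'[OF that] by eventually_elim auto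
      qed
      moreover have "prob (\<Inter>j\<in>?K. ?X N j -` A j \<inter> space M) = (\<Prod>j\<in>?K. prob (?X N j -` A j \<inter> space M))" for N
        using indep_varsD_finite[OF ind[of N] K, of A] by (simp add: case_prod_unfold)
      moreover have "(\<lambda>N. \<Prod>j\<in>?K. prob (?X N j -` A j \<inter> space M)) \<longlonglongrightarrow> (\<Prod>j\<in>?K. prob (?V j -` A j \<inter> space M))"
      proof (rule tendsto_prod, rule prob_eventually_eq)
        fix j \<omega> assume "\<omega> \<in> space M"
        from ev[OF this, of "fst j" "snd j"]
        show "\<forall>\<^sub>F N in sequentially. (\<omega> \<in> ?X N j -` A j \<inter> space M) = (\<omega> \<in> ?V j -` A j \<inter> space M)"
          by eventually_elim (simp only: vimage_eq Int_iff)
      next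
        show "?X N j -` A j \<inter> space M \<in> events" for N j
          by (rule measurable_sets[OF measurable_colour]) simp
      qed blast
      ultimately have "prob (\<Inter>j\<in>?K. ?V j -` A j \<inter> space M) = (\<Prod>j\<in>?K. prob (?V j -` A j \<inter> space M))"
        using LIMSEQ_unique by (simp only:)
      then show "prob (\<Inter>j\<in>?K. (case j of (c, k) \<Rightarrow> V k c) -` A j \<inter> space M) =
        (\<Prod>j\<in>?K. prob ((case j of (c, k) \<Rightarrow> V k c) -` A j \<inter> space M))"
        by (simp add: case_prod_unfold)
    qed
  qed (auto simp: Int_stable_def sigma_sets.Basic)
  then have V: "indep_vars (\<lambda>_. count_space UNIV) (\<lambda>j. V (snd j) (fst j)) ?K"
    by (simp add: case_prod_unfold)
  \<comment> \<open>Translates side, colour and cell into colour and one of the 2n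
    intervals.\<close>
  let ?h = "\<lambda>j :: bool \<times> bool \<times> nat. (fst (snd j), if fst j then snd (snd j) else n + snd (snd j))"
  let ?I = "(UNIV :: bool set) \<times> (UNIV :: bool set) \<times> {..<n}"
  have "?h ` ?I \<subseteq> ?K" "inj_on ?h ?I"
    by (auto intro!: inj_onI split: if_splits)
  then have "indep_vars (\<lambda>_. count_space UNIV) (\<lambda>j. V (snd (?h j)) (fst (?h j))) ?I"
    using indep_vars_reindex[OF indep_vars_subset[OF V]] by blast
  then show ?thesis
    by (rule indep_vars_cong[THEN iffD1, rotated -1]) (auto simp: V_def)
qed

end

section \<open>Strong Markov property\<close>

text \<open>The finite-dimensional distribution of a process with stationary independent increments,
  started at time \<open>t\<close> in state \<open>k\<close>, where \<open>p d i\<close> is the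
  chance of an increment \<open>i\<close> over a duration \<open>d\<close>.\<close>

fun fdd_prod :: "(real \<Rightarrow> int \<Rightarrow> real) \<Rightarrow> real \<Rightarrow> int \<Rightarrow> (real \<times> int) list \<Rightarrow> real" where
  "fdd_prod p t k [] = 1"
| "fdd_prod p t k ((u, j) # xs) = p (u - t) (j - k) * fdd_prod p u j xs"

lemma fdd_prod_append:
  "fdd_prod p t k (xs @ (u, j) # ys) = fdd_prod p t k (xs @ [(u, j)]) * fdd_prod p u j ys"
  by (induction xs arbitrary: t k) auto

lemma fdd_prod_shift:
  "fdd_prod p (a + t) (b + k) (map (\<lambda>(u, j). (a + u, b + j)) xs) = fdd_prod p t k xs"
proof (induction xs arbitrary: t k)
  case (Cons x xs)
  then show ?case by (cases x) simp
qed simp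

text \<open>Total probability over the values of \<open>Z\<close>: if the conditional chance of
  \<open>C k\<close> given \<open>Z = k\<close> is \<open>p\<close> for every \<open>k\<close>, the
  chance of \<open>C\<close> at the random index is \<open>p\<close> as well. \<open>Z\<close> will
  be the value of the process at a time, or the index of a dyadic cell.\<close>

lemma (in prob_space) prob_mult_by_countable_cases:
  fixes Z :: "'a \<Rightarrow> 'b :: countable"
  assumes Z: "\<And>k. E \<inter> {\<omega> \<in> space M. Z \<omega> = k} \<in> events" and C: "\<And>k. C k \<in> events"
    and E: "E \<in> events"
    and eq: "\<And>k. prob (E \<inter> {\<omega> \<in> space M. Z \<omega> = k} \<inter> C k) = prob (E \<inter> {\<omega> \<in> space M. Z \<omega> = k}) * p"
  shows "prob (E \<inter> {\<omega> \<in> space M. \<omega> \<in> C (Z \<omega>)}) = prob E * p"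
    and "E \<inter> {\<omega> \<in> space M. \<omega> \<in> C (Z \<omega>)} \<in> events"
proof -
  define A where "A i = (if i \<in> range (to_nat :: 'b \<Rightarrow> nat) then E \<inter> {\<omega> \<in> space M. Z \<omega> = from_nat i} else {})" for i
  define B where "B i = A i \<inter> C (from_nat i)" for i
  have Ev: "A i \<in> events" "B i \<in> events" for i
    using Z C by (auto simp: A_def B_def)
  have Esp: "E \<subseteq> space M" using E by (rule sets.sets_into_space)
  have UA: "(\<Union>i. A i) = E"
  proof (intro set_eqI iffI)
    fix \<omega> assume "\<omega> \<in> E"
    then have "\<omega> \<in> A (to_nat (Z \<omega>))"
      using Esp by (auto simp: A_def)
    then show "\<omega> \<in> (\<Union>i. A i)" by blast
  qed (auto simp: A_def split: if_splits)
  have UB: "(\<Union>i. B i) = E \<inter> {\<omega> \<in> space M. \<omega> \<in> C (Z \<omega>)}"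
  proof (intro set_eqI iffI)
    fix \<omega> assume "\<omega> \<in> E \<inter> {\<omega> \<in> space M. \<omega> \<in> C (Z \<omega>)}"
    then have "\<omega> \<in> B (to_nat (Z \<omega>))"
      by (auto simp: A_def B_def)
    then show "\<omega> \<in> (\<Union>i. B i)" by blast
  qed (auto simp: A_def B_def split: if_splits)
  have disj: "disjoint_family A" "disjoint_family B"
    by (auto simp: disjoint_family_on_def A_def B_def)
  have "(\<lambda>i. prob (A i)) sums prob E"
    using finite_measure_UNION[OF _ disj(1)] Ev UA by auto
  then have "(\<lambda>i. prob (A i) * p) sums (prob E * p)"
    by (rule sums_mult2)
  moreover have "(\<lambda>i. prob (B i)) sums prob (\<Union>i. B i)"
    using finite_measure_UNION[OF _ disj(2)] Ev by auto
  moreover have "prob (B i) = prob (A i) * p" for i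
    using eq by (auto simp: A_def B_def)
  ultimately show "prob (E \<inter> {\<omega> \<in> space M. \<omega> \<in> C (Z \<omega>)}) = prob E * p"
    using UB by (simp add: sums_unique2)
  have "(\<Union>i. B i) \<in> events" using Ev by auto
  then show "E \<inter> {\<omega> \<in> space M. \<omega> \<in> C (Z \<omega>)} \<in> events"
    by (simp add: UB)
qed

text \<open>What the strong Markov property and the passage times require of a path: locally
  constant to the right, and upward jumps of at most one. Downward jumps are not restricted by
  \<open>Y_left\<close>, so both the excess and its negative are instances.\<close>

locale stationary_process = prob_space M for M :: "'a measure" +
  fixes Y :: "real \<Rightarrow> 'a \<Rightarrow> int"
  assumes Y_measurable [measurable]: "Y t \<in> measurable M (count_space UNIV)"
    and Y_nonpos: "t \<le> 0 \<Longrightarrow> Y t \<omega> = 0"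
    and Y_right: "\<omega> \<in> space M \<Longrightarrow> 0 \<le> t \<Longrightarrow> \<exists>e>0. \<forall>s. t \<le> s \<longrightarrow> s < t + e \<longrightarrow> Y s \<omega> = Y t \<omega>"
    and Y_left: "\<omega> \<in> space M \<Longrightarrow> 0 < t \<Longrightarrow> \<exists>e>0. \<forall>s. t - e < s \<longrightarrow> s < t \<longrightarrow> Y t \<omega> \<le> Y s \<omega> + 1"
    and fdd: "sorted_wrt (<) (0 # map fst xs) \<Longrightarrow> prob {\<omega> \<in> space M. \<forall>x\<in>set xs. Y (fst x) \<omega> = snd x} =
      fdd_prod (\<lambda>d k. prob {\<omega> \<in> space M. Y d \<omega> = k}) 0 0 xs"
begin

abbreviation incr_prob :: "real \<Rightarrow> int \<Rightarrow> real" where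
  "incr_prob d k \<equiv> prob {\<omega> \<in> space M. Y d \<omega> = k}"

text \<open>The natural filtration, with an arbitrary set of times: \<open>past {..u}\<close> is the
  history at time \<open>u\<close>, \<open>past {0..}\<close> is generated by the whole
  path.\<close>

definition past :: "real set \<Rightarrow> 'a measure" where
  "past I = sigma (space M) {Y s -` {k} \<inter> space M | s k. s \<in> I}"

lemma space_past [simp]: "space (past I) = space M"
  unfolding past_def by (rule space_measure_of) auto

lemma sets_past: "sets (past I) = sigma_sets (space M) {Y s -` {k} \<inter> space M | s k. s \<in> I}"
  unfolding past_def by (rule sets_measure_of) auto

lemma sets_past_events: "sets (past I) \<subseteq> events"
  unfolding sets_past by (rule sets.sigma_sets_subset) (auto intro: measurable_sets[OF Y_measurable])

lemma measurable_past: "s \<in> I \<Longrightarrow> Y s \<in> measurable (past I) (count_space UNIV)"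
  by (auto simp: measurable_count_space_eq2_countable sets_past intro!: sigma_sets.Basic)

lemma past_mono: "I \<subseteq> J \<Longrightarrow> sets (past I) \<subseteq> sets (past J)"
  unfolding sets_past by (rule sigma_sets_mono') auto

text \<open>List the times of \<open>A\<close> in order, then \<open>t + fst x\<close> for
  \<open>x\<close> in \<open>xs\<close>. Since \<open>t\<close> belongs to \<open>A\<close>, the
  product of transition probabilities splits at the known state \<open>f t\<close>, and its second
  factor is invariant under shifting time and state.\<close>

lemma prob_past_cylinder:
  assumes t: "0 < t" and A: "finite A" "A \<subseteq> {0<..t}" "t \<in> A"
    and xs: "sorted_wrt (<) (0 # map fst xs)"
  shows "prob ({\<omega> \<in> space M. \<forall>s\<in>A. Y s \<omega> = f s} \<inter> {\<omega> \<in> space M. \<forall>x\<in>set xs. Y (t + fst x) \<omega> - Y t \<omega> = snd x}) =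
    prob {\<omega> \<in> space M. \<forall>s\<in>A. Y s \<omega> = f s} * fdd_prod incr_prob 0 0 xs"
proof -
  define zs where "zs = sorted_list_of_set (A - {t})"
  define ys where "ys = map (\<lambda>s. (s, f s)) zs"
  have zs: "set zs = A - {t}" "sorted_wrt (<) zs"
    using A by (auto simp: zs_def)
  have A': "{\<omega> \<in> space M. \<forall>s\<in>A. Y s \<omega> = f s} = {\<omega> \<in> space M. \<forall>x\<in>set (ys @ [(t, f t)]). Y (fst x) \<omega> = snd x}"
    using zs A by (auto simp: ys_def)
  let ?xs = "map (\<lambda>(u, j). (t + u, f t + j)) xs"
  have AC: "{\<omega> \<in> space M. \<forall>s\<in>A. Y s \<omega> = f s} \<inter> {\<omega> \<in> space M. \<forall>x\<in>set xs. Y (t + fst x) \<omega> - Y t \<omega> = snd x} =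
      {\<omega> \<in> space M. \<forall>x\<in>set (ys @ (t, f t) # ?xs). Y (fst x) \<omega> = snd x}"
  proof -
    have "(\<forall>x\<in>set ?xs. Y (fst x) \<omega> = snd x) \<longleftrightarrow> (\<forall>x\<in>set xs. Y (t + fst x) \<omega> = f t + snd x)" for \<omega>
      by (simp add: case_prod_unfold)
    then have "(\<forall>x\<in>set (ys @ (t, f t) # ?xs). Y (fst x) \<omega> = snd x) \<longleftrightarrow>
      (\<forall>x\<in>set (ys @ [(t, f t)]). Y (fst x) \<omega> = snd x) \<and> (\<forall>x\<in>set xs. Y (t + fst x) \<omega> - Y t \<omega> = snd x)" for \<omega>
      by (simp only: set_append list.set ball_Un ball_simps fst_conv snd_conv) (auto simp: algebra_simps)
    then show ?thesis
      unfolding A' by blast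
  qed
  have fst: "map fst (ys @ [(t, f t)]) = zs @ [t]" "map fst (ys @ (t, f t) # ?xs) = zs @ t # map (\<lambda>x. t + fst x) xs"
    by (auto simp: ys_def comp_def case_prod_unfold)
  have s1: "sorted_wrt (<) (0 # zs @ [t])"
    using zs A by (auto simp: sorted_wrt_append)
  have s2: "sorted_wrt (<) (0 # zs @ t # map (\<lambda>x. t + fst x) xs)"
    using s1 xs t by (auto simp: sorted_wrt_append sorted_wrt_map intro: add_pos_pos) fastforce
  show ?thesis
    unfolding AC unfolding A'
    using fdd_prod_shift[of incr_prob t 0 "f t" 0 xs]
    by (subst fdd, simp only: fst s2, subst fdd, simp only: fst s1, subst fdd_prod_append) simp
qed

text \<open>The cylinders that fix the value at \<open>t\<close> are closed under intersection and
  generate the history, so independence of the increments extends from them to every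
  \<open>E\<close>.\<close>

lemma prob_past_increments:
  assumes t: "0 < t" and E: "E \<in> sets (past {..t})" and xs: "sorted_wrt (<) (0 # map fst xs)"
  shows "prob (E \<inter> {\<omega> \<in> space M. \<forall>x\<in>set xs. Y (t + fst x) \<omega> - Y t \<omega> = snd x}) = prob E * fdd_prod incr_prob 0 0 xs"
proof -
  define C where "C = {\<omega> \<in> space M. \<forall>x\<in>set xs. Y (t + fst x) \<omega> - Y t \<omega> = snd x}"
  let ?cyl = "\<lambda>A f. {\<omega> \<in> space M. \<forall>s\<in>A. Y s \<omega> = f s}"
  define G where "G = insert {} {?cyl A f | A f. finite A \<and> A \<subseteq> {0<..t} \<and> t \<in> A}"
  have G_I: "?cyl A f \<in> G" if "finite A" "A \<subseteq> {0<..t}" "t \<in> A" for A f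
    unfolding G_def using that by (intro insertI2 CollectI exI[of _ A] exI[of _ f] conjI refl)
  have C: "C \<in> events"
    unfolding C_def by measurable
  have cyl: "?cyl A f \<in> events" if "finite A" for A f
    using that by measurable
  have cylC: "prob (?cyl A f \<inter> C) = prob (?cyl A f) * fdd_prod incr_prob 0 0 xs"
    if "finite A" "A \<subseteq> {0<..t}" "t \<in> A" for A f
    unfolding C_def using t that xs by (rule prob_past_cylinder)
  \<comment> \<open>The cylinder formula requires the value at \<open>t\<close>; summing over it
    gives the unconditional probability of \<open>C\<close>.\<close>
  have "prob (space M \<inter> {\<omega> \<in> space M. \<omega> \<in> C}) = prob (space M) * fdd_prod incr_prob 0 0 xs"
  proof (rule prob_mult_by_countable_cases(1)[where Z="Y t" and C="\<lambda>_. C"])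
    fix k
    have eq: "space M \<inter> {\<omega> \<in> space M. Y t \<omega> = k} = ?cyl {t} (\<lambda>_. k)" by auto
    show "prob (space M \<inter> {\<omega> \<in> space M. Y t \<omega> = k} \<inter> C) = prob (space M \<inter> {\<omega> \<in> space M. Y t \<omega> = k}) * fdd_prod incr_prob 0 0 xs"
      unfolding eq using t by (intro cylC) auto
  qed (use C in measurable)
  moreover have "space M \<inter> {\<omega> \<in> space M. \<omega> \<in> C} = C"
    by (auto simp: C_def)
  ultimately have probC: "prob C = fdd_prod incr_prob 0 0 xs"
    by (simp add: prob_space)
  have "indep_set G {C}"
  proof (rule indep_setI)
    show "G \<subseteq> events" using cyl by (auto simp: G_def)
    show "prob (a \<inter> b) = prob a * prob b" if "a \<in> G" "b \<in> {C}" for a b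
      using that cylC probC by (auto simp: G_def)
  qed (use C in auto)
  moreover have "Int_stable G"
  proof (rule Int_stableI)
    fix a b assume ab: "a \<in> G" "b \<in> G"
    show "a \<inter> b \<in> G"
    proof (cases "a \<inter> b = {}")
      case False
      with ab obtain A f B g where *: "a = ?cyl A f" "finite A" "A \<subseteq> {0<..t}" "t \<in> A"
          "b = ?cyl B g" "finite B" "B \<subseteq> {0<..t}" by (auto simp: G_def)
      with False obtain \<omega> where \<omega>: "\<forall>s\<in>A. Y s \<omega> = f s" "\<forall>s\<in>B. Y s \<omega> = g s" by auto
      have "a \<inter> b = ?cyl (A \<union> B) (\<lambda>s. Y s \<omega>)"
        unfolding *(1,5) using \<omega> by auto
      then show ?thesis
        using * by (simp only:) (intro G_I, auto)
    qed (simp add: G_def)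
  qed
  ultimately have "indep_set (sigma_sets (space M) G) (sigma_sets (space M) {C})"
    by (rule indep_set_sigma_sets) (simp add: Int_stable_def)
  moreover have "sets (past {..t}) \<subseteq> sigma_sets (space M) G"
    unfolding sets_past
  proof (rule sigma_sets_mono, safe)
    fix s k assume s: "s \<le> t"
    have sp: "space M \<in> sigma_sets (space M) G" by (rule sigma_sets_top)
    show "Y s -` {k} \<inter> space M \<in> sigma_sets (space M) G"
    proof (cases "0 < s")
      case False
      then have "Y s -` {k} \<inter> space M = (if k = 0 then space M else {})"
        using Y_nonpos[of s] by auto
      then show ?thesis using sp by (simp add: sigma_sets.Empty)
    next
      case True
      let ?f = "\<lambda>j u. if u = s then k else j"
      \<comment> \<open>An event at a single time is a countable union of admissible cylinders, one
        for each value at \<open>t\<close>.\<close>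
      have "Y s -` {k} \<inter> space M = (\<Union>j. ?cyl {s, t} (?f j))"
        by auto
      also have "\<dots> \<in> sigma_sets (space M) G"
      proof (rule sigma_sets_UNION)
        show "countable (range (\<lambda>j. ?cyl {s, t} (?f j)))" by simp
        fix b assume "b \<in> range (\<lambda>j. ?cyl {s, t} (?f j))"
        then obtain j where "b = ?cyl {s, t} (?f j)" by blast
        moreover have "finite {s, t}" "{s, t} \<subseteq> {0<..t}" "t \<in> {s, t}"
          using s True t by auto
        ultimately show "b \<in> sigma_sets (space M) G"
          by (simp only:) (intro sigma_sets.Basic G_I)
      qed
      finally show ?thesis .
    qed
  qed
  ultimately show ?thesis
    unfolding C_def[symmetric] using E probC
    by (metis indep_setD insertI1 sigma_sets.Basic subsetD)
qed

text \<open>\<open>T\<close> is rounded up to a dyadic time. On each dyadic cell the rounded time is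
  deterministic, so the increments after it are independent of the history; right-continuity
  transfers this to \<open>T\<close>.\<close>

lemma strong_markov_fdd:
  assumes E: "E \<in> events" and T: "\<And>\<omega>. \<omega> \<in> E \<Longrightarrow> 0 \<le> T \<omega>"
    and past: "\<And>u. 0 < u \<Longrightarrow> E \<inter> {\<omega>. T \<omega> < u} \<in> sets (past {..u})"
    and xs: "sorted_wrt (<) (0 # map fst xs)"
  shows "prob (E \<inter> {\<omega> \<in> space M. \<forall>x\<in>set xs. Y (T \<omega> + fst x) \<omega> - Y (T \<omega>) \<omega> = snd x}) = prob E * fdd_prod incr_prob 0 0 xs"
    and "E \<inter> {\<omega> \<in> space M. \<forall>x\<in>set xs. Y (T \<omega> + fst x) \<omega> - Y (T \<omega>) \<omega> = snd x} \<in> events"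
proof -
  \<comment> \<open>\<open>Suc\<close> rounds strictly up, even at dyadic \<open>T\<close>. Hence
    the cell containing \<open>T\<close> is determined by strict inequalities \<open>T < u\<close>
    alone, as in the hypothesis \<open>past\<close>.\<close>
  define tau where "tau n i = real (Suc i) / 2 ^ n" for n i :: nat
  define Z where "Z n \<omega> = nat \<lfloor>T \<omega> * 2 ^ n\<rfloor>" for n \<omega>
  define C where "C n i = {\<omega> \<in> space M. \<forall>x\<in>set xs. Y (tau n i + fst x) \<omega> - Y (tau n i) \<omega> = snd x}" for n i
  define D where "D n = E \<inter> {\<omega> \<in> space M. \<omega> \<in> C n (Z n \<omega>)}" for n
  have E_sub: "E \<subseteq> space M" using E by (rule sets.sets_into_space)
  have C: "C n i \<in> events" for n i
    unfolding C_def by measurable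
  have Z_eq: "E \<inter> {\<omega> \<in> space M. Z n \<omega> = i} = E \<inter> {\<omega>. T \<omega> < tau n i} - E \<inter> {\<omega>. T \<omega> < real i / 2 ^ n}" for n i
  proof -
    have "Z n \<omega> = i \<longleftrightarrow> T \<omega> < tau n i \<and> \<not> T \<omega> < real i / 2 ^ n" if "\<omega> \<in> E" for \<omega>
    proof -
      have "Z n \<omega> = i \<longleftrightarrow> \<lfloor>T \<omega> * 2 ^ n\<rfloor> = int i"
        unfolding Z_def using T[OF that] by (auto simp: nat_eq_iff)
      also have "\<dots> \<longleftrightarrow> real i \<le> T \<omega> * 2 ^ n \<and> T \<omega> * 2 ^ n < real i + 1"
        by (simp add: floor_eq_iff)
      finally show ?thesis
        by (auto simp: tau_def field_simps not_less)
    qed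
    then show ?thesis using E_sub by blast
  qed
  have Z: "E \<inter> {\<omega> \<in> space M. Z n \<omega> = i} \<in> sets (past {..tau n i})" for n i
  proof -
    have "E \<inter> {\<omega>. T \<omega> < real i / 2 ^ n} \<in> sets (past {..tau n i})"
    proof (cases "i = 0")
      case True
      then have "E \<inter> {\<omega>. T \<omega> < real i / 2 ^ n} = {}"
        using T by force
      then show ?thesis by simp
    next
      case False
      then have "E \<inter> {\<omega>. T \<omega> < real i / 2 ^ n} \<in> sets (past {..real i / 2 ^ n})"
        by (intro past) simp
      moreover have "real i / 2 ^ n \<le> tau n i"
        by (simp add: tau_def divide_right_mono)
      ultimately show ?thesis
        using past_mono[of "{..real i / 2 ^ n}" "{..tau n i}"] by auto
    qed
    moreover have "E \<inter> {\<omega>. T \<omega> < tau n i} \<in> sets (past {..tau n i})"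
      by (intro past) (simp add: tau_def)
    ultimately show ?thesis
      unfolding Z_eq by (rule sets.Diff[rotated])
  qed
  have D: "prob (D n) = prob E * fdd_prod incr_prob 0 0 xs" "D n \<in> events" for n
  proof -
    have 1: "E \<inter> {\<omega> \<in> space M. Z n \<omega> = i} \<in> events" for i
      using Z sets_past_events by blast
    have 2: "prob (E \<inter> {\<omega> \<in> space M. Z n \<omega> = i} \<inter> C n i) = prob (E \<inter> {\<omega> \<in> space M. Z n \<omega> = i}) * fdd_prod incr_prob 0 0 xs" for i
      unfolding C_def by (rule prob_past_increments[OF _ Z xs]) (simp add: tau_def)
    show "prob (D n) = prob E * fdd_prod incr_prob 0 0 xs" "D n \<in> events"
      unfolding D_def by (rule prob_mult_by_countable_cases[OF 1 C E 2])+
  qed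
  let ?D = "E \<inter> {\<omega> \<in> space M. \<forall>x\<in>set xs. Y (T \<omega> + fst x) \<omega> - Y (T \<omega>) \<omega> = snd x}"
  have ev: "\<forall>\<^sub>F n in sequentially. \<omega> \<in> D n \<longleftrightarrow> \<omega> \<in> ?D" if \<omega>: "\<omega> \<in> space M" for \<omega>
  proof (cases "\<omega> \<in> E")
    case True
    note T0 = T[OF True]
    have tau: "T \<omega> < tau n (Z n \<omega>)" "tau n (Z n \<omega>) \<le> T \<omega> + (1 / 2) ^ n" for n
    proof -
      have "real (Z n \<omega>) = of_int \<lfloor>T \<omega> * 2 ^ n\<rfloor>"
        using T0 by (simp add: Z_def)
      then have "real (Z n \<omega>) \<le> T \<omega> * 2 ^ n" "T \<omega> * 2 ^ n < real (Z n \<omega>) + 1"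
        by linarith+
      then show "T \<omega> < tau n (Z n \<omega>)" "tau n (Z n \<omega>) \<le> T \<omega> + (1 / 2) ^ n"
        by (simp_all add: tau_def field_simps)
    qed
    have near: "\<forall>\<^sub>F n in sequentially. Y (tau n (Z n \<omega>) + u) \<omega> = Y (T \<omega> + u) \<omega>" if u: "0 \<le> u" for u
    proof -
      obtain e where e: "e > 0" "\<And>s. T \<omega> + u \<le> s \<Longrightarrow> s < T \<omega> + u + e \<Longrightarrow> Y s \<omega> = Y (T \<omega> + u) \<omega>"
        using Y_right[OF \<omega>, of "T \<omega> + u"] T0 u by auto
      have "\<forall>\<^sub>F n in sequentially. (1 / 2) ^ n < e"
        using order_tendstoD(2)[OF LIMSEQ_power_zero[of "1 / 2 :: real"] e(1)] by simp
      then show ?thesis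
      proof eventually_elim
        case (elim n)
        show ?case by (rule e(2)) (use tau[of n] elim in linarith)+
      qed
    qed
    have u: "0 \<le> fst x" if "x \<in> set xs" for x
      using xs that by auto
    have "\<forall>\<^sub>F n in sequentially. \<forall>x\<in>set xs. Y (tau n (Z n \<omega>) + fst x) \<omega> = Y (T \<omega> + fst x) \<omega>"
      by (intro eventually_ball_finite ballI near u) auto
    moreover have "\<forall>\<^sub>F n in sequentially. Y (tau n (Z n \<omega>)) \<omega> = Y (T \<omega>) \<omega>"
      using near[of 0] by simp
    ultimately show ?thesis
      by eventually_elim (use True \<omega> in \<open>simp add: D_def C_def\<close>)
  qed (simp add: D_def)
  have lim: "(\<lambda>n. prob (D n)) \<longlonglongrightarrow> prob ?D"
    by (rule prob_eventually_eq) (use D ev in auto)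
  then show "prob ?D = prob E * fdd_prod incr_prob 0 0 xs"
    by (simp add: D LIMSEQ_const_iff)
  show "?D \<in> events"
    by (rule events_eventually_eq[of D]) (use D ev in auto)
qed

end

section \<open>Passage times\<close>

lemma sets_Collect_Bex_countable:
  assumes "countable Q" "\<And>q. q \<in> Q \<Longrightarrow> {\<omega> \<in> space N. P q \<omega>} \<in> sets N"
  shows "{\<omega> \<in> space N. \<exists>q\<in>Q. P q \<omega>} \<in> sets N"
proof -
  have "{\<omega> \<in> space N. \<exists>q\<in>Q. P q \<omega>} = (\<Union>q\<in>Q. {\<omega> \<in> space N. P q \<omega>})" by auto
  then show ?thesis using assms by (auto intro!: sets.countable_UN')
qed

lemma eventually_Bex_from_nat_into:
  assumes "countable Q"
  shows "\<forall>\<^sub>F n in sequentially. (\<exists>s\<in>Q \<inter> from_nat_into Q ` {..n}. P s) \<longleftrightarrow> (\<exists>s\<in>Q. P s)"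
proof (cases "\<exists>s\<in>Q. P s")
  case True
  then obtain s where s: "s \<in> Q" "P s" by blast
  then obtain i where i: "from_nat_into Q i = s"
    using assms by (metis from_nat_into_surj)
  have "\<exists>s\<in>Q \<inter> from_nat_into Q ` {..n}. P s" if "i \<le> n" for n
    using s i that by blast
  then show ?thesis
    using True unfolding eventually_sequentially by blast
qed auto

text \<open>A finite index set is completed to an initial segment by putting the whole space at the
  missing indices.\<close>

lemma (in prob_space) indep_vars_natI:
  fixes X :: "nat \<Rightarrow> 'a \<Rightarrow> 'b"
  assumes X: "\<And>i. X i \<in> measurable M (N i)"
    and eq: "\<And>n A. (\<And>i. A i \<in> sets (N i)) \<Longrightarrow>
      prob {\<omega> \<in> space M. \<forall>i<n. X i \<omega> \<in> A i} = (\<Prod>i<n. prob {\<omega> \<in> space M. X i \<omega> \<in> A i})"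
  shows "indep_vars N X UNIV"
  unfolding indep_vars_def2
proof (intro conjI ballI X indep_setsI)
  show "{X i -` A \<inter> space M | A. A \<in> sets (N i)} \<subseteq> events" for i
    using measurable_sets[OF X] by auto
next
  fix A and J :: "nat set" assume J: "J \<noteq> {}" "J \<subseteq> UNIV" "finite J"
    and "\<forall>j\<in>J. A j \<in> {X j -` A \<inter> space M | A. A \<in> sets (N j)}"
  then have "\<forall>j\<in>J. \<exists>B. A j = X j -` B \<inter> space M \<and> B \<in> sets (N j)" by auto
  from bchoice[OF this] obtain B where
    B: "\<And>j. j \<in> J \<Longrightarrow> A j = X j -` B j \<inter> space M \<and> B j \<in> sets (N j)" by blast
  define n where "n = Suc (Max J)"
  have n: "j < n" if "j \<in> J" for j
    using J that by (simp add: n_def le_imp_less_Suc)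
  define C where "C i = (if i \<in> J then B i else space (N i))" for i
  have C: "C i \<in> sets (N i)" for i
    using B by (auto simp: C_def)
  have sp: "X i \<omega> \<in> space (N i)" if "\<omega> \<in> space M" for i \<omega>
    using that X by (auto dest: measurable_space)
  have "(\<Inter>j\<in>J. A j) = {\<omega> \<in> space M. \<forall>i<n. X i \<omega> \<in> C i}"
    using B J n sp by (auto simp: C_def)
  then have "prob (\<Inter>j\<in>J. A j) = (\<Prod>i<n. prob {\<omega> \<in> space M. X i \<omega> \<in> C i})"
    using eq[OF C] by simp
  also have "\<dots> = (\<Prod>i\<in>J. prob {\<omega> \<in> space M. X i \<omega> \<in> C i})"
  proof (rule prod.mono_neutral_right)
    show "\<forall>i\<in>{..<n} - J. prob {\<omega> \<in> space M. X i \<omega> \<in> C i} = 1"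
    proof
      fix i assume "i \<in> {..<n} - J"
      then have "{\<omega> \<in> space M. X i \<omega> \<in> C i} = space M"
        using sp by (auto simp: C_def)
      then show "prob {\<omega> \<in> space M. X i \<omega> \<in> C i} = 1"
        by (simp add: prob_space)
    qed
  qed (use n in auto)
  also have "\<dots> = (\<Prod>j\<in>J. prob (A j))"
  proof (rule prod.cong[OF refl])
    fix j assume "j \<in> J"
    then have "{\<omega> \<in> space M. X j \<omega> \<in> C j} = A j"
      using B[of j] by (auto simp: C_def)
    then show "prob {\<omega> \<in> space M. X j \<omega> \<in> C j} = prob (A j)" by simp
  qed
  finally show "prob (\<Inter>j\<in>J. A j) = (\<Prod>j\<in>J. prob (A j))" .
qed

context stationary_process
begin

lemma top_past: "space M \<in> sets (past I)"
  using sets.top[of "past I"] by simp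

lemma events_Y: "{\<omega> \<in> space M. Y s \<omega> \<in> K} \<in> events"
  using measurable_sets[OF Y_measurable, of K s] by (simp add: vimage_def Int_def conj_commute)

text \<open>Split according to the vector of increments over \<open>D\<close>: there are countably
  many integer vectors, and each is a finite-dimensional event.\<close>

lemma strong_markov_hit_finite:
  assumes E: "E \<in> events" and T: "\<And>\<omega>. \<omega> \<in> E \<Longrightarrow> 0 \<le> T \<omega>"
    and past: "\<And>u. 0 < u \<Longrightarrow> E \<inter> {\<omega>. T \<omega> < u} \<in> sets (past {..u})"
    and D: "finite D" "D \<subseteq> {0<..}"
  shows "prob (E \<inter> {\<omega> \<in> space M. \<exists>s\<in>D. Y (T \<omega> + s) \<omega> - Y (T \<omega>) \<omega> \<in> K}) = prob E * prob {\<omega> \<in> space M. \<exists>s\<in>D. Y s \<omega> \<in> K}"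
    and "E \<inter> {\<omega> \<in> space M. \<exists>s\<in>D. Y (T \<omega> + s) \<omega> - Y (T \<omega>) \<omega> \<in> K} \<in> events"
proof -
  define F where "F = {f \<in> D \<rightarrow>\<^sub>E (UNIV :: int set). \<exists>s\<in>D. f s \<in> K}"
  have F: "countable F"
    unfolding F_def using D by (intro countable_subset[OF _ countable_PiE[of D "\<lambda>_. UNIV :: int set"]]) auto
  define A where "A f = E \<inter> {\<omega> \<in> space M. \<forall>s\<in>D. Y (T \<omega> + s) \<omega> - Y (T \<omega>) \<omega> = f s}" for f
  define B where "B f = {\<omega> \<in> space M. \<forall>s\<in>D. Y s \<omega> = f s}" for f
  define xs where "xs f = map (\<lambda>s. (s, f s)) (sorted_list_of_set D)" for f :: "real \<Rightarrow> int"
  have xs: "sorted_wrt (<) (0 # map fst (xs f))" for f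
    using D by (auto simp: xs_def comp_def)
  have eqs: "A f = E \<inter> {\<omega> \<in> space M. \<forall>x\<in>set (xs f). Y (T \<omega> + fst x) \<omega> - Y (T \<omega>) \<omega> = snd x}"
    "B f = {\<omega> \<in> space M. \<forall>x\<in>set (xs f). Y (fst x) \<omega> = snd x}" for f
    using D by (auto simp: A_def B_def xs_def)
  have A: "A f \<in> events" "prob (A f) = prob E * prob (B f)" and B: "B f \<in> events" for f
  proof -
    show "A f \<in> events"
      unfolding eqs by (rule strong_markov_fdd(2)[OF E T past xs])
    show "prob (A f) = prob E * prob (B f)"
      unfolding eqs fdd[OF xs] by (rule strong_markov_fdd(1)[OF E T past xs])
    show "B f \<in> events"
      unfolding B_def using D by measurable
  qed
  have UA: "(\<Union>f\<in>F. A f) = E \<inter> {\<omega> \<in> space M. \<exists>s\<in>D. Y (T \<omega> + s) \<omega> - Y (T \<omega>) \<omega> \<in> K}"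
  proof (intro set_eqI iffI)
    fix \<omega> assume *: "\<omega> \<in> E \<inter> {\<omega> \<in> space M. \<exists>s\<in>D. Y (T \<omega> + s) \<omega> - Y (T \<omega>) \<omega> \<in> K}"
    let ?f = "\<lambda>s\<in>D. Y (T \<omega> + s) \<omega> - Y (T \<omega>) \<omega>"
    have "?f \<in> F" "\<omega> \<in> A ?f"
      using * by (auto simp: F_def A_def)
    then show "\<omega> \<in> (\<Union>f\<in>F. A f)" by blast
  qed (auto simp: F_def A_def)
  have UB: "(\<Union>f\<in>F. B f) = {\<omega> \<in> space M. \<exists>s\<in>D. Y s \<omega> \<in> K}"
  proof (intro set_eqI iffI)
    fix \<omega> assume *: "\<omega> \<in> {\<omega> \<in> space M. \<exists>s\<in>D. Y s \<omega> \<in> K}"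
    let ?f = "\<lambda>s\<in>D. Y s \<omega>"
    have "?f \<in> F" "\<omega> \<in> B ?f"
      using * by (auto simp: F_def B_def)
    then show "\<omega> \<in> (\<Union>f\<in>F. B f)" by blast
  qed (auto simp: F_def B_def)
  have ne: "\<exists>s\<in>D. f s \<noteq> g s" if "f \<in> F" "g \<in> F" "f \<noteq> g" for f g
    using that PiE_ext[of f D "\<lambda>_. UNIV" g] by (auto simp: F_def)
  have dA: "disjoint_family_on A F"
    unfolding disjoint_family_on_def A_def using ne by fastforce
  have dB: "disjoint_family_on B F"
    unfolding disjoint_family_on_def B_def using ne by fastforce
  have "emeasure M (\<Union>f\<in>F. A f) = (\<integral>\<^sup>+f. emeasure M (A f) \<partial>count_space F)"
    using A F dA by (intro emeasure_UN_countable) auto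
  also have "\<dots> = (\<integral>\<^sup>+f. emeasure M E * emeasure M (B f) \<partial>count_space F)"
    by (simp add: emeasure_eq_measure A ennreal_mult)
  also have "\<dots> = emeasure M E * (\<integral>\<^sup>+f. emeasure M (B f) \<partial>count_space F)"
    by (rule nn_integral_cmult) simp
  also have "(\<integral>\<^sup>+f. emeasure M (B f) \<partial>count_space F) = emeasure M (\<Union>f\<in>F. B f)"
    using B F dB by (intro emeasure_UN_countable[symmetric]) auto
  finally show "prob (E \<inter> {\<omega> \<in> space M. \<exists>s\<in>D. Y (T \<omega> + s) \<omega> - Y (T \<omega>) \<omega> \<in> K}) = prob E * prob {\<omega> \<in> space M. \<exists>s\<in>D. Y s \<omega> \<in> K}"
    unfolding UA UB by (simp add: emeasure_eq_measure ennreal_mult[symmetric])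
  have "(\<Union>f\<in>F. A f) \<in> events"
    using A F by (intro sets.countable_UN') auto
  then show "E \<inter> {\<omega> \<in> space M. \<exists>s\<in>D. Y (T \<omega> + s) \<omega> - Y (T \<omega>) \<omega> \<in> K} \<in> events"
    by (simp add: UA)
qed

text \<open>\<open>Q\<close> is exhausted by finite sets. Countably many times suffice for all later
  hitting events, because a path keeps each value for a while to the right.\<close>

lemma strong_markov_hit:
  assumes E: "E \<in> events" and T: "\<And>\<omega>. \<omega> \<in> E \<Longrightarrow> 0 \<le> T \<omega>"
    and past: "\<And>u. 0 < u \<Longrightarrow> E \<inter> {\<omega>. T \<omega> < u} \<in> sets (past {..u})"
    and Q: "countable Q" "Q \<subseteq> {0<..}"
  shows "prob (E \<inter> {\<omega> \<in> space M. \<exists>s\<in>Q. Y (T \<omega> + s) \<omega> - Y (T \<omega>) \<omega> \<in> K}) = prob E * prob {\<omega> \<in> space M. \<exists>s\<in>Q. Y s \<omega> \<in> K}"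
    and "E \<inter> {\<omega> \<in> space M. \<exists>s\<in>Q. Y (T \<omega> + s) \<omega> - Y (T \<omega>) \<omega> \<in> K} \<in> events"
proof -
  let ?D = "\<lambda>n. Q \<inter> from_nat_into Q ` {..n}"
  have D: "finite (?D n)" "?D n \<subseteq> {0<..}" for n
    using Q by auto
  note fin = strong_markov_hit_finite[OF E T past D, where K=K]
  let ?A = "\<lambda>n. E \<inter> {\<omega> \<in> space M. \<exists>s\<in>?D n. Y (T \<omega> + s) \<omega> - Y (T \<omega>) \<omega> \<in> K}"
  let ?B = "\<lambda>n. {\<omega> \<in> space M. \<exists>s\<in>?D n. Y s \<omega> \<in> K}"
  let ?A' = "E \<inter> {\<omega> \<in> space M. \<exists>s\<in>Q. Y (T \<omega> + s) \<omega> - Y (T \<omega>) \<omega> \<in> K}"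
  let ?B' = "{\<omega> \<in> space M. \<exists>s\<in>Q. Y s \<omega> \<in> K}"
  have evA: "\<forall>\<^sub>F n in sequentially. \<omega> \<in> ?A n \<longleftrightarrow> \<omega> \<in> ?A'" for \<omega>
    using eventually_Bex_from_nat_into[OF Q(1), of "\<lambda>s. Y (T \<omega> + s) \<omega> - Y (T \<omega>) \<omega> \<in> K"]
    by eventually_elim blast
  have evB: "\<forall>\<^sub>F n in sequentially. \<omega> \<in> ?B n \<longleftrightarrow> \<omega> \<in> ?B'" for \<omega>
    using eventually_Bex_from_nat_into[OF Q(1), of "\<lambda>s. Y s \<omega> \<in> K"]
    by eventually_elim blast
  have B: "?B n \<in> events" for n
    by (rule sets_Collect_Bex_countable[OF countable_finite[OF D(1)]]) (rule events_Y)
  have "(\<lambda>n. prob (?A n)) \<longlonglongrightarrow> prob ?A'"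
    by (rule prob_eventually_eq[OF fin(2) _ evA]) auto
  moreover have "(\<lambda>n. prob E * prob (?B n)) \<longlonglongrightarrow> prob E * prob ?B'"
    by (intro tendsto_mult_left prob_eventually_eq[OF B _ evB]) auto
  moreover have "prob (?A n) = prob E * prob (?B n)" for n
    by (rule fin(1))
  ultimately show "prob ?A' = prob E * prob ?B'"
    by (simp only: LIMSEQ_unique)
  show "?A' \<in> events"
    by (rule events_eventually_eq[OF fin(2) _ evA]) auto
qed

lemma right_rational:
  assumes "\<omega> \<in> space M" "0 \<le> s" "s < b"
  obtains q where "q \<in> \<rat>" "s < q" "q < b" "Y q \<omega> = Y s \<omega>"
proof -
  obtain e where e: "e > 0" "\<And>r. s \<le> r \<Longrightarrow> r < s + e \<Longrightarrow> Y r \<omega> = Y s \<omega>"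
    using Y_right[OF assms(1,2)] by blast
  obtain q where "q \<in> \<rat>" "s < q" "q < min b (s + e)"
    using Rats_dense_in_real[of s "min b (s + e)"] e assms by auto
  then show ?thesis
    using that[of q] e(2)[of q] by simp
qed

section \<open>Levels, passage times and gaps\<close>

definition reaches :: "nat \<Rightarrow> 'a \<Rightarrow> bool" where
  "reaches k \<omega> \<longleftrightarrow> (\<exists>s\<ge>0. int k \<le> Y s \<omega>)"

text \<open>If the level is never reached this is the unspecified real \<open>Inf {}\<close>, which
  is why \<open>reaches\<close> accompanies it.\<close>

definition passage :: "nat \<Rightarrow> 'a \<Rightarrow> real" where
  "passage k \<omega> = Inf {s. 0 \<le> s \<and> int k \<le> Y s \<omega>}"

lemma passage_le: "0 \<le> s \<Longrightarrow> int k \<le> Y s \<omega> \<Longrightarrow> passage k \<omega> \<le> s"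
  unfolding passage_def by (rule cInf_lower) auto

lemma passage_nonneg: "reaches k \<omega> \<Longrightarrow> 0 \<le> passage k \<omega>"
  unfolding passage_def reaches_def by (rule cInf_greatest) auto

lemma passage_0: "passage 0 \<omega> = 0"
  using passage_le[of 0 0 \<omega>] passage_nonneg[of 0 \<omega>] Y_nonpos[of 0 \<omega>]
  by (force simp: reaches_def)

lemma reaches_mono: "k \<le> j \<Longrightarrow> reaches j \<omega> \<Longrightarrow> reaches k \<omega>"
  unfolding reaches_def by force

lemma passage_attained:
  assumes "\<omega> \<in> space M" "reaches k \<omega>"
  shows "int k \<le> Y (passage k \<omega>) \<omega>"
proof -
  obtain e where e: "e > 0" "\<And>r. passage k \<omega> \<le> r \<Longrightarrow> r < passage k \<omega> + e \<Longrightarrow> Y r \<omega> = Y (passage k \<omega>) \<omega>"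
    using Y_right[OF assms(1) passage_nonneg[OF assms(2)]] by blast
  have "\<exists>s\<in>{s. 0 \<le> s \<and> int k \<le> Y s \<omega>}. s < passage k \<omega> + e"
  proof (rule ccontr)
    assume "\<not> ?thesis"
    then have "passage k \<omega> + e \<le> Inf {s. 0 \<le> s \<and> int k \<le> Y s \<omega>}"
      using assms(2) by (intro cInf_greatest) (auto simp: reaches_def not_less)
    then show False
      using e by (simp add: passage_def)
  qed
  then obtain s where s: "0 \<le> s" "int k \<le> Y s \<omega>" "s < passage k \<omega> + e" by auto
  then show ?thesis
    using e(2)[OF passage_le[OF s(1,2)] s(3)] by simp
qed

text \<open>Just before the passage the path is below \<open>k\<close>, and it jumps up by at most
  one, so it does not overshoot.\<close>

lemma Y_passage:
  assumes "\<omega> \<in> space M" "reaches k \<omega>"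
  shows "Y (passage k \<omega>) \<omega> = int k"
proof (cases "passage k \<omega> = 0")
  case True
  then show ?thesis
    using passage_attained[OF assms] Y_nonpos[of 0 \<omega>] by simp
next
  case False
  then have pos: "0 < passage k \<omega>"
    using passage_nonneg[OF assms(2)] by simp
  obtain e where e: "e > 0" "\<And>s. passage k \<omega> - e < s \<Longrightarrow> s < passage k \<omega> \<Longrightarrow> Y (passage k \<omega>) \<omega> \<le> Y s \<omega> + 1"
    using Y_left[OF assms(1) pos] by blast
  obtain s where s: "max 0 (passage k \<omega> - e) < s" "s < passage k \<omega>"
    using dense[of "max 0 (passage k \<omega> - e)" "passage k \<omega>"] pos e(1) by auto
  have "Y s \<omega> < int k"
    using passage_le[of s k \<omega>] s by force
  then show ?thesis
    using e(2)[of s] s passage_attained[OF assms] by simp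
qed

lemma passage_strict_mono:
  assumes "\<omega> \<in> space M" "reaches (Suc k) \<omega>"
  shows "passage k \<omega> < passage (Suc k) \<omega>"
proof -
  have r: "reaches k \<omega>"
    using reaches_mono[OF _ assms(2)] by simp
  have "passage k \<omega> \<le> passage (Suc k) \<omega>"
    using Y_passage[OF assms] passage_nonneg[OF assms(2)] by (intro passage_le) auto
  moreover have "passage k \<omega> \<noteq> passage (Suc k) \<omega>"
    using Y_passage[OF assms] Y_passage[OF assms(1) r] by auto
  ultimately show ?thesis by simp
qed

text \<open>The level attained before \<open>u\<close> is held for a while, hence also at a rational
  time before \<open>u\<close>. This works for the strict inequality only.\<close>

lemma passage_less_iff:
  assumes "\<omega> \<in> space M"
  shows "reaches k \<omega> \<and> passage k \<omega> < u \<longleftrightarrow> (\<exists>q\<in>\<rat> \<inter> {0..<u}. int k \<le> Y q \<omega>)"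
proof
  assume "reaches k \<omega> \<and> passage k \<omega> < u"
  then have r: "reaches k \<omega>" "passage k \<omega> < u" by auto
  from right_rational[OF assms passage_nonneg[OF r(1)] r(2)] obtain q
    where "q \<in> \<rat>" "passage k \<omega> < q" "q < u" "Y q \<omega> = Y (passage k \<omega>) \<omega>" .
  then show "\<exists>q\<in>\<rat> \<inter> {0..<u}. int k \<le> Y q \<omega>"
    using passage_attained[OF assms r(1)] passage_nonneg[OF r(1)] by (intro bexI[of _ q]) auto
next
  assume "\<exists>q\<in>\<rat> \<inter> {0..<u}. int k \<le> Y q \<omega>"
  then obtain q where q: "0 \<le> q" "q < u" "int k \<le> Y q \<omega>" by auto
  then show "reaches k \<omega> \<and> passage k \<omega> < u"
    using passage_le[OF q(1,3)] by (auto simp: reaches_def)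
qed

lemma sets_passage_less:
  assumes "{0..<u} \<subseteq> I"
  shows "{\<omega> \<in> space M. reaches k \<omega> \<and> passage k \<omega> < u} \<in> sets (past I)"
proof -
  have "{\<omega> \<in> space M. reaches k \<omega> \<and> passage k \<omega> < u} = {\<omega> \<in> space (past I). \<exists>q\<in>\<rat> \<inter> {0..<u}. int k \<le> Y q \<omega>}"
    using passage_less_iff by auto
  also have "\<dots> \<in> sets (past I)"
  proof (rule sets_Collect_Bex_countable)
    show "countable (\<rat> \<inter> {0..<u})"
      using countable_rat by blast
    fix q assume "q \<in> \<rat> \<inter> {0..<u}"
    then have "q \<in> I" using assms by auto
    from measurable_sets[OF measurable_past[OF this], of "{int k..}"]
    show "{\<omega> \<in> space (past I). int k \<le> Y q \<omega>} \<in> sets (past I)"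
      by (simp add: vimage_def Int_def conj_commute)
  qed
  finally show ?thesis .
qed

lemma sets_reaches: "{0..} \<subseteq> I \<Longrightarrow> {\<omega> \<in> space M. reaches k \<omega>} \<in> sets (past I)"
proof -
  assume I: "{0..} \<subseteq> I"
  have "{\<omega> \<in> space M. reaches k \<omega>} = (\<Union>n. {\<omega> \<in> space M. reaches k \<omega> \<and> passage k \<omega> < real n})"
    using reals_Archimedean2 by auto
  also have "\<dots> \<in> sets (past I)"
  proof (intro sets.countable_nat_UN, rule image_subsetI)
    show "{\<omega> \<in> space M. reaches k \<omega> \<and> passage k \<omega> < real n} \<in> sets (past I)" for n
      using I by (intro sets_passage_less) auto
  qed
  finally show ?thesis .
qed

lemma measurable_passage_past: "passage k \<in> borel_measurable (past {0..})"
proof (subst borel_measurable_iff_less, intro allI)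
  fix u
  \<comment> \<open>The second set collects the paths that miss the level, on which
    \<open>passage\<close> has the constant default value \<open>Inf {}\<close>.\<close>
  have "{\<omega> \<in> space (past {0..}). passage k \<omega> < u} =
    {\<omega> \<in> space M. reaches k \<omega> \<and> passage k \<omega> < u} \<union> ((space M - {\<omega> \<in> space M. reaches k \<omega>}) \<inter> (if Inf {} < u then space M else {}))"
    by (auto simp: passage_def reaches_def) (metis (mono_tags, lifting) Collect_empty_eq)+
  also have "\<dots> \<in> sets (past {0..})"
  proof (intro sets.Un sets.Int sets.Diff)
    show "space M \<in> sets (past {0..})" "(if Inf {} < u then space M else {}) \<in> sets (past {0..})"
      by (simp_all add: top_past)
  qed (auto intro: sets_passage_less sets_reaches)
  finally show "{\<omega> \<in> space (past {0..}). passage k \<omega> < u} \<in> sets (past {0..})" .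
qed

lemma measurable_from_past: "f \<in> measurable (past I) N \<Longrightarrow> f \<in> measurable M N"
  using sets_past_events[of I] by (auto simp: measurable_def)

lemma measurable_passage [measurable]: "passage k \<in> borel_measurable M"
  by (rule measurable_from_past[OF measurable_passage_past])

lemma events_reaches [measurable]: "{\<omega> \<in> space M. reaches k \<omega>} \<in> events"
  using sets_reaches[of "{0..}"] sets_past_events by blast

text \<open>For the excess this is B_(k+1) of the overview; for a single count it is the spacing
  between consecutive points.\<close>

definition gap :: "nat \<Rightarrow> 'a \<Rightarrow> real" where
  "gap k \<omega> = passage (Suc k) \<omega> - passage k \<omega>"

lemma measurable_gap [measurable]: "gap k \<in> borel_measurable M"
  unfolding gap_def[abs_def] by measurable

lemma measurable_gap_past: "gap k \<in> borel_measurable (past {0..})"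
  unfolding gap_def[abs_def] by (intro borel_measurable_diff measurable_passage_past)

lemma sum_gap: "(\<Sum>i<k. gap i \<omega>) = passage k \<omega>"
  using sum_lessThan_telescope[of "\<lambda>i. passage i \<omega>" k] by (simp add: gap_def passage_0)

text \<open>The passage times capped at \<open>u\<close> are measurable in the history at
  \<open>u\<close>, and on the event that level \<open>k\<close> is reached before \<open>u\<close>
  all caps up to \<open>k\<close> are inactive.\<close>

lemma gap_history_past:
  assumes A: "\<And>i. A i \<in> sets borel"
  shows "{\<omega> \<in> space M. reaches k \<omega> \<and> (\<forall>i<k. gap i \<omega> \<in> A i)} \<inter> {\<omega>. passage k \<omega> < u} \<in> sets (past {..u})"
proof -
  let ?R = "\<lambda>i \<omega>. reaches i \<omega> \<and> passage i \<omega> < u"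
  define cap where "cap i \<omega> = (if ?R i \<omega> then passage i \<omega> else u)" for i \<omega>
  have cap: "cap i \<in> borel_measurable (past {..u})" for i
  proof (subst borel_measurable_iff_less, intro allI)
    fix v
    show "{\<omega> \<in> space (past {..u}). cap i \<omega> < v} \<in> sets (past {..u})"
    proof (cases "u < v")
      case True
      then have "{\<omega> \<in> space (past {..u}). cap i \<omega> < v} = space (past {..u})"
        by (auto simp: cap_def)
      then show ?thesis by (simp add: top_past)
    next
      case False
      then have "{\<omega> \<in> space (past {..u}). cap i \<omega> < v} = {\<omega> \<in> space M. reaches i \<omega> \<and> passage i \<omega> < v}"
        by (auto simp: cap_def)
      then show ?thesis
        using sets_passage_less[of v "{..u}" i] False by (auto simp: subset_iff)
    qed
  qed
  have "{\<omega> \<in> space M. reaches k \<omega> \<and> (\<forall>i<k. gap i \<omega> \<in> A i)} \<inter> {\<omega>. passage k \<omega> < u} =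
    {\<omega> \<in> space M. ?R k \<omega>} \<inter> {\<omega> \<in> space (past {..u}). \<forall>i<k. cap (Suc i) \<omega> - cap i \<omega> \<in> A i}"
  proof -
    have "cap i \<omega> = passage i \<omega>" if "\<omega> \<in> space M" "?R k \<omega>" "i \<le> k" for i \<omega>
    proof -
      have ri: "reaches i \<omega>" using reaches_mono that by blast
      have "passage i \<omega> \<le> passage k \<omega>"
        using Y_passage[OF that(1), of k] passage_nonneg[of k \<omega>] that by (intro passage_le) auto
      then show ?thesis
        using that ri by (simp add: cap_def)
    qed
    then show ?thesis
      by (auto simp: gap_def)
  qed
  also have "\<dots> \<in> sets (past {..u})"
  proof (rule sets.Int)
    have [measurable]: "cap i \<in> borel_measurable (past {..u})" "A i \<in> sets borel" for i
      by (rule cap) (rule A)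
    show "{\<omega> \<in> space (past {..u}). \<forall>i<k. cap (Suc i) \<omega> - cap i \<omega> \<in> A i} \<in> sets (past {..u})"
      by measurable
  qed (auto intro: sets_passage_less)
  finally show ?thesis .
qed

text \<open>A gap shorter than \<open>a\<close> is visible at a rational time before
  \<open>a\<close>, as level \<open>k + 1\<close> is held for a while. A gap equal to
  \<open>a\<close> is visible only at \<open>a\<close>, which is therefore added to the
  rationals.\<close>

lemma gap_le_iff:
  assumes "\<omega> \<in> space M" "reaches (Suc k) \<omega>" "0 < a"
  shows "gap k \<omega> \<le> a \<longleftrightarrow> (\<exists>s\<in>insert a (\<rat> \<inter> {0<..<a}). Y (passage k \<omega> + s) \<omega> - Y (passage k \<omega>) \<omega> \<in> {1..})"
proof -
  have rk: "reaches k \<omega>" using reaches_mono[OF _ assms(2)] by simp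
  note Yk = Y_passage[OF assms(1) rk] and pk = passage_nonneg[OF rk]
  have lt: "0 < gap k \<omega>"
    using passage_strict_mono[OF assms(1,2)] by (simp add: gap_def)
  show ?thesis
  proof
    assume le: "gap k \<omega> \<le> a"
    have Yg: "Y (passage k \<omega> + gap k \<omega>) \<omega> = int k + 1"
      using Y_passage[OF assms(1,2)] by (simp add: gap_def)
    show "\<exists>s\<in>insert a (\<rat> \<inter> {0<..<a}). Y (passage k \<omega> + s) \<omega> - Y (passage k \<omega>) \<omega> \<in> {1..}"
    proof (cases "gap k \<omega> = a")
      case True
      then show ?thesis using Yg Yk by auto
    next
      case False
      with le have "gap k \<omega> < a" by simp
      obtain e where e: "e > 0" "\<And>s. passage k \<omega> + gap k \<omega> \<le> s \<Longrightarrow> s < passage k \<omega> + gap k \<omega> + e \<Longrightarrow> Y s \<omega> = Y (passage k \<omega> + gap k \<omega>) \<omega>"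
        using Y_right[OF assms(1), of "passage k \<omega> + gap k \<omega>"] pk lt by auto
      obtain q where q: "q \<in> \<rat>" "gap k \<omega> < q" "q < min a (gap k \<omega> + e)"
        using Rats_dense_in_real[of "gap k \<omega>" "min a (gap k \<omega> + e)"] \<open>gap k \<omega> < a\<close> e(1) by auto
      then have "Y (passage k \<omega> + q) \<omega> = int k + 1"
        using e(2)[of "passage k \<omega> + q"] Yg by simp
      then show ?thesis
        using q lt Yk by (intro bexI[of _ q]) auto
    qed
  next
    assume "\<exists>s\<in>insert a (\<rat> \<inter> {0<..<a}). Y (passage k \<omega> + s) \<omega> - Y (passage k \<omega>) \<omega> \<in> {1..}"
    then obtain s where s: "0 < s" "s \<le> a" "int k + 1 \<le> Y (passage k \<omega> + s) \<omega>"
      using assms(3) Yk by auto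
    then have "passage (Suc k) \<omega> \<le> passage k \<omega> + s"
      using pk by (intro passage_le) auto
    then show "gap k \<omega> \<le> a"
      using s by (simp add: gap_def)
  qed
qed

end

locale transient_process = stationary_process +
  assumes AE_reaches: "AE \<omega> in M. reaches k \<omega>"
begin

text \<open>For positive \<open>a\<close> this is the strong Markov property at the passage to level
  \<open>k\<close>: the next gap is the first passage to level 1 of the restarted path. For other
  \<open>a\<close> both sides vanish, since gaps are almost surely positive.\<close>

lemma prob_history_gap_le:
  assumes A: "\<And>i. A i \<in> sets borel"
  shows "prob ({\<omega> \<in> space M. \<forall>i<k. gap i \<omega> \<in> A i} \<inter> {\<omega> \<in> space M. gap k \<omega> \<le> a}) =
    prob {\<omega> \<in> space M. \<forall>i<k. gap i \<omega> \<in> A i} * prob {\<omega> \<in> space M. gap 0 \<omega> \<le> a}"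
proof (cases "0 < a")
  case True
  have [measurable]: "A i \<in> sets borel" for i by (rule A)
  let ?Q = "insert a (\<rat> \<inter> {0<..<a})"
  let ?E = "{\<omega> \<in> space M. reaches k \<omega> \<and> (\<forall>i<k. gap i \<omega> \<in> A i)}"
  have Q: "countable ?Q" "?Q \<subseteq> {0<..}"
    using countable_rat True by auto
  have E: "?E \<in> events" by measurable
  have 1: "prob ({\<omega> \<in> space M. \<forall>i<k. gap i \<omega> \<in> A i} \<inter> {\<omega> \<in> space M. gap k \<omega> \<le> a}) =
    prob (?E \<inter> {\<omega> \<in> space M. \<exists>s\<in>?Q. Y (passage k \<omega> + s) \<omega> - Y (passage k \<omega>) \<omega> \<in> {1..}})"
  proof (rule measure_eq_AE)
    show "AE \<omega> in M. (\<omega> \<in> {\<omega> \<in> space M. \<forall>i<k. gap i \<omega> \<in> A i} \<inter> {\<omega> \<in> space M. gap k \<omega> \<le> a}) =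
      (\<omega> \<in> ?E \<inter> {\<omega> \<in> space M. \<exists>s\<in>?Q. Y (passage k \<omega> + s) \<omega> - Y (passage k \<omega>) \<omega> \<in> {1..}})"
      using AE_reaches[of "Suc k"]
    proof (rule AE_mp, intro AE_I2 impI)
      fix \<omega> assume w: "\<omega> \<in> space M" "reaches (Suc k) \<omega>"
      then have "reaches k \<omega>" using reaches_mono[OF _ w(2)] by simp
      then show "(\<omega> \<in> {\<omega> \<in> space M. \<forall>i<k. gap i \<omega> \<in> A i} \<inter> {\<omega> \<in> space M. gap k \<omega> \<le> a}) =
      (\<omega> \<in> ?E \<inter> {\<omega> \<in> space M. \<exists>s\<in>?Q. Y (passage k \<omega> + s) \<omega> - Y (passage k \<omega>) \<omega> \<in> {1..}})"
        using gap_le_iff[OF w True] w by blast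
    qed
    show "?E \<inter> {\<omega> \<in> space M. \<exists>s\<in>?Q. Y (passage k \<omega> + s) \<omega> - Y (passage k \<omega>) \<omega> \<in> {1..}} \<in> events"
      by (rule strong_markov_hit(2)[OF E _ _ Q]) (use passage_nonneg gap_history_past[OF A] in auto)
  qed measurable
  have 2: "prob (?E \<inter> {\<omega> \<in> space M. \<exists>s\<in>?Q. Y (passage k \<omega> + s) \<omega> - Y (passage k \<omega>) \<omega> \<in> {1..}}) =
    prob ?E * prob {\<omega> \<in> space M. \<exists>s\<in>?Q. Y s \<omega> \<in> {1..}}"
    by (rule strong_markov_hit(1)[OF E _ _ Q]) (use passage_nonneg gap_history_past[OF A] in auto)
  have 3: "prob ?E = prob {\<omega> \<in> space M. \<forall>i<k. gap i \<omega> \<in> A i}"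
    by (rule measure_eq_AE) (use AE_reaches[of k] in \<open>auto elim!: AE_mp\<close>)
  have 4: "prob {\<omega> \<in> space M. \<exists>s\<in>?Q. Y s \<omega> \<in> {1..}} = prob {\<omega> \<in> space M. gap 0 \<omega> \<le> a}"
  proof (rule measure_eq_AE)
    show "AE \<omega> in M. (\<omega> \<in> {\<omega> \<in> space M. \<exists>s\<in>?Q. Y s \<omega> \<in> {1..}}) = (\<omega> \<in> {\<omega> \<in> space M. gap 0 \<omega> \<le> a})"
      using AE_reaches[of "Suc 0"]
    proof (rule AE_mp, intro AE_I2 impI)
      fix \<omega> assume w: "\<omega> \<in> space M" "reaches (Suc 0) \<omega>"
      show "(\<omega> \<in> {\<omega> \<in> space M. \<exists>s\<in>?Q. Y s \<omega> \<in> {1..}}) = (\<omega> \<in> {\<omega> \<in> space M. gap 0 \<omega> \<le> a})"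
        using gap_le_iff[OF w True] w by (simp add: passage_0 Y_nonpos)
    qed
    show "{\<omega> \<in> space M. \<exists>s\<in>?Q. Y s \<omega> \<in> {1..}} \<in> events"
      by (rule sets_Collect_Bex_countable[OF Q(1)]) (rule events_Y)
  qed measurable
  show ?thesis
    by (simp only: 1 2 3 4)
next
  case False
  have null: "prob ({\<omega> \<in> space M. gap j \<omega> \<le> a}) = 0" for j
  proof -
    have "prob {\<omega> \<in> space M. gap j \<omega> \<le> a} = prob {}"
    proof (rule measure_eq_AE)
      show "AE \<omega> in M. (\<omega> \<in> {\<omega> \<in> space M. gap j \<omega> \<le> a}) = (\<omega> \<in> {})"
        using AE_reaches[of "Suc j"]
      proof (rule AE_mp, intro AE_I2 impI)
        fix \<omega> assume "\<omega> \<in> space M" "reaches (Suc j) \<omega>"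
        then have "0 < gap j \<omega>"
          using passage_strict_mono by (simp add: gap_def)
        then show "(\<omega> \<in> {\<omega> \<in> space M. gap j \<omega> \<le> a}) = (\<omega> \<in> {})"
          using False by simp
      qed
    qed measurable
    then show ?thesis by simp
  qed
  have "prob ({\<omega> \<in> space M. \<forall>i<k. gap i \<omega> \<in> A i} \<inter> {\<omega> \<in> space M. gap k \<omega> \<le> a}) \<le> prob {\<omega> \<in> space M. gap k \<omega> \<le> a}"
    by (rule finite_measure_mono) measurable
  then show ?thesis
    using null[of k] null[of 0] by (simp add: measure_nonneg order.antisym)
qed

lemma distr_gap: "distr M borel (gap k) = distr M borel (gap 0)"
proof -
  have "real_distribution (distr M borel (gap j))" for j
    by (rule real_distribution_distr) measurable
  moreover have "cdf (distr M borel (gap k)) = cdf (distr M borel (gap 0))"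
  proof
    fix a
    have "prob {\<omega> \<in> space M. gap k \<omega> \<le> a} = prob {\<omega> \<in> space M. gap 0 \<omega> \<le> a}"
      using prob_history_gap_le[where A="\<lambda>_. UNIV" and k=k and a=a] by (simp add: prob_space Int_absorb1)
    then show "cdf (distr M borel (gap k)) a = cdf (distr M borel (gap 0)) a"
      by (simp add: cdf_def measure_distr vimage_def Int_def conj_commute)
  qed
  ultimately show ?thesis
    by (intro cdf_unique)
qed

text \<open>Half lines are closed under intersection and generate the Borel sets, so the
  factorisation of a half-line event for the last gap extends to all Borel sets; induction on the
  number of gaps does the rest.\<close>

lemma indep_gap: "indep_vars (\<lambda>_. borel) gap UNIV"
proof (rule indep_vars_natI)
  fix n and A :: "nat \<Rightarrow> real set"
  assume A: "\<And>i. A i \<in> sets borel"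
  then have [measurable]: "A i \<in> sets borel" for i by blast
  show "prob {\<omega> \<in> space M. \<forall>i<n. gap i \<omega> \<in> A i} = (\<Prod>i<n. prob {\<omega> \<in> space M. gap i \<omega> \<in> A i})"
  proof (induction n)
    case (Suc n)
    let ?E = "{\<omega> \<in> space M. \<forall>i<n. gap i \<omega> \<in> A i}"
    let ?G = "range (\<lambda>a. {\<omega> \<in> space M. gap n \<omega> \<le> a})"
    have "indep_set {?E} ?G"
    proof (rule indep_setI)
      fix a b assume "a \<in> {?E}" "b \<in> ?G"
      then obtain x where ab: "a = ?E" "b = {\<omega> \<in> space M. gap n \<omega> \<le> x}" by blast
      have "prob b = prob {\<omega> \<in> space M. gap 0 \<omega> \<le> x}"
        unfolding ab using prob_history_gap_le[where A="\<lambda>_. UNIV" and k=n and a=x] by (simp add: prob_space Int_absorb1)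
      then show "prob (a \<inter> b) = prob a * prob b"
        unfolding ab using prob_history_gap_le[where A=A and k=n and a=x, OF A] by simp
    qed auto
    moreover have "Int_stable ?G"
    proof (rule Int_stableI)
      fix a b assume "a \<in> ?G" "b \<in> ?G"
      then obtain x y where "a = {\<omega> \<in> space M. gap n \<omega> \<le> x}" "b = {\<omega> \<in> space M. gap n \<omega> \<le> y}" by blast
      then have "a \<inter> b = {\<omega> \<in> space M. gap n \<omega> \<le> min x y}" by auto
      then show "a \<inter> b \<in> ?G" by blast
    qed
    ultimately have ind: "indep_set (sigma_sets (space M) {?E}) (sigma_sets (space M) ?G)"
      by (intro indep_set_sigma_sets) (auto simp: Int_stable_def)
    have "gap n \<in> borel_measurable (sigma (space M) ?G)"
      unfolding borel_measurable_iff_le by (auto simp: space_measure_of_conv)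
    then have "gap n -` A n \<inter> space (sigma (space M) ?G) \<in> sets (sigma (space M) ?G)"
      by (rule measurable_sets) (rule A)
    moreover have "sets (sigma (space M) ?G) = sigma_sets (space M) ?G"
      by (rule sets_measure_of) auto
    ultimately have "gap n -` A n \<inter> space M \<in> sigma_sets (space M) ?G"
      by (simp add: space_measure_of_conv)
    then have "prob (?E \<inter> (gap n -` A n \<inter> space M)) = prob ?E * prob (gap n -` A n \<inter> space M)"
      by (rule indep_setD[OF ind sigma_sets.Basic, rotated]) simp
    moreover have "?E \<inter> (gap n -` A n \<inter> space M) = {\<omega> \<in> space M. \<forall>i<Suc n. gap i \<omega> \<in> A i}"
      by (auto simp: less_Suc_eq)
    moreover have "gap n -` A n \<inter> space M = {\<omega> \<in> space M. gap n \<omega> \<in> A n}"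
      by auto
    ultimately show ?case
      using Suc by simp
  qed (simp add: prob_space)
qed measurable

end

section \<open>Optional stopping\<close>

context stationary_process
begin

lemma prob_past_increment:
  assumes "0 < u" "0 < d" "E \<in> sets (past {..u})"
  shows "prob (E \<inter> {\<omega> \<in> space M. Y (u + d) \<omega> - Y u \<omega> = k}) = prob E * incr_prob d k"
  using prob_past_increments[of u E "[(d, k)]"] assms by simp

lemma distr_increment:
  assumes "0 < u" "0 < d"
  shows "distr M (count_space UNIV) (\<lambda>\<omega>. Y (u + d) \<omega> - Y u \<omega>) = distr M (count_space UNIV) (Y d)"
proof (rule measure_eqI_countable[where A=UNIV])
  fix k :: int
  have "prob {\<omega> \<in> space M. Y (u + d) \<omega> - Y u \<omega> = k} = incr_prob d k"
    using prob_past_increment[OF assms top_past, of k] by (simp add: prob_space Int_absorb1)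
  then show "emeasure (distr M (count_space UNIV) (\<lambda>\<omega>. Y (u + d) \<omega> - Y u \<omega>)) {k} = emeasure (distr M (count_space UNIV) (Y d)) {k}"
    by (simp add: emeasure_distr emeasure_eq_measure vimage_def Int_def conj_commute)
qed auto

lemma nn_integral_past_increment:
  fixes f :: "'a \<Rightarrow> ennreal" and h :: "int \<Rightarrow> ennreal"
  assumes u: "0 < u" and d: "0 < d" and f: "f \<in> borel_measurable (past {..u})"
  shows "(\<integral>\<^sup>+\<omega>. f \<omega> * h (Y (u + d) \<omega> - Y u \<omega>) \<partial>M) = (\<integral>\<^sup>+\<omega>. f \<omega> \<partial>M) * (\<integral>\<^sup>+\<omega>. h (Y d \<omega>) \<partial>M)"
proof -
  define g where "g \<omega> = h (Y (u + d) \<omega> - Y u \<omega>)" for \<omega>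
  let ?C = "\<lambda>k. {\<omega> \<in> space M. Y (u + d) \<omega> - Y u \<omega> = k}"
  let ?G = "insert {} (range ?C)"
  have C: "?C k \<in> events" for k by measurable
  have probC: "prob (?C k) = incr_prob d k" for k
    using prob_past_increment[OF u d top_past, of k] by (simp add: prob_space Int_absorb1)
  have "indep_set (sets (past {..u})) ?G"
  proof (rule indep_setI)
    fix a b assume "a \<in> sets (past {..u})" "b \<in> ?G"
    then show "prob (a \<inter> b) = prob a * prob b"
      using prob_past_increment[OF u d] probC by auto
  qed (use C sets_past_events in auto)
  moreover have "Int_stable (sets (past {..u}))" by (auto simp: Int_stable_def)
  moreover have "Int_stable ?G" by (auto simp: Int_stable_def)
  ultimately have ind: "indep_set (sigma_sets (space M) (sets (past {..u}))) (sigma_sets (space M) ?G)"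
    by (rule indep_set_sigma_sets)
  have gG: "g -` B \<inter> space M \<in> sigma_sets (space M) ?G" for B
  proof -
    have "g -` B \<inter> space M = (\<Union>k\<in>h -` B. ?C k)"
      by (auto simp: g_def)
    also have "\<dots> \<in> sigma_sets (space M) ?G"
      by (rule sigma_sets_UNION) (auto intro: sigma_sets.Basic)
    finally show ?thesis .
  qed
  have f': "f \<in> borel_measurable M" by (rule measurable_from_past[OF f])
  have g': "g \<in> borel_measurable M" unfolding g_def by measurable
  define X where "X b = (if b then f else g)" for b :: bool
  have "indep_vars (\<lambda>_. borel) X UNIV"
    unfolding indep_vars_def2
  proof (intro conjI ballI)
    show "X b \<in> borel_measurable M" for b
      using f' g' by (simp add: X_def)
    show "indep_sets (\<lambda>b. {X b -` A \<inter> space M |A. A \<in> sets borel}) UNIV"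
    proof (rule indep_sets_mono_sets[OF ind[unfolded indep_set_def]])
      fix b :: bool
      have "f -` A \<inter> space M \<in> sets (past {..u})" if "A \<in> sets borel" for A
        using measurable_sets[OF f that] by simp
      then show "{X b -` A \<inter> space M |A. A \<in> sets borel} \<subseteq>
        (case b of True \<Rightarrow> sigma_sets (space M) (sets (past {..u})) | False \<Rightarrow> sigma_sets (space M) ?G)"
        using gG by (cases b) (auto simp: X_def intro: sigma_sets.Basic)
    qed
  qed
  then have "(\<integral>\<^sup>+\<omega>. (\<Prod>b\<in>UNIV. X b \<omega>) \<partial>M) = (\<Prod>b\<in>UNIV. \<integral>\<^sup>+\<omega>. X b \<omega> \<partial>M)"
    by (intro indep_vars_nn_integral) auto
  then have "(\<integral>\<^sup>+\<omega>. f \<omega> * g \<omega> \<partial>M) = (\<integral>\<^sup>+\<omega>. f \<omega> \<partial>M) * (\<integral>\<^sup>+\<omega>. g \<omega> \<partial>M)"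
    by (simp add: UNIV_bool X_def mult.commute)
  also have "(\<integral>\<^sup>+\<omega>. g \<omega> \<partial>M) = (\<integral>\<^sup>+k. h k \<partial>distr M (count_space UNIV) (\<lambda>\<omega>. Y (u + d) \<omega> - Y u \<omega>))"
    by (subst nn_integral_distr) (auto simp: g_def[abs_def])
  also have "\<dots> = (\<integral>\<^sup>+\<omega>. h (Y d \<omega>) \<partial>M)"
    unfolding distr_increment[OF u d] by (subst nn_integral_distr) auto
  finally show ?thesis by (simp add: g_def)
qed

text \<open>The factor z^(Y v - Y u) is independent of the history at \<open>u\<close> and has mean
  1.\<close>

lemma exponential_martingale:
  assumes z: "0 < z" and mart: "\<And>d. 0 < d \<Longrightarrow> (\<integral>\<^sup>+\<omega>. ennreal (z powi Y d \<omega>) \<partial>M) = 1"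
    and u: "0 < u" "u \<le> v" and F: "F \<in> sets (past {..u})"
  shows "(\<integral>\<^sup>+\<omega>. ennreal (z powi Y v \<omega>) * indicator F \<omega> \<partial>M) = (\<integral>\<^sup>+\<omega>. ennreal (z powi Y u \<omega>) * indicator F \<omega> \<partial>M)"
proof (cases "u = v")
  case False
  define d where "d = v - u"
  have d: "0 < d" "v = u + d" using u False by (auto simp: d_def)
  let ?f = "\<lambda>\<omega>. ennreal (z powi Y u \<omega>) * indicator F \<omega>"
  have [measurable]: "Y u \<in> measurable (past {..u}) (count_space UNIV)" "F \<in> sets (past {..u})"
    using F by (auto intro: measurable_past)
  have "?f \<in> borel_measurable (past {..u})"
    by measurable
  from nn_integral_past_increment[OF u(1) d(1) this, of "\<lambda>k. ennreal (z powi k)"]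
  have "(\<integral>\<^sup>+\<omega>. ?f \<omega> * ennreal (z powi (Y v \<omega> - Y u \<omega>)) \<partial>M) = (\<integral>\<^sup>+\<omega>. ?f \<omega> \<partial>M)"
    by (simp add: mart d)
  moreover have "?f \<omega> * ennreal (z powi (Y v \<omega> - Y u \<omega>)) = ennreal (z powi Y v \<omega>) * indicator F \<omega>" for \<omega>
    using z by (auto simp: ennreal_mult'[symmetric] power_int_add[symmetric] split: split_indicator)
  ultimately show ?thesis by simp
qed simp

text \<open>On each dyadic cell the martingale may be moved from time \<open>N\<close> back to the
  rounded passage time. As the mesh shrinks its value there tends to \<open>z ^ j\<close>, and
  \<open>w\<close>, an integrable majorant of the path of z^Y on [0,N], permits the limit under the
  integral.\<close>

lemma optional_stopping_passage:
  fixes N j :: nat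
  assumes z: "0 < z" and mart: "\<And>d. 0 < d \<Longrightarrow> (\<integral>\<^sup>+\<omega>. ennreal (z powi Y d \<omega>) \<partial>M) = 1"
    and w [measurable]: "w \<in> borel_measurable M" and w_fin: "(\<integral>\<^sup>+\<omega>. w \<omega> \<partial>M) < \<infinity>"
    and w_dom: "\<And>\<omega> s. \<omega> \<in> space M \<Longrightarrow> 0 \<le> s \<Longrightarrow> s \<le> real N \<Longrightarrow> ennreal (z powi Y s \<omega>) \<le> w \<omega>"
  defines "E \<equiv> {\<omega> \<in> space M. reaches j \<omega> \<and> passage j \<omega> < real N}"
  shows "(\<integral>\<^sup>+\<omega>. ennreal (z powi Y (real N) \<omega>) * indicator E \<omega> \<partial>M) = ennreal (z ^ j) * emeasure M E"
proof -
  have E: "E \<in> events"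
    unfolding E_def using sets_passage_less[of "real N" UNIV j] sets_past_events by blast
  then have [measurable]: "E \<in> events" .
  define Z where "Z n \<omega> = nat \<lfloor>passage j \<omega> * 2 ^ n\<rfloor>" for n \<omega>
  define tau where "tau n i = real (Suc i) / 2 ^ n" for n i :: nat
  have [measurable]: "Z n \<in> measurable M (count_space UNIV)" for n
    unfolding Z_def by measurable
  have Z_iff: "Z n \<omega> = i \<longleftrightarrow> passage j \<omega> < tau n i \<and> \<not> passage j \<omega> < real i / 2 ^ n" if "reaches j \<omega>" for n i \<omega>
  proof -
    have "Z n \<omega> = i \<longleftrightarrow> \<lfloor>passage j \<omega> * 2 ^ n\<rfloor> = int i"
      unfolding Z_def using passage_nonneg[OF that] by (auto simp: nat_eq_iff)
    also have "\<dots> \<longleftrightarrow> real i \<le> passage j \<omega> * 2 ^ n \<and> passage j \<omega> * 2 ^ n < real i + 1"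
      by (simp add: floor_eq_iff)
    finally show ?thesis
      by (auto simp: tau_def field_simps not_less)
  qed
  \<comment> \<open>\<open>N\<close> is itself a multiple of the mesh, so rounding up a time before
    \<open>N\<close> never passes \<open>N\<close>.\<close>
  have tau_le: "tau n i \<le> real N" if "\<omega> \<in> E" "Z n \<omega> = i" for n i \<omega>
  proof -
    have "real i / 2 ^ n < real N"
      using that Z_iff[of \<omega> n i] by (auto simp: E_def)
    then have "real i < real (N * 2 ^ n)"
      by (simp add: field_simps)
    then have "Suc i \<le> N * 2 ^ n" by linarith
    then have "real (Suc i) \<le> real (N * 2 ^ n)" by (simp only: of_nat_le_iff)
    then show ?thesis
      by (simp add: tau_def field_simps)
  qed
  have cell: "E \<inter> {\<omega> \<in> space M. Z n \<omega> = i} \<in> sets (past {..tau n i})" if "tau n i \<le> real N" for n i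
  proof -
    have "E \<inter> {\<omega> \<in> space M. Z n \<omega> = i} =
      {\<omega> \<in> space M. reaches j \<omega> \<and> passage j \<omega> < tau n i} - {\<omega> \<in> space M. reaches j \<omega> \<and> passage j \<omega> < real i / 2 ^ n}"
      using Z_iff that by (auto simp: E_def)
    moreover have "real i / 2 ^ n \<le> tau n i"
      by (simp add: tau_def divide_right_mono)
    ultimately show ?thesis
      by (auto intro!: sets.Diff sets_passage_less)
  qed
  have step: "(\<integral>\<^sup>+\<omega>. ennreal (z powi Y (real N) \<omega>) * indicator E \<omega> \<partial>M) =
      (\<integral>\<^sup>+\<omega>. ennreal (z powi Y (tau n (Z n \<omega>)) \<omega>) * indicator E \<omega> \<partial>M)" for n
  proof -
    let ?F = "\<lambda>i. E \<inter> {\<omega> \<in> space M. Z n \<omega> = i}"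
    have split: "f \<omega> * indicator E \<omega> = (\<Sum>i. f \<omega> * indicator (?F i) \<omega>)" if "\<omega> \<in> space M" for f :: "'a \<Rightarrow> ennreal" and \<omega>
    proof -
      have "(\<lambda>i. f \<omega> * indicator (?F i) \<omega>) sums (\<Sum>i\<in>{Z n \<omega>}. f \<omega> * indicator (?F i) \<omega>)"
        by (rule sums_finite) auto
      then show ?thesis
        using that by (simp add: sums_iff indicator_def)
    qed
    have "(\<integral>\<^sup>+\<omega>. ennreal (z powi Y (real N) \<omega>) * indicator E \<omega> \<partial>M) =
        (\<integral>\<^sup>+\<omega>. (\<Sum>i. ennreal (z powi Y (real N) \<omega>) * indicator (?F i) \<omega>) \<partial>M)"
      by (intro nn_integral_cong split)
    also have "\<dots> = (\<Sum>i. \<integral>\<^sup>+\<omega>. ennreal (z powi Y (real N) \<omega>) * indicator (?F i) \<omega> \<partial>M)"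
      by (rule nn_integral_suminf) measurable
    also have "\<dots> = (\<Sum>i. \<integral>\<^sup>+\<omega>. ennreal (z powi Y (tau n i) \<omega>) * indicator (?F i) \<omega> \<partial>M)"
    proof (rule suminf_cong)
      fix i
      show "(\<integral>\<^sup>+\<omega>. ennreal (z powi Y (real N) \<omega>) * indicator (?F i) \<omega> \<partial>M) = (\<integral>\<^sup>+\<omega>. ennreal (z powi Y (tau n i) \<omega>) * indicator (?F i) \<omega> \<partial>M)"
      proof (cases "tau n i \<le> real N")
        case True
        show ?thesis
          by (rule exponential_martingale[OF z mart _ True cell[OF True]]) (auto simp: tau_def)
      next
        case False
        then have "?F i = {}" using tau_le by auto
        then show ?thesis by simp
      qed
    qed
    also have "\<dots> = (\<integral>\<^sup>+\<omega>. (\<Sum>i. ennreal (z powi Y (tau n i) \<omega>) * indicator (?F i) \<omega>) \<partial>M)"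
      by (rule nn_integral_suminf[symmetric]) measurable
    also have "\<dots> = (\<integral>\<^sup>+\<omega>. (\<Sum>i. ennreal (z powi Y (tau n (Z n \<omega>)) \<omega>) * indicator (?F i) \<omega>) \<partial>M)"
      by (intro nn_integral_cong suminf_cong) (auto split: split_indicator)
    also have "\<dots> = (\<integral>\<^sup>+\<omega>. ennreal (z powi Y (tau n (Z n \<omega>)) \<omega>) * indicator E \<omega> \<partial>M)"
      by (intro nn_integral_cong split[symmetric])
    finally show ?thesis .
  qed
  have meas: "(\<lambda>\<omega>. Y (tau n (Z n \<omega>)) \<omega>) \<in> measurable M (count_space UNIV)" for n
    by (rule measurable_compose_countable'[where I=UNIV]) auto
  have "(\<lambda>n. \<integral>\<^sup>+\<omega>. ennreal (z powi Y (tau n (Z n \<omega>)) \<omega>) * indicator E \<omega> \<partial>M) \<longlonglongrightarrow>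
      (\<integral>\<^sup>+\<omega>. ennreal (z ^ j) * indicator E \<omega> \<partial>M)"
  proof (rule nn_integral_dominated_convergence[where w=w])
    have [measurable]: "(\<lambda>\<omega>. Y (tau n (Z n \<omega>)) \<omega>) \<in> measurable M (count_space UNIV)" for n
      by (rule meas)
    show "(\<lambda>\<omega>. ennreal (z powi Y (tau n (Z n \<omega>)) \<omega>) * indicator E \<omega>) \<in> borel_measurable M" for n
      by measurable
    show "AE \<omega> in M. ennreal (z powi Y (tau n (Z n \<omega>)) \<omega>) * indicator E \<omega> \<le> w \<omega>" for n
    proof (rule AE_I2)
      fix \<omega> assume w: "\<omega> \<in> space M"
      show "ennreal (z powi Y (tau n (Z n \<omega>)) \<omega>) * indicator E \<omega> \<le> w \<omega>"
        using w_dom[OF w _ tau_le[OF _ refl], of n] by (auto simp: tau_def split: split_indicator)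
    qed
    show "AE \<omega> in M. (\<lambda>n. ennreal (z powi Y (tau n (Z n \<omega>)) \<omega>) * indicator E \<omega>) \<longlonglongrightarrow> ennreal (z ^ j) * indicator E \<omega>"
    proof (rule AE_I2)
      fix \<omega> assume w: "\<omega> \<in> space M"
      show "(\<lambda>n. ennreal (z powi Y (tau n (Z n \<omega>)) \<omega>) * indicator E \<omega>) \<longlonglongrightarrow> ennreal (z ^ j) * indicator E \<omega>"
      proof (cases "\<omega> \<in> E")
        case True
        then have r: "reaches j \<omega>" by (simp add: E_def)
        obtain e where e: "e > 0" "\<And>s. passage j \<omega> \<le> s \<Longrightarrow> s < passage j \<omega> + e \<Longrightarrow> Y s \<omega> = Y (passage j \<omega>) \<omega>"
          using Y_right[OF w passage_nonneg[OF r]] by auto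
        have "\<forall>\<^sub>F n in sequentially. (1 / 2) ^ n < e"
          using order_tendstoD(2)[OF LIMSEQ_power_zero[of "1 / 2 :: real"] e(1)] by simp
        then have "\<forall>\<^sub>F n in sequentially. Y (tau n (Z n \<omega>)) \<omega> = int j"
        proof eventually_elim
          case (elim n)
          have "passage j \<omega> < tau n (Z n \<omega>)" "\<not> passage j \<omega> < real (Z n \<omega>) / 2 ^ n"
            using Z_iff[OF r, of n "Z n \<omega>"] by auto
          moreover have "tau n (Z n \<omega>) = real (Z n \<omega>) / 2 ^ n + (1 / 2) ^ n"
            by (simp add: tau_def field_simps)
          ultimately have "Y (tau n (Z n \<omega>)) \<omega> = Y (passage j \<omega>) \<omega>"
            using elim by (intro e(2)) auto
          then show ?case
            using Y_passage[OF w r] by simp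
        qed
        then have "\<forall>\<^sub>F n in sequentially. ennreal (z powi Y (tau n (Z n \<omega>)) \<omega>) * indicator E \<omega> = ennreal (z ^ j) * indicator E \<omega>"
          by eventually_elim simp
        then show ?thesis
          by (rule tendsto_eventually)
      qed simp
    qed
  qed (use w_fin in auto)
  then have "(\<integral>\<^sup>+\<omega>. ennreal (z powi Y (real N) \<omega>) * indicator E \<omega> \<partial>M) = (\<integral>\<^sup>+\<omega>. ennreal (z ^ j) * indicator E \<omega> \<partial>M)"
    by (simp add: step[symmetric] LIMSEQ_const_iff)
  then show ?thesis
    by (simp add: nn_integral_cmult_indicator E)
qed

text \<open>With z = y^2, split the mean 1 of z^Y(N) according to whether level \<open>j\<close> is
  reached before \<open>N\<close>. The first part is z^j times the probability sought. In the second
  Y(N) \<le> j, so the integrand is at most y^j y^Y(N), whose mean vanishes by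
  \<open>decay\<close>.\<close>

lemma prob_reaches:
  assumes y: "1 \<le> y" and mart: "\<And>d. 0 < d \<Longrightarrow> (\<integral>\<^sup>+\<omega>. ennreal ((y ^ 2) powi Y d \<omega>) \<partial>M) = 1"
    and w: "\<And>N. w N \<in> borel_measurable M" "\<And>N. (\<integral>\<^sup>+\<omega>. w N \<omega> \<partial>M) < \<infinity>"
      "\<And>N \<omega> s. \<omega> \<in> space M \<Longrightarrow> 0 \<le> s \<Longrightarrow> s \<le> real N \<Longrightarrow> ennreal ((y ^ 2) powi Y s \<omega>) \<le> w N \<omega>"
    and decay: "(\<lambda>N. \<integral>\<^sup>+\<omega>. ennreal (y powi Y (real N) \<omega>) \<partial>M) \<longlonglongrightarrow> 0"
  shows "prob {\<omega> \<in> space M. reaches j \<omega>} = (1 / y ^ 2) ^ j"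
proof -
  define E where "E N = {\<omega> \<in> space M. reaches j \<omega> \<and> passage j \<omega> < real N}" for N :: nat
  have E: "E N \<in> events" for N
    unfolding E_def using sets_passage_less[of "real N" UNIV j] sets_past_events by blast
  have y0: "0 < y ^ 2" "0 < y" using y by auto
  have lower: "1 - ennreal (y ^ j) * (\<integral>\<^sup>+\<omega>. ennreal (y powi Y (real N) \<omega>) \<partial>M) \<le> ennreal ((y ^ 2) ^ j) * emeasure M (E N)"
    and upper: "ennreal ((y ^ 2) ^ j) * emeasure M (E N) \<le> 1" if N: "0 < N" for N
  proof -
    note [measurable] = E
    \<comment> \<open>Equality is possible: level \<open>j\<close> may be reached exactly at time
      \<open>N\<close>. Before \<open>N\<close> the path is below \<open>j\<close>, and the last
      jump adds at most one.\<close>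
    have le: "Y (real N) \<omega> \<le> int j" if w': "\<omega> \<in> space M - E N" for \<omega>
    proof -
      obtain e where e: "e > 0" "\<And>s. real N - e < s \<Longrightarrow> s < real N \<Longrightarrow> Y (real N) \<omega> \<le> Y s \<omega> + 1"
        using Y_left[of \<omega> "real N"] w' N by auto
      obtain s where s: "max 0 (real N - e) < s" "s < real N"
        using dense[of "max 0 (real N - e)" "real N"] N e(1) by auto
      have "\<not> int j \<le> Y s \<omega>"
        using passage_le[of s j \<omega>] w' s by (auto simp: E_def reaches_def)
      then show ?thesis
        using e(2)[of s] s by simp
    qed
    have "1 = (\<integral>\<^sup>+\<omega>. ennreal ((y ^ 2) powi Y (real N) \<omega>) \<partial>M)"
      using mart[of "real N"] N by simp
    also have "\<dots> = (\<integral>\<^sup>+\<omega>. ennreal ((y ^ 2) powi Y (real N) \<omega>) * indicator (E N) \<omega> + ennreal ((y ^ 2) powi Y (real N) \<omega>) * indicator (space M - E N) \<omega> \<partial>M)"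
      by (intro nn_integral_cong) (auto split: split_indicator)
    also have "\<dots> = (\<integral>\<^sup>+\<omega>. ennreal ((y ^ 2) powi Y (real N) \<omega>) * indicator (E N) \<omega> \<partial>M) +
        (\<integral>\<^sup>+\<omega>. ennreal ((y ^ 2) powi Y (real N) \<omega>) * indicator (space M - E N) \<omega> \<partial>M)"
      by (rule nn_integral_add) measurable
    also have "(\<integral>\<^sup>+\<omega>. ennreal ((y ^ 2) powi Y (real N) \<omega>) * indicator (E N) \<omega> \<partial>M) = ennreal ((y ^ 2) ^ j) * emeasure M (E N)"
      unfolding E_def by (rule optional_stopping_passage[OF y0(1) mart w(1) w(2) w(3)])
    finally have one: "1 = ennreal ((y ^ 2) ^ j) * emeasure M (E N) +
        (\<integral>\<^sup>+\<omega>. ennreal ((y ^ 2) powi Y (real N) \<omega>) * indicator (space M - E N) \<omega> \<partial>M)" .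
    then show "ennreal ((y ^ 2) ^ j) * emeasure M (E N) \<le> 1"
      by (metis le_iff_add)
    have "(\<integral>\<^sup>+\<omega>. ennreal ((y ^ 2) powi Y (real N) \<omega>) * indicator (space M - E N) \<omega> \<partial>M) \<le>
        (\<integral>\<^sup>+\<omega>. ennreal (y ^ j) * ennreal (y powi Y (real N) \<omega>) \<partial>M)"
    proof (rule nn_integral_mono)
      fix \<omega>
      have "(y ^ 2) powi Y (real N) \<omega> \<le> y ^ j * y powi Y (real N) \<omega>" if "\<omega> \<in> space M - E N"
      proof -
        have "(y ^ 2) powi Y (real N) \<omega> = y powi Y (real N) \<omega> * y powi Y (real N) \<omega>"
          by (simp add: power2_eq_square power_int_mult_distrib)
        also have "\<dots> \<le> y powi int j * y powi Y (real N) \<omega>"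
          using y le[OF that] by (intro mult_right_mono power_int_increasing) auto
        finally show ?thesis by simp
      qed
      then show "ennreal ((y ^ 2) powi Y (real N) \<omega>) * indicator (space M - E N) \<omega> \<le> ennreal (y ^ j) * ennreal (y powi Y (real N) \<omega>)"
        using y0 by (auto simp: ennreal_mult[symmetric] split: split_indicator)
    qed
    also have "\<dots> = ennreal (y ^ j) * (\<integral>\<^sup>+\<omega>. ennreal (y powi Y (real N) \<omega>) \<partial>M)"
      by (rule nn_integral_cmult) measurable
    finally have "1 \<le> ennreal ((y ^ 2) ^ j) * emeasure M (E N) + ennreal (y ^ j) * (\<integral>\<^sup>+\<omega>. ennreal (y powi Y (real N) \<omega>) \<partial>M)"
      by (subst one) (rule add_left_mono)
    then show "1 - ennreal (y ^ j) * (\<integral>\<^sup>+\<omega>. ennreal (y powi Y (real N) \<omega>) \<partial>M) \<le> ennreal ((y ^ 2) ^ j) * emeasure M (E N)"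
      by (simp add: ennreal_minus_le_iff add.commute)
  qed
  have "(\<lambda>N. 1 - ennreal (y ^ j) * (\<integral>\<^sup>+\<omega>. ennreal (y powi Y (real N) \<omega>) \<partial>M)) \<longlonglongrightarrow> 1 - ennreal (y ^ j) * 0"
    by (rule tendsto_diff_ennreal[OF tendsto_const ennreal_tendsto_cmult[OF _ decay]]) simp_all
  then have lim0: "(\<lambda>N. 1 - ennreal (y ^ j) * (\<integral>\<^sup>+\<omega>. ennreal (y powi Y (real N) \<omega>) \<partial>M)) \<longlonglongrightarrow> 1"
    by simp
  have "\<forall>\<^sub>F N in sequentially. 1 - ennreal (y ^ j) * (\<integral>\<^sup>+\<omega>. ennreal (y powi Y (real N) \<omega>) \<partial>M) \<le> ennreal ((y ^ 2) ^ j) * emeasure M (E N)"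
    using eventually_gt_at_top[of 0] by eventually_elim (rule lower)
  moreover have "\<forall>\<^sub>F N in sequentially. ennreal ((y ^ 2) ^ j) * emeasure M (E N) \<le> 1"
    using eventually_gt_at_top[of 0] by eventually_elim (rule upper)
  ultimately have lim1: "(\<lambda>N. ennreal ((y ^ 2) ^ j) * emeasure M (E N)) \<longlonglongrightarrow> 1"
    by (rule tendsto_sandwich[OF _ _ lim0 tendsto_const])
  have "(\<lambda>N. prob (E N)) \<longlonglongrightarrow> prob {\<omega> \<in> space M. reaches j \<omega>}"
  proof (rule prob_eventually_eq[OF E])
    fix \<omega>
    obtain n :: nat where n: "passage j \<omega> < real n" using reals_Archimedean2 by blast
    show "\<forall>\<^sub>F N in sequentially. (\<omega> \<in> E N) = (\<omega> \<in> {\<omega> \<in> space M. reaches j \<omega>})"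
      using eventually_ge_at_top[of n] by eventually_elim (use n in \<open>auto simp: E_def\<close>)
  qed auto
  then have "(\<lambda>N. ennreal ((y ^ 2) ^ j * prob (E N))) \<longlonglongrightarrow> ennreal ((y ^ 2) ^ j * prob {\<omega> \<in> space M. reaches j \<omega>})"
    by (intro tendsto_ennrealI tendsto_mult_left)
  then have "(\<lambda>N. ennreal ((y ^ 2) ^ j) * emeasure M (E N)) \<longlonglongrightarrow> ennreal ((y ^ 2) ^ j * prob {\<omega> \<in> space M. reaches j \<omega>})"
    using y0 by (simp add: emeasure_eq_measure ennreal_mult)
  from LIMSEQ_unique[OF this lim1] have "(y ^ 2) ^ j * prob {\<omega> \<in> space M. reaches j \<omega>} = 1"
    by (simp add: ennreal_eq_1)
  then show ?thesis
    using y0 by (simp add: field_simps)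
qed

end

section \<open>Integer combinations of Poisson counts\<close>

lemma fdd_prod_eq_prod:
  "fdd_prod p t k xs = (\<Prod>i<length xs. p ((t # map fst xs) ! Suc i - (t # map fst xs) ! i) ((k # map snd xs) ! Suc i - (k # map snd xs) ! i))"
proof (induction xs arbitrary: t k)
  case (Cons x xs)
  show ?case
    by (cases x) (simp add: Cons prod.lessThan_Suc_shift del: prod.lessThan_Suc)
qed simp

lemma locally_finite_right_gap:
  assumes "locally_finite S"
  shows "\<exists>e>0. S \<inter> {t<..<t + e} = {}"
proof -
  have "finite (S \<inter> {t..t + 1})"
    using assms by (simp add: locally_finite_def)
  from finite_set_avoid[OF this, of t] obtain d where d: "d > 0" "\<And>x. x \<in> S \<inter> {t..t + 1} \<Longrightarrow> x \<noteq> t \<Longrightarrow> d \<le> dist t x" by blast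
  have "S \<inter> {t<..<t + min d 1} = {}"
    using d(2) by (force simp: dist_real_def)
  then show ?thesis
    using d(1) by (intro exI[of _ "min d 1"]) auto
qed

lemma locally_finite_left_gap:
  assumes "locally_finite S"
  shows "\<exists>e>0. S \<inter> {t - e<..<t} = {}"
proof -
  obtain e where e: "e > 0" "uminus ` S \<inter> {- t<..<- t + e} = {}"
    using locally_finite_right_gap[OF locally_finite_uminus[OF assms]] by blast
  have "S \<inter> {t - e<..<t} = {}"
  proof (rule equals0I)
    fix x assume "x \<in> S \<inter> {t - e<..<t}"
    then have "- x \<in> uminus ` S \<inter> {- t<..<- t + e}" by auto
    with e(2) show False by blast
  qed
  then show ?thesis using e(1) by blast
qed

lemma poisson_pgf:
  assumes r: "0 < r" and z: "0 \<le> z"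
  shows "(\<integral>\<^sup>+k. ennreal (z ^ k) \<partial>measure_pmf (poisson_pmf r)) = ennreal (exp (r * (z - 1)))"
proof -
  have "(\<lambda>k. (r * z) ^ k / fact k * exp (- r)) sums (exp (r * z) * exp (- r))"
    using exp_converges[of "r * z"] by (intro sums_mult2) (simp add: scaleR_conv_of_real field_simps)
  moreover have "(r * z) ^ k / fact k * exp (- r) = pmf (poisson_pmf r) k * z ^ k" for k
    using r by (simp add: power_mult_distrib)
  ultimately have s: "(\<lambda>k. pmf (poisson_pmf r) k * z ^ k) sums exp (r * (z - 1))"
    by (simp add: exp_add[symmetric] algebra_simps)
  have "(\<integral>\<^sup>+k. ennreal (z ^ k) \<partial>measure_pmf (poisson_pmf r)) = (\<integral>\<^sup>+k. ennreal (pmf (poisson_pmf r) k * z ^ k) \<partial>count_space UNIV)"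
    by (simp add: nn_integral_measure_pmf ennreal_mult'[symmetric] del: pmf_poisson)
  also have "\<dots> = (\<Sum>k. ennreal (pmf (poisson_pmf r) k * z ^ k))"
    by (rule nn_integral_count_space_nat)
  also have "\<dots> = ennreal (exp (r * (z - 1)))"
    using z by (intro suminf_ennreal_eq s) (auto simp del: pmf_poisson)
  finally show ?thesis .
qed

context poisson_matching
begin

definition pcount :: "bool \<Rightarrow> bool \<Rightarrow> real \<Rightarrow> 'a \<Rightarrow> nat" where
  "pcount s c t \<omega> = card (half s c \<omega> \<inter> {0<..t})"

text \<open>The coefficient \<open>a\<close> belongs to red, \<open>b\<close> to blue. The pair
  (1,-1) gives the excess, (-1,1) its negative, (1,0) and (0,1) the single counts, so one proof
  covers all of them.\<close>

definition comb :: "int \<Rightarrow> int \<Rightarrow> bool \<Rightarrow> real \<Rightarrow> 'a \<Rightarrow> int" where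
  "comb a b s t \<omega> = a * int (pcount s False t \<omega>) + b * int (pcount s True t \<omega>)"

lemma locally_finite_half: "\<omega> \<in> space M \<Longrightarrow> locally_finite (half s c \<omega>)"
  by (simp add: half_def locally_finite_colour locally_finite_uminus)

lemma measurable_pcount [measurable]: "pcount s c t \<in> measurable M (count_space UNIV)"
  unfolding pcount_def[abs_def] by (rule measurable_half)

lemma measurable_comb [measurable]: "comb a b s t \<in> measurable M (count_space UNIV)"
  unfolding comb_def[abs_def] by measurable

lemma pcount_add:
  assumes "\<omega> \<in> space M" "0 \<le> u" "u \<le> v"
  shows "pcount s c v \<omega> = pcount s c u \<omega> + card (half s c \<omega> \<inter> {u<..v})"
proof -
  have "half s c \<omega> \<inter> {0<..v} = half s c \<omega> \<inter> {0<..u} \<union> half s c \<omega> \<inter> {u<..v}"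
    using assms by auto
  then show ?thesis
    unfolding pcount_def using finite_locally_finite_Ioo(2)[OF locally_finite_half[OF assms(1)]]
    by (simp add: card_Un_disjoint Int_Un_distrib disjoint_iff)
qed

lemma pcount_mono: "\<omega> \<in> space M \<Longrightarrow> 0 \<le> u \<Longrightarrow> u \<le> v \<Longrightarrow> pcount s c u \<omega> \<le> pcount s c v \<omega>"
  using pcount_add[of \<omega> u v s c] by simp

lemma measurable_pair_half:
  "(\<lambda>\<omega>. (card (half s False \<omega> \<inter> {u<..v}), card (half s True \<omega> \<inter> {u<..v}))) \<in> measurable M (count_space UNIV)"
    (is "?f \<in> _")
proof -
  have "?f -` {p} \<inter> space M \<in> events" for p
  proof -
    have "?f -` {p} \<inter> space M =
      ((\<lambda>\<omega>. card (half s False \<omega> \<inter> {u<..v})) -` {fst p} \<inter> space M) \<inter> ((\<lambda>\<omega>. card (half s True \<omega> \<inter> {u<..v})) -` {snd p} \<inter> space M)"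
      by (cases p) auto
    also have "\<dots> \<in> events"
      by (intro sets.Int measurable_sets[OF measurable_half]) auto
    finally show ?thesis .
  qed
  then show ?thesis
    by (simp add: measurable_count_space_eq2_countable)
qed

lemma distr_pair_half:
  assumes "0 \<le> u" "u < v"
  shows "distr M (count_space UNIV) (\<lambda>\<omega>. (card (half s False \<omega> \<inter> {u<..v}), card (half s True \<omega> \<inter> {u<..v}))) =
    measure_pmf (pair_pmf (poisson_pmf (m * (v - u))) (poisson_pmf (l * (v - u))))"
proof (rule measure_eqI_countable[where A=UNIV])
  fix p :: "nat \<times> nat"
  obtain j k where p: "p = (j, k)" by (cases p)
  define x where "x i = (if i = 0 then u else v)" for i :: nat
  have ind: "indep_vars (\<lambda>_. count_space UNIV) (\<lambda>(s, c, i) \<omega>. card (half s c \<omega> \<inter> {x i<..x (Suc i)})) (UNIV \<times> UNIV \<times> {..<1})"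
    using assms by (intro indep_half) (auto simp: x_def)
  let ?J = "{(s, False, 0), (s, True, 0)} :: (bool \<times> bool \<times> nat) set"
  let ?A = "\<lambda>j'. if fst (snd j') then {k} else {j}"
  have "prob (\<Inter>i\<in>?J. (case i of (s, c, i) \<Rightarrow> \<lambda>\<omega>. card (half s c \<omega> \<inter> {x i<..x (Suc i)})) -` ?A i \<inter> space M) =
    (\<Prod>i\<in>?J. prob ((case i of (s, c, i) \<Rightarrow> \<lambda>\<omega>. card (half s c \<omega> \<inter> {x i<..x (Suc i)})) -` ?A i \<inter> space M))"
    by (rule indep_varsD[OF ind]) auto
  then have "prob ({\<omega> \<in> space M. card (half s False \<omega> \<inter> {u<..v}) = j} \<inter> {\<omega> \<in> space M. card (half s True \<omega> \<inter> {u<..v}) = k}) =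
    prob {\<omega> \<in> space M. card (half s False \<omega> \<inter> {u<..v}) = j} * prob {\<omega> \<in> space M. card (half s True \<omega> \<inter> {u<..v}) = k}"
    by (simp add: x_def vimage_def Int_def conj_commute conj_left_commute)
  moreover have "{\<omega> \<in> space M. (card (half s False \<omega> \<inter> {u<..v}), card (half s True \<omega> \<inter> {u<..v})) = p} =
    {\<omega> \<in> space M. card (half s False \<omega> \<inter> {u<..v}) = j} \<inter> {\<omega> \<in> space M. card (half s True \<omega> \<inter> {u<..v}) = k}"
    by (auto simp: p)
  ultimately have "prob {\<omega> \<in> space M. (card (half s False \<omega> \<inter> {u<..v}), card (half s True \<omega> \<inter> {u<..v})) = p} =
    pmf (pair_pmf (poisson_pmf (m * (v - u))) (poisson_pmf (l * (v - u)))) p"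
    by (simp only: prob_half[OF assms(2)] p pmf_pair rate_def if_True if_False)
  then show "emeasure (distr M (count_space UNIV) (\<lambda>\<omega>. (card (half s False \<omega> \<inter> {u<..v}), card (half s True \<omega> \<inter> {u<..v})))) {p} =
    emeasure (measure_pmf (pair_pmf (poisson_pmf (m * (v - u))) (poisson_pmf (l * (v - u))))) {p}"
    by (subst emeasure_distr[OF measurable_pair_half])
      (simp_all add: emeasure_pmf_single emeasure_eq_measure vimage_def Collect_conj_eq Int_commute)
qed auto

lemma prob_comb_increment:
  assumes "0 \<le> u" "u < v"
  shows "prob {\<omega> \<in> space M. a * int (card (half s False \<omega> \<inter> {u<..v})) + b * int (card (half s True \<omega> \<inter> {u<..v})) = k} =
    prob {\<omega> \<in> space M. comb a b s (v - u) \<omega> = k}"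
proof -
  let ?S = "{(i, j). a * int i + b * int j = k}"
  have *: "prob {\<omega> \<in> space M. a * int (card (half s False \<omega> \<inter> {u<..v})) + b * int (card (half s True \<omega> \<inter> {u<..v})) = k} =
    measure_pmf.prob (pair_pmf (poisson_pmf (m * (v - u))) (poisson_pmf (l * (v - u)))) ?S" if "0 \<le> u" "u < v" for u v
    unfolding distr_pair_half[OF that, of s, symmetric]
    by (subst measure_distr[OF measurable_pair_half]) (auto intro!: arg_cong[where f=prob])
  show ?thesis
    using *[OF assms] *[of 0 "v - u"] assms by (simp add: comb_def pcount_def)
qed

text \<open>Prescribing values at increasing times, with value 0 at time 0, is prescribing the
  increments over the cells of the grid. These are functions of disjoint groups of independent
  counts.\<close>

lemma comb_fdd:
  assumes xs: "sorted_wrt (<) (0 # map fst xs)"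
  shows "prob {\<omega> \<in> space M. \<forall>x\<in>set xs. comb a b s (fst x) \<omega> = snd x} =
    fdd_prod (\<lambda>d k. prob {\<omega> \<in> space M. comb a b s d \<omega> = k}) 0 0 xs"
proof (cases "xs = []")
  case False
  define n where "n = length xs"
  have n: "0 < n" using False by (simp add: n_def)
  define x where "x i = (0 # map fst xs) ! i" for i
  define y where "y i = (0 # map snd xs) ! i" for i
  have x0: "0 \<le> x 0" by (simp add: x_def)
  have x_mono: "x i < x (Suc i)" if "i < n" for i
    unfolding x_def using sorted_wrt_nth_less[OF xs, of i "Suc i"] that by (simp add: n_def)
  have x_nonneg: "0 \<le> x i" if "i \<le> n" for i
    using that
  proof (induction i)
    case (Suc i)
    then show ?case using x_mono[of i] by simp
  qed (simp add: x0)
  define W where "W i \<omega> = a * int (card (half s False \<omega> \<inter> {x i<..x (Suc i)})) + b * int (card (half s True \<omega> \<inter> {x i<..x (Suc i)}))" for i \<omega>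
  let ?K = "\<lambda>i. {(s, False, i), (s, True, i)}"
  have "indep_vars (\<lambda>i. PiM (?K i) (\<lambda>_. count_space UNIV))
     (\<lambda>i \<omega>. restrict (\<lambda>j. (case j of (s, c, i) \<Rightarrow> \<lambda>\<omega>. card (half s c \<omega> \<inter> {x i<..x (Suc i)})) \<omega>) (?K i)) {..<n}"
    by (rule indep_vars_restrict[OF indep_half[OF x0 x_mono n]]) (auto simp: disjoint_family_on_def)
  then have "indep_vars (\<lambda>_. count_space UNIV)
     (\<lambda>i \<omega>. (\<lambda>f. a * int (f (s, False, i)) + b * int (f (s, True, i)))
       (restrict (\<lambda>j. (case j of (s, c, i) \<Rightarrow> \<lambda>\<omega>. card (half s c \<omega> \<inter> {x i<..x (Suc i)})) \<omega>) (?K i))) {..<n}"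
  proof (rule indep_vars_compose2)
    fix i
    have [measurable]: "(\<lambda>f. f j) \<in> measurable (PiM (?K i) (\<lambda>_. count_space UNIV)) (count_space (UNIV :: nat set))" if "j \<in> ?K i" for j
      using that by (rule measurable_component_singleton)
    show "(\<lambda>f. a * int (f (s, False, i)) + b * int (f (s, True, i))) \<in> measurable (PiM (?K i) (\<lambda>_. count_space UNIV)) (count_space UNIV)"
      by measurable
  qed
  then have indW: "indep_vars (\<lambda>_. count_space UNIV) W {..<n}"
    by (simp add: W_def[abs_def])
  have probW: "prob {\<omega> \<in> space M. W i \<omega> = k} = prob {\<omega> \<in> space M. comb a b s (x (Suc i) - x i) \<omega> = k}" if "i < n" for i k
    unfolding W_def using that x_nonneg[of i] x_mono[of i] by (intro prob_comb_increment) auto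
  have W_eq: "comb a b s (x (Suc i)) \<omega> - comb a b s (x i) \<omega> = W i \<omega>" if "\<omega> \<in> space M" "i < n" for i \<omega>
    using pcount_add[OF that(1) x_nonneg[of i], of "x (Suc i)" s] x_mono[of i] that
    by (simp add: comb_def W_def algebra_simps)
  have ev: "{\<omega> \<in> space M. \<forall>x\<in>set xs. comb a b s (fst x) \<omega> = snd x} = {\<omega> \<in> space M. \<forall>i<n. W i \<omega> = y (Suc i) - y i}"
  proof (intro set_eqI iffI)
    fix \<omega> assume "\<omega> \<in> {\<omega> \<in> space M. \<forall>x\<in>set xs. comb a b s (fst x) \<omega> = snd x}"
    then have w: "\<omega> \<in> space M" "\<And>i. i < n \<Longrightarrow> comb a b s (fst (xs ! i)) \<omega> = snd (xs ! i)"
      by (auto simp: n_def)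
    have c: "comb a b s (x i) \<omega> = y i" if "i \<le> n" for i
      using that w(2) by (cases i) (auto simp: x_def y_def n_def comb_def pcount_def)
    have "W i \<omega> = y (Suc i) - y i" if "i < n" for i
      using W_eq[OF w(1) that] c[of i] c[of "Suc i"] that by simp
    then show "\<omega> \<in> {\<omega> \<in> space M. \<forall>i<n. W i \<omega> = y (Suc i) - y i}"
      using w by simp
  next
    fix \<omega> assume "\<omega> \<in> {\<omega> \<in> space M. \<forall>i<n. W i \<omega> = y (Suc i) - y i}"
    then have w: "\<omega> \<in> space M" "\<And>i. i < n \<Longrightarrow> W i \<omega> = y (Suc i) - y i"
      by auto
    have c: "comb a b s (x i) \<omega> = y i" if "i \<le> n" for i
      using that
    proof (induction i)
      case (Suc i)
      then show ?case using W_eq[OF w(1), of i] w(2)[of i] by simp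
    qed (simp add: x_def y_def comb_def pcount_def)
    have "comb a b s (fst p) \<omega> = snd p" if p: "p \<in> set xs" for p
    proof -
      obtain i where "i < n" "p = xs ! i"
        using p by (auto simp: in_set_conv_nth n_def)
      then show ?thesis
        using c[of "Suc i"] by (simp add: x_def y_def n_def)
    qed
    then show "\<omega> \<in> {\<omega> \<in> space M. \<forall>x\<in>set xs. comb a b s (fst x) \<omega> = snd x}"
      using w by auto
  qed
  have "{..<n} \<noteq> {}" using n by (simp add: lessThan_empty_iff)
  moreover from this have "{\<omega> \<in> space M. \<forall>i<n. W i \<omega> = y (Suc i) - y i} = (\<Inter>i\<in>{..<n}. W i -` {y (Suc i) - y i} \<inter> space M)"
    by auto
  ultimately have "prob {\<omega> \<in> space M. \<forall>x\<in>set xs. comb a b s (fst x) \<omega> = snd x} = (\<Prod>i<n. prob (W i -` {y (Suc i) - y i} \<inter> space M))"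
    unfolding ev by (simp only:) (rule indep_varsD_finite[OF indW], auto)
  also have "\<dots> = (\<Prod>i<n. prob {\<omega> \<in> space M. comb a b s (x (Suc i) - x i) \<omega> = y (Suc i) - y i})"
    using probW by (intro prod.cong refl) (auto simp: vimage_def Int_def conj_commute)
  finally show ?thesis
    by (simp add: fdd_prod_eq_prod x_def y_def n_def)
qed (simp add: prob_space)

text \<open>The jump at a time is \<open>a\<close>, \<open>b\<close> or \<open>a + b\<close>
  according to the colours present there. The three conditions bound it by one on every path,
  including those where red and blue coincide.\<close>

lemma stationary_process_comb:
  assumes "a \<le> 1" "b \<le> 1" "a + b \<le> 1"
  shows "stationary_process M (comb a b s)"
proof
  fix t \<omega>
  show "comb a b s t \<in> measurable M (count_space UNIV)" by measurable
  show "comb a b s t \<omega> = 0" if "t \<le> 0"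
    using that by (simp add: comb_def pcount_def)
  show "\<exists>e>0. \<forall>s'. t \<le> s' \<longrightarrow> s' < t + e \<longrightarrow> comb a b s s' \<omega> = comb a b s t \<omega>" if w: "\<omega> \<in> space M" and t: "0 \<le> t"
  proof -
    have "\<exists>e>0. \<forall>s'. t \<le> s' \<longrightarrow> s' < t + e \<longrightarrow> pcount s c s' \<omega> = pcount s c t \<omega>" for c
    proof -
      obtain e where e: "e > 0" "half s c \<omega> \<inter> {t<..<t + e} = {}"
        using locally_finite_right_gap[OF locally_finite_half[OF w]] by blast
      have "pcount s c s' \<omega> = pcount s c t \<omega>" if "t \<le> s'" "s' < t + e" for s'
      proof -
        have "half s c \<omega> \<inter> {t<..s'} = {}" using e(2) that by auto
        then show ?thesis using pcount_add[OF w t that(1)] by simp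
      qed
      then show ?thesis using e(1) by blast
    qed
    from this[of False] this[of True] obtain e1 e2 where
      e: "e1 > 0" "\<And>s'. t \<le> s' \<Longrightarrow> s' < t + e1 \<Longrightarrow> pcount s False s' \<omega> = pcount s False t \<omega>"
      "e2 > 0" "\<And>s'. t \<le> s' \<Longrightarrow> s' < t + e2 \<Longrightarrow> pcount s True s' \<omega> = pcount s True t \<omega>" by blast
    show ?thesis
    proof (intro exI[of _ "min e1 e2"] conjI allI impI)
      fix s' assume "t \<le> s'" "s' < t + min e1 e2"
      then show "comb a b s s' \<omega> = comb a b s t \<omega>"
        using e(2)[of s'] e(4)[of s'] by (simp add: comb_def)
    qed (use e in simp)
  qed
  show "\<exists>e>0. \<forall>s'. t - e < s' \<longrightarrow> s' < t \<longrightarrow> comb a b s t \<omega> \<le> comb a b s s' \<omega> + 1" if w: "\<omega> \<in> space M" and t: "0 < t"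
  proof -
    have "\<exists>e>0. \<forall>s'. t - e < s' \<longrightarrow> s' < t \<longrightarrow> pcount s c t \<omega> = pcount s c s' \<omega> + (if t \<in> half s c \<omega> then 1 else 0)" for c
    proof -
      obtain e where e: "e > 0" "half s c \<omega> \<inter> {t - e<..<t} = {}"
        using locally_finite_left_gap[OF locally_finite_half[OF w]] by blast
      have "pcount s c t \<omega> = pcount s c s' \<omega> + (if t \<in> half s c \<omega> then 1 else 0)" if "t - min e t < s'" "s' < t" for s'
      proof -
        have "half s c \<omega> \<inter> {s'<..t} = (if t \<in> half s c \<omega> then {t} else {})"
          using e(2) that by (auto simp: disjoint_iff order_le_less)
        then show ?thesis using pcount_add[OF w, of s' t s c] that t by (auto simp: min_def split: if_splits)
      qed
      then show ?thesis using e(1) t by (intro exI[of _ "min e t"]) auto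
    qed
    from this[of False] this[of True] obtain e1 e2 where
      e: "e1 > 0" "\<And>s'. t - e1 < s' \<Longrightarrow> s' < t \<Longrightarrow> pcount s False t \<omega> = pcount s False s' \<omega> + (if t \<in> half s False \<omega> then 1 else 0)"
      "e2 > 0" "\<And>s'. t - e2 < s' \<Longrightarrow> s' < t \<Longrightarrow> pcount s True t \<omega> = pcount s True s' \<omega> + (if t \<in> half s True \<omega> then 1 else 0)" by blast
    show ?thesis
    proof (intro exI[of _ "min e1 e2"] conjI allI impI)
      fix s' assume "t - min e1 e2 < s'" "s' < t"
      then show "comb a b s t \<omega> \<le> comb a b s s' \<omega> + 1"
        using e(2)[of s'] e(4)[of s'] assms by (simp add: comb_def algebra_simps)
    qed (use e in simp)
  qed
  show "prob {\<omega> \<in> space M. \<forall>x\<in>set xs. comb a b s (fst x) \<omega> = snd x} =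
    fdd_prod (\<lambda>d k. prob {\<omega> \<in> space M. comb a b s d \<omega> = k}) 0 0 xs" if "sorted_wrt (<) (0 # map fst xs)" for xs
    using that by (rule comb_fdd)
qed

text \<open>The two counts are independent, so the mean is the product of two Poisson generating
  functions.\<close>

lemma nn_integral_comb:
  assumes z: "0 < z" and t: "0 < t"
  shows "(\<integral>\<^sup>+\<omega>. ennreal (z powi comb a b s t \<omega>) \<partial>M) = ennreal (exp (t * (m * (z powi a - 1) + l * (z powi b - 1))))"
proof -
  let ?P = "pair_pmf (poisson_pmf (m * t)) (poisson_pmf (l * t))"
  have "(\<integral>\<^sup>+\<omega>. ennreal (z powi comb a b s t \<omega>) \<partial>M) =
    (\<integral>\<^sup>+p. ennreal (z powi (a * int (fst p) + b * int (snd p))) \<partial>distr M (count_space UNIV) (\<lambda>\<omega>. (card (half s False \<omega> \<inter> {0<..t}), card (half s True \<omega> \<inter> {0<..t}))))"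
    by (subst nn_integral_distr[OF measurable_pair_half]) (simp_all add: comb_def pcount_def)
  also have "\<dots> = (\<integral>\<^sup>+p. ennreal (z powi (a * int (fst p) + b * int (snd p))) \<partial>measure_pmf ?P)"
    using distr_pair_half[of 0 t s] t by simp
  also have "\<dots> = (\<integral>\<^sup>+i. \<integral>\<^sup>+j. ennreal ((z powi a) ^ i) * ennreal ((z powi b) ^ j) \<partial>measure_pmf (poisson_pmf (l * t)) \<partial>measure_pmf (poisson_pmf (m * t)))"
    unfolding nn_integral_pair_pmf' using z
    by (intro nn_integral_cong) (simp add: power_int_add power_int_mult ennreal_mult'[symmetric])
  also have "\<dots> = ennreal (exp (l * t * (z powi b - 1))) * ennreal (exp (m * t * (z powi a - 1)))"
    using z t l_pos m_pos
    by (simp add: nn_integral_cmult nn_integral_multc poisson_pgf) (simp add: mult.commute)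
  also have "\<dots> = ennreal (exp (t * (m * (z powi a - 1) + l * (z powi b - 1))))"
    by (simp add: ennreal_mult'[symmetric] exp_add[symmetric] algebra_simps)
  finally show ?thesis .
qed

lemma nn_integral_comb_decay:
  assumes z: "0 < z" and neg: "m * (z powi a - 1) + l * (z powi b - 1) < 0"
  shows "(\<lambda>N. \<integral>\<^sup>+\<omega>. ennreal (z powi comb a b s (real N) \<omega>) \<partial>M) \<longlonglongrightarrow> 0"
proof -
  let ?q = "exp (m * (z powi a - 1) + l * (z powi b - 1))"
  have "(\<lambda>N. ennreal (?q ^ N)) \<longlonglongrightarrow> ennreal 0"
    using neg by (intro tendsto_ennrealI LIMSEQ_power_zero) simp
  moreover have "\<forall>\<^sub>F N in sequentially. ennreal (?q ^ N) = (\<integral>\<^sup>+\<omega>. ennreal (z powi comb a b s (real N) \<omega>) \<partial>M)"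
    using eventually_gt_at_top[of 0]
    by eventually_elim (simp add: nn_integral_comb[OF z] exp_of_nat_mult)
  ultimately show ?thesis
    by (auto intro: Lim_transform_eventually)
qed

text \<open>A path that never reaches \<open>k\<close> keeps z^comb above \<open>z ^ k\<close> at
  all times since \<open>z < 1\<close>, whereas the mean of z^comb tends to 0 when its exponential
  rate is negative.\<close>

lemma transient_process_comb:
  assumes "a \<le> 1" "b \<le> 1" "a + b \<le> 1" and z: "0 < z" "z < 1"
    and neg: "m * (z powi a - 1) + l * (z powi b - 1) < 0"
  shows "transient_process M (comb a b s)"
proof -
  interpret P: stationary_process M "comb a b s"
    using assms(1-3) by (rule stationary_process_comb)
  show ?thesis
  proof
    fix k
    let ?N = "{\<omega> \<in> space M. \<not> P.reaches k \<omega>}"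
    have "?N = space M - {\<omega> \<in> space M. P.reaches k \<omega>}" by auto
    then have N: "?N \<in> events" using P.events_reaches by simp
    have "ennreal (z ^ k) * emeasure M ?N \<le> (\<integral>\<^sup>+\<omega>. ennreal (z powi comb a b s (real n) \<omega>) \<partial>M)" for n
    proof -
      have "ennreal (z ^ k) * emeasure M ?N = (\<integral>\<^sup>+\<omega>. ennreal (z ^ k) * indicator ?N \<omega> \<partial>M)"
        using N by (simp add: nn_integral_cmult_indicator)
      also have "\<dots> \<le> (\<integral>\<^sup>+\<omega>. ennreal (z powi comb a b s (real n) \<omega>) \<partial>M)"
      proof (rule nn_integral_mono)
        fix \<omega>
        have "z ^ k \<le> z powi comb a b s (real n) \<omega>" if "\<omega> \<in> ?N"
        proof -
          have "comb a b s (real n) \<omega> \<le> int k"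
            using that unfolding P.reaches_def by (auto simp: not_le dest: spec[of _ "real n"])
          then have "z powi int k \<le> z powi comb a b s (real n) \<omega>"
            using z by (intro power_int_decreasing) auto
          then show ?thesis by simp
        qed
        then show "ennreal (z ^ k) * indicator ?N \<omega> \<le> ennreal (z powi comb a b s (real n) \<omega>)"
          by (auto split: split_indicator intro: ennreal_leI)
      qed
      finally show ?thesis .
    qed
    then have "ennreal (z ^ k) * emeasure M ?N \<le> 0"
      using nn_integral_comb_decay[OF z(1) neg, of s] by (intro LIMSEQ_le_const) auto
    then have "emeasure M ?N = 0"
      using zero_less_power[OF z(1), of k] by (simp add: ennreal_eq_0_iff not_le[symmetric])
    then show "AE \<omega> in M. P.reaches k \<omega>"
      using N by (intro AE_I[of _ _ ?N]) auto
  qed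
qed

end

section \<open>Independence of the four processes\<close>

text \<open>Independence of whole blocks combines with independence inside each block: the events of
  one block are intersected into a single event of its \<sigma>-algebra, and the two product
  formulas are nested.\<close>

lemma (in prob_space) indep_vars_blocks:
  fixes F :: "'c :: finite \<Rightarrow> 'a measure" and X :: "'c \<Rightarrow> 'i \<Rightarrow> 'a \<Rightarrow> 'b"
  assumes ind: "indep_sets (\<lambda>c. sets (F c)) UNIV" and sp: "\<And>c. space (F c) = space M"
    and X: "\<And>c i. i \<in> I \<Longrightarrow> X c i \<in> measurable (F c) (N i)"
    and indX: "\<And>c. indep_vars N (X c) I"
  shows "indep_vars (\<lambda>j. N (snd j)) (\<lambda>j. X (fst j) (snd j)) (UNIV \<times> I)"
  unfolding indep_vars_def2
proof (intro conjI ballI indep_setsI)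
  fix j :: "'c \<times> 'i" assume "j \<in> UNIV \<times> I"
  then show "random_variable (N (snd j)) (X (fst j) (snd j))"
    using indX by (auto simp: indep_vars_def2)
  then show "{X (fst j) (snd j) -` A \<inter> space M |A. A \<in> sets (N (snd j))} \<subseteq> events"
    by auto
next
  fix A and J :: "('c \<times> 'i) set" assume J: "J \<noteq> {}" "J \<subseteq> UNIV \<times> I" "finite J"
    and A: "\<forall>j\<in>J. A j \<in> {X (fst j) (snd j) -` A \<inter> space M |A. A \<in> sets (N (snd j))}"
  define Jc where "Jc c = {i. (c, i) \<in> J}" for c
  have Jc: "finite (Jc c)" "Jc c \<subseteq> I" for c
  proof -
    have "Jc c = snd ` (J \<inter> {c} \<times> UNIV)" by (force simp: Jc_def)
    then show "finite (Jc c)" using J by simp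
    show "Jc c \<subseteq> I" using J by (auto simp: Jc_def)
  qed
  have J_eq: "J = (SIGMA c:UNIV. Jc c)" by (auto simp: Jc_def)
  define A' where "A' c = {\<omega> \<in> space M. \<forall>i\<in>Jc c. \<omega> \<in> A (c, i)}" for c
  have A_sub: "A j \<subseteq> space M" if "j \<in> J" for j using A that by auto
  have AF: "A (c, i) \<in> sets (F c)" if i: "i \<in> Jc c" for c i
  proof -
    obtain B where "A (c, i) = X c i -` B \<inter> space M" "B \<in> sets (N i)"
      using A i by (force simp: Jc_def)
    then show ?thesis
      using measurable_sets[OF X[of i c], of B] Jc(2)[of c] i sp by auto
  qed
  have A'F: "A' c \<in> sets (F c)" for c
  proof (cases "Jc c = {}")
    case True
    then show ?thesis using sets.top[of "F c"] by (simp add: A'_def sp)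
  next
    case False
    then have "A' c = (\<Inter>i\<in>Jc c. A (c, i))"
      using A_sub unfolding A'_def by (auto simp: Jc_def)
    also have "\<dots> \<in> sets (F c)"
      using AF Jc False by (intro sets.finite_INT) auto
    finally show ?thesis .
  qed
  have A'p: "prob (A' c) = (\<Prod>i\<in>Jc c. prob (A (c, i)))" for c
  proof (cases "Jc c = {}")
    case True
    then show ?thesis by (simp add: A'_def prob_space)
  next
    case False
    then have "A' c = (\<Inter>i\<in>Jc c. A (c, i))"
      using A_sub unfolding A'_def by (auto simp: Jc_def)
    also have "prob \<dots> = (\<Prod>i\<in>Jc c. prob (A (c, i)))"
    proof (rule indep_setsD)
      show "indep_sets (\<lambda>i. {X c i -` A \<inter> space M |A. A \<in> sets (N i)}) I"
        using indX[of c] by (simp add: indep_vars_def2)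
      show "\<forall>i\<in>Jc c. A (c, i) \<in> {X c i -` A \<inter> space M |A. A \<in> sets (N i)}"
        using A by (force simp: Jc_def)
    qed (use Jc False in auto)
    finally show ?thesis .
  qed
  have "(\<Inter>j\<in>J. A j) = (\<Inter>c\<in>UNIV. A' c)"
    using A_sub J(1) unfolding A'_def by (auto simp: Jc_def)
  also have "prob \<dots> = (\<Prod>c\<in>UNIV. prob (A' c))"
    by (rule indep_setsD[OF ind]) (use A'F in auto)
  also have "\<dots> = (\<Prod>c\<in>UNIV. \<Prod>i\<in>Jc c. prob (A (c, i)))"
    by (simp add: A'p)
  also have "\<dots> = (\<Prod>j\<in>J. prob (A j))"
    unfolding J_eq using Jc by (subst prod.Sigma) (auto simp: case_prod_unfold)
  finally show "prob (\<Inter>j\<in>J. A j) = (\<Prod>j\<in>J. prob (A j))" .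
qed

lemma (in stationary_process) past_subset:
  assumes "\<And>t. Y t \<in> measurable N (count_space UNIV)" "space N = space M"
  shows "sets (past I) \<subseteq> sets N"
  unfolding sets_past assms(2)[symmetric]
  by (rule sets.sigma_sets_subset) (use measurable_sets[OF assms(1)] in auto)

lemma (in stationary_process) measurable_past_subset:
  assumes "\<And>t. Y t \<in> measurable N (count_space UNIV)" "space N = space M" "f \<in> measurable (past I) L"
  shows "f \<in> measurable N L"
  using past_subset[OF assms(1,2), of I] assms(2,3) by (auto simp: measurable_def)

context poisson_matching
begin

text \<open>The \<sigma>-algebra of the half processes whose side and colour lie in
  \<open>J\<close>. Independence between sides or between colours is always obtained from disjoint
  sets \<open>J\<close>.\<close>

definition hist :: "(bool \<times> bool) set \<Rightarrow> 'a measure" where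
  "hist J = sigma (space M) {pcount s c t -` {k} \<inter> space M | s c t k. (s, c) \<in> J}"

lemma space_hist [simp]: "space (hist J) = space M"
  unfolding hist_def by (rule space_measure_of) auto

lemma sets_hist: "sets (hist J) = sigma_sets (space M) {pcount s c t -` {k} \<inter> space M | s c t k. (s, c) \<in> J}"
  unfolding hist_def by (rule sets_measure_of) auto

lemma measurable_pcount_hist: "(s, c) \<in> J \<Longrightarrow> pcount s c t \<in> measurable (hist J) (count_space UNIV)"
  by (auto simp: measurable_count_space_eq2_countable sets_hist intro!: sigma_sets.Basic)

lemma measurable_comb_hist:
  assumes "a \<noteq> 0 \<Longrightarrow> (s, False) \<in> J" "b \<noteq> 0 \<Longrightarrow> (s, True) \<in> J"
  shows "comb a b s t \<in> measurable (hist J) (count_space UNIV)"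
proof -
  have 1: "(\<lambda>\<omega>. a * int (pcount s False t \<omega>)) \<in> measurable (hist J) (count_space UNIV)"
    using measurable_compose[OF measurable_pcount_hist, of s False J "\<lambda>n. a * int n"] assms(1) by (cases "a = 0") auto
  have 2: "(\<lambda>\<omega>. b * int (pcount s True t \<omega>)) \<in> measurable (hist J) (count_space UNIV)"
    using measurable_compose[OF measurable_pcount_hist, of s True J "\<lambda>n. b * int n"] assms(2) by (cases "b = 0") auto
  note [measurable] = 1 2
  show ?thesis
    unfolding comb_def[abs_def] by measurable
qed

text \<open>Finitely many cylinders involve finitely many times. On a common grid every count is a
  sum of cell counts, which are independent over sides and colours; cylinders are closed under
  intersection, so independence passes to the generated \<sigma>-algebras.\<close>

lemma indep_hist:
  assumes disj: "disjoint_family_on J K"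
  shows "indep_sets (\<lambda>k. sets (hist (J k))) K"
proof -
  define cyl where "cyl p I f = {\<omega> \<in> space M. \<forall>t\<in>I. pcount (fst p) (snd p) t \<omega> \<in> f t}" for p :: "bool \<times> bool" and I :: "real set" and f :: "real \<Rightarrow> nat set"
  define E where "E p = {cyl p I f | I f. finite I}" for p
  have ind: "indep_sets E UNIV"
  proof (rule indep_setsI)
    fix p
    have "cyl p I f \<in> events" if "finite I" for I f
      unfolding cyl_def using that by measurable
    then show "E p \<subseteq> events" by (auto simp: E_def)
  next
    fix A and P :: "(bool \<times> bool) set" assume P: "P \<noteq> {}" "P \<subseteq> UNIV" "finite P" and "\<forall>p\<in>P. A p \<in> E p"
    then have "\<forall>p\<in>P. \<exists>I. \<exists>f. finite I \<and> A p = cyl p I f" by (auto simp: E_def)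
    from bchoice[OF this] obtain I where "\<forall>p\<in>P. \<exists>f. finite (I p) \<and> A p = cyl p (I p) f" by blast
    from bchoice[OF this] obtain f where If: "\<And>p. p \<in> P \<Longrightarrow> finite (I p)" "\<And>p. p \<in> P \<Longrightarrow> A p = cyl p (I p) (f p)" by blast
    \<comment> \<open>The 1 keeps the grid nonempty. Nonpositive times are dropped because all
      counts vanish there.\<close>
    define U where "U = insert 1 ((\<Union>p\<in>P. I p) \<inter> {0<..})"
    have U: "finite U" "U \<subseteq> {0<..}" using If P by (auto simp: U_def)
    define zs where "zs = sorted_list_of_set U"
    have zs: "set zs = U" "sorted_wrt (<) (0 # zs)"
      using U by (auto simp: zs_def)
    define n where "n = length zs"
    have n: "0 < n" using zs(1) by (auto simp: n_def U_def)
    define x where "x i = (0 # zs) ! i" for i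
    have x0: "x 0 = 0" by (simp add: x_def)
    have x_mono: "x i < x (Suc i)" if "i < n" for i
      unfolding x_def using sorted_wrt_nth_less[OF zs(2), of i "Suc i"] that by (simp add: n_def)
    have x_nonneg: "0 \<le> x i" if "i \<le> n" for i
      using that
    proof (induction i)
      case (Suc i)
      then show ?case using x_mono[of i] by simp
    qed (simp add: x0)
    have pc: "pcount s c (x k) \<omega> = (\<Sum>i<k. card (half s c \<omega> \<inter> {x i<..x (Suc i)}))" if "\<omega> \<in> space M" "k \<le> n" for s c k \<omega>
      using that(2)
    proof (induction k)
      case (Suc k)
      then show ?case
        using pcount_add[OF that(1) x_nonneg[of k], of "x (Suc k)" s c] x_mono[of k] by simp
    qed (simp add: x0 pcount_def)
    have "\<forall>t\<in>\<Union>p\<in>P. I p. \<exists>k\<le>n. \<forall>s c \<omega>. pcount s c t \<omega> = pcount s c (x k) \<omega>"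
    proof
      fix t assume t: "t \<in> (\<Union>p\<in>P. I p)"
      show "\<exists>k\<le>n. \<forall>s c \<omega>. pcount s c t \<omega> = pcount s c (x k) \<omega>"
      proof (cases "0 < t")
        case True
        then have "t \<in> set zs" using t zs by (auto simp: U_def)
        then obtain i where "i < n" "zs ! i = t" by (auto simp: in_set_conv_nth n_def)
        then have "Suc i \<le> n" "x (Suc i) = t" by (auto simp: x_def)
        then show ?thesis by blast
      next
        case False
        then show ?thesis by (intro exI[of _ 0]) (simp add: x0 pcount_def)
      qed
    qed
    from bchoice[OF this] obtain k where k: "\<And>t. t \<in> (\<Union>p\<in>P. I p) \<Longrightarrow> k t \<le> n"
      "\<And>t s c \<omega>. t \<in> (\<Union>p\<in>P. I p) \<Longrightarrow> pcount s c t \<omega> = pcount s c (x (k t)) \<omega>" by blast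
    define Kp where "Kp p = {(fst p, snd p, i) | i. i < n}" for p :: "bool \<times> bool"
    define V where "V p \<omega> = restrict (\<lambda>j. (case j of (s, c, i) \<Rightarrow> \<lambda>\<omega>. card (half s c \<omega> \<inter> {x i<..x (Suc i)})) \<omega>) (Kp p)" for p \<omega>
    have indV: "indep_vars (\<lambda>p. PiM (Kp p) (\<lambda>_. count_space UNIV)) V UNIV"
      unfolding V_def[abs_def]
    proof (rule indep_vars_restrict[OF indep_half])
      show "0 \<le> x 0" by (simp add: x0)
      show "x i < x (Suc i)" if "i < n" for i using that by (rule x_mono)
      show "0 < n" by (rule n)
    qed (auto simp: Kp_def disjoint_family_on_def)
    define C where "C p = {g \<in> space (PiM (Kp p) (\<lambda>_. count_space (UNIV :: nat set))). \<forall>t\<in>I p. (\<Sum>i<k t. g (fst p, snd p, i)) \<in> f p t}" for p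
    have C: "C p \<in> sets (PiM (Kp p) (\<lambda>_. count_space (UNIV :: nat set)))" if p: "p \<in> P" for p
    proof -
      have fin: "finite (I p)" using If p by blast
      have m: "(\<lambda>g. \<Sum>i<k t. g (fst p, snd p, i)) \<in> measurable (PiM (Kp p) (\<lambda>_. count_space (UNIV :: nat set))) (count_space UNIV)" if t: "t \<in> I p" for t
      proof (rule measurable_sum_nat)
        fix i assume "i \<in> {..<k t}"
        then have "(fst p, snd p, i) \<in> Kp p"
          using k(1)[of t] t p by (force simp: Kp_def)
        then show "(\<lambda>g. g (fst p, snd p, i)) \<in> measurable (PiM (Kp p) (\<lambda>_. count_space (UNIV :: nat set))) (count_space UNIV)"
          by (rule measurable_component_singleton)
      qed
      have "{g \<in> space (PiM (Kp p) (\<lambda>_. count_space (UNIV :: nat set))). (\<Sum>i<k t. g (fst p, snd p, i)) \<in> f p t} \<in> sets (PiM (Kp p) (\<lambda>_. count_space (UNIV :: nat set)))" if t: "t \<in> I p" for t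
        using measurable_sets[OF m[OF t], of "f p t"] by (simp add: vimage_def Int_def conj_commute)
      then show ?thesis
        unfolding C_def using fin by (intro sets.sets_Collect_finite_All)
    qed
    have A_eq: "A p = V p -` C p \<inter> space M" if p: "p \<in> P" for p
    proof -
      have "pcount (fst p) (snd p) t \<omega> = (\<Sum>i<k t. V p \<omega> (fst p, snd p, i))" if "t \<in> I p" "\<omega> \<in> space M" for t \<omega>
      proof -
        have t: "t \<in> (\<Union>p\<in>P. I p)" using that p by blast
        have "(\<Sum>i<k t. V p \<omega> (fst p, snd p, i)) = (\<Sum>i<k t. card (half (fst p) (snd p) \<omega> \<inter> {x i<..x (Suc i)}))"
          using k(1)[OF t] by (intro sum.cong) (auto simp: V_def Kp_def)
        then show ?thesis
          using pc[OF that(2) k(1)[OF t]] k(2)[OF t] by simp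
      qed
      moreover have "V p \<omega> \<in> space (PiM (Kp p) (\<lambda>_. count_space UNIV))" for \<omega>
        by (auto simp: V_def space_PiM)
      ultimately show ?thesis
        unfolding If(2)[OF p] cyl_def C_def by auto
    qed
    have "prob (\<Inter>p\<in>P. V p -` C p \<inter> space M) = (\<Prod>p\<in>P. prob (V p -` C p \<inter> space M))"
      by (rule indep_varsD[OF indV]) (use P C in auto)
    then show "prob (\<Inter>p\<in>P. A p) = (\<Prod>p\<in>P. prob (A p))"
      by (simp add: A_eq)
  qed
  have stable: "Int_stable (E p)" for p
  proof (rule Int_stableI)
    fix a b assume "a \<in> E p" "b \<in> E p"
    then obtain I f I' f' where *: "a = cyl p I f" "finite I" "b = cyl p I' f'" "finite I'" by (auto simp: E_def)
    have "a \<inter> b = cyl p (I \<union> I') (\<lambda>t. {n. (t \<in> I \<longrightarrow> n \<in> f t) \<and> (t \<in> I' \<longrightarrow> n \<in> f' t)})"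
      unfolding * cyl_def by auto
    then show "a \<inter> b \<in> E p"
      using * unfolding E_def by blast
  qed
  have "indep_sets (\<lambda>k. sigma_sets (space M) (\<Union>p\<in>J k. E p)) K"
    using stable disj by (intro indep_sets_collect_sigma indep_sets_mono_index[OF _ ind]) auto
  then show ?thesis
  proof (rule indep_sets_mono_sets)
    fix k
    show "sets (hist (J k)) \<subseteq> sigma_sets (space M) (\<Union>p\<in>J k. E p)"
      unfolding sets_hist
    proof (rule sigma_sets_mono', safe)
      fix s c t j assume "(s, c) \<in> J k"
      moreover have "pcount s c t -` {j} \<inter> space M = cyl (s, c) {t} (\<lambda>_. {j})"
        by (auto simp: cyl_def)
      ultimately show "pcount s c t -` {j} \<inter> space M \<in> (\<Union>p\<in>J k. E p)"
        unfolding E_def by blast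
    qed
  qed
qed

lemma indep_vars_hist:
  assumes "disjoint_family_on J K" "\<And>k. k \<in> K \<Longrightarrow> X k \<in> measurable (hist (J k)) (N k)"
  shows "indep_vars N X K"
  unfolding indep_vars_def2
proof
  note ind = indep_hist[OF assms(1)]
  have sub: "sets (hist (J k)) \<subseteq> events" if "k \<in> K" for k
    using ind that by (auto simp: indep_sets_def)
  show "\<forall>k\<in>K. random_variable (N k) (X k)"
  proof
    fix k assume "k \<in> K"
    from assms(2)[OF this] sub[OF this] show "random_variable (N k) (X k)"
      by (auto simp: measurable_def)
  qed
  show "indep_sets (\<lambda>k. {X k -` A \<inter> space M |A. A \<in> sets (N k)}) K"
    using ind
  proof (rule indep_sets_mono_sets)
    fix k assume "k \<in> K"
    from measurable_sets[OF assms(2)[OF this]]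
    show "{X k -` A \<inter> space M |A. A \<in> sets (N k)} \<subseteq> sets (hist (J k))" by auto
  qed
qed

end

section \<open>Measurability of the busy cycle\<close>

lemma measurable_arrival_time [measurable]:
  "(\<lambda>\<omega>. arrival_time \<omega> k) \<in> borel_measurable (PiM UNIV (\<lambda>_. borel \<Otimes>\<^sub>M borel))"
  unfolding arrival_time_def by measurable

lemma finite_arrivals_iff:
  "finite {k. 1 \<le> k \<and> arrival_time \<omega> k \<le> t} \<longleftrightarrow> (\<forall>\<^sub>F k in sequentially. t < arrival_time \<omega> k)"
    (is "finite ?K \<longleftrightarrow> _")
proof
  assume "finite ?K"
  then obtain n where n: "?K \<subseteq> {..n}"
    using finite_nat_iff_bounded_le by blast
  have "t < arrival_time \<omega> k" if "Suc n \<le> k" for k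
  proof (rule ccontr)
    assume "\<not> t < arrival_time \<omega> k"
    then have "k \<in> ?K" using that by simp
    from subsetD[OF n this] that show False by simp
  qed
  then show "\<forall>\<^sub>F k in sequentially. t < arrival_time \<omega> k"
    unfolding eventually_sequentially by blast
next
  assume "\<forall>\<^sub>F k in sequentially. t < arrival_time \<omega> k"
  then obtain n where n: "\<And>k. n \<le> k \<Longrightarrow> t < arrival_time \<omega> k"
    unfolding eventually_sequentially by blast
  have "?K \<subseteq> {..n}"
  proof
    fix k assume "k \<in> ?K"
    then show "k \<in> {..n}" using n[of k] by (cases "n \<le> k") auto
  qed
  then show "finite ?K" by (rule finite_subset) simp
qed

text \<open>A sum over an infinite set is 0 by convention. The test \<open>?F\<close> detects
  finiteness measurably, and in the finite case the sum is a series with measurable terms.\<close>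

lemma measurable_work_arrived:
  assumes f [measurable]: "f \<in> borel_measurable (PiM UNIV (\<lambda>_. borel \<Otimes>\<^sub>M borel))"
  shows "(\<lambda>\<omega>. work_arrived \<omega> (f \<omega>)) \<in> borel_measurable (PiM UNIV (\<lambda>_. borel \<Otimes>\<^sub>M borel))"
proof -
  let ?Q = "PiM UNIV (\<lambda>_. borel \<Otimes>\<^sub>M borel) :: (nat \<Rightarrow> real \<times> real) measure"
  let ?K = "\<lambda>\<omega>. {k. 1 \<le> k \<and> arrival_time \<omega> k \<le> f \<omega>}"
  let ?F = "\<lambda>\<omega>. \<exists>n. \<forall>k\<ge>n. f \<omega> < arrival_time \<omega> k"
  let ?g = "\<lambda>\<omega> k. if 1 \<le> k \<and> arrival_time \<omega> k \<le> f \<omega> then snd (\<omega> k) else 0"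
  have fin: "finite (?K \<omega>) \<longleftrightarrow> ?F \<omega>" for \<omega>
    unfolding finite_arrivals_iff eventually_sequentially ..
  have "work_arrived \<omega> (f \<omega>) = snd (\<omega> 0) + (if ?F \<omega> then (\<Sum>k. ?g \<omega> k) else 0)" for \<omega>
  proof (cases "finite (?K \<omega>)")
    case True
    have "(\<Sum>k. ?g \<omega> k) = (\<Sum>k\<in>?K \<omega>. ?g \<omega> k)"
      using True by (intro suminf_finite) auto
    also have "\<dots> = (\<Sum>k\<in>?K \<omega>. snd (\<omega> k))"
      by (intro sum.cong) auto
    finally show ?thesis
      using True unfolding fin work_arrived_def by (simp only: if_True)
  next
    case False
    then have "(\<Sum>k\<in>?K \<omega>. snd (\<omega> k)) = 0" by (rule sum.infinite)
    with False show ?thesis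
      unfolding work_arrived_def fin by (simp only: if_False)
  qed
  then have "(\<lambda>\<omega>. work_arrived \<omega> (f \<omega>)) = (\<lambda>\<omega>. snd (\<omega> 0) + (if ?F \<omega> then (\<Sum>k. ?g \<omega> k) else 0))"
    by (rule ext)
  moreover have "(\<lambda>\<omega>. snd (\<omega> 0) + (if ?F \<omega> then (\<Sum>k. ?g \<omega> k) else 0)) \<in> borel_measurable ?Q"
  proof -
    have comp: "(\<lambda>\<omega>. snd (\<omega> k)) \<in> borel_measurable ?Q" for k
      by measurable
    have less: "Measurable.pred ?Q (\<lambda>\<omega>. f \<omega> < arrival_time \<omega> k)" for k
      using f measurable_arrival_time[of k] by (rule borel_measurable_pred_less)
    have "(\<lambda>\<omega>. ?g \<omega> k) \<in> borel_measurable ?Q" for k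
    proof (rule measurable_If[OF comp])
      have "Measurable.pred ?Q (\<lambda>\<omega>. 1 \<le> k \<and> \<not> f \<omega> < arrival_time \<omega> k)"
        using less[of k] by (intro pred_intros_logic) auto
      then show "{\<omega> \<in> space ?Q. 1 \<le> k \<and> arrival_time \<omega> k \<le> f \<omega>} \<in> sets ?Q"
        unfolding pred_def not_less .
    qed simp
    then have sum: "(\<lambda>\<omega>. \<Sum>k. ?g \<omega> k) \<in> borel_measurable ?Q"
      by (rule borel_measurable_suminf)
    have "{\<omega> \<in> space ?Q. ?F \<omega>} = (\<Union>n. \<Inter>k\<in>{n..}. {\<omega> \<in> space ?Q. f \<omega> < arrival_time \<omega> k})"
      by auto
    also have "\<dots> \<in> sets ?Q"
      by (intro sets.countable_UN' sets.countable_INT' less[unfolded pred_def] image_subsetI) auto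
    finally show ?thesis
      by (intro borel_measurable_add comp measurable_If sum) auto
  qed
  ultimately show ?thesis by (simp only:)
qed

text \<open>An infinite lower limit becomes 0 under \<open>real_of_ereal\<close>; the condition
  \<open>0 < explosion_time \<omega>\<close> discards it later.\<close>

definition explosion_time :: "(nat \<Rightarrow> real \<times> real) \<Rightarrow> real" where
  "explosion_time \<omega> = real_of_ereal (liminf (\<lambda>k. ereal (arrival_time \<omega> k)))"

lemma measurable_explosion_time [measurable]:
  "explosion_time \<in> borel_measurable (PiM UNIV (\<lambda>_. borel \<Otimes>\<^sub>M borel))"
  unfolding explosion_time_def[abs_def] by measurable

text \<open>The arrived work is a right-continuous step function of time, except that the sum takes its junk
value 0 once infinitely many arrivals have occurred. This can only matter at the first such time.\<close>

lemma work_arrived_le_iff: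
  "(\<exists>t. 0 < t \<and> t < u \<and> work_arrived \<omega> t \<le> t) \<longleftrightarrow> (\<exists>q\<in>\<rat> \<inter> {0<..<u}. work_arrived \<omega> q \<le> q) \<or>
    (0 < explosion_time \<omega> \<and> explosion_time \<omega> < u \<and> work_arrived \<omega> (explosion_time \<omega>) \<le> explosion_time \<omega>)"
    (is "?L \<longleftrightarrow> ?R")
proof
  let ?K = "\<lambda>t. {k. 1 \<le> k \<and> arrival_time \<omega> k \<le> t}"
  assume ?L
  then obtain t where t: "0 < t" "t < u" "work_arrived \<omega> t \<le> t" by blast
  show ?R
  proof (cases "\<exists>q>t. finite (?K q)")
    case True
    then obtain q where q: "t < q" "finite (?K q)" by blast
    \<comment> \<open>No customer arrives after \<open>t\<close> and up to a rational below the
      minimum of this set, so the arrived work does not change in between.\<close>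
    let ?T = "insert (min q u) (arrival_time \<omega> ` (?K q - ?K t))"
    have T: "finite ?T" "\<And>x. x \<in> ?T \<Longrightarrow> t < x"
      using q t by auto
    then have "t < Min ?T" by simp
    then obtain r where r: "r \<in> \<rat>" "t < r" "r < Min ?T"
      using Rats_dense_in_real by blast
    then have r': "r < min q u" "\<And>k. k \<in> ?K q - ?K t \<Longrightarrow> r < arrival_time \<omega> k"
      using T(1) by auto
    have "?K r \<subseteq> ?K t"
    proof
      fix k assume k: "k \<in> ?K r"
      show "k \<in> ?K t"
      proof (rule ccontr)
        assume "k \<notin> ?K t"
        then have "k \<in> ?K q - ?K t" using k r'(1) by auto
        from r'(2)[OF this] k show False by simp
      qed
    qed
    moreover have "?K t \<subseteq> ?K r" using r(2) by auto
    ultimately have "?K r = ?K t" by blast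
    then have "work_arrived \<omega> r = work_arrived \<omega> t"
      by (simp only: work_arrived_def)
    then show ?thesis
      using t r r' by (intro disjI1 bexI[of _ r]) auto
  next
    case inf: False
    show ?thesis
    proof (cases "finite (?K t)")
      case True
      \<comment> \<open>Finitely many arrivals up to \<open>t\<close>, infinitely many up to each
        later time: \<open>t\<close> is the explosion time.\<close>
      have "ereal t \<le> liminf (\<lambda>k. ereal (arrival_time \<omega> k))"
        unfolding le_Liminf_iff
      proof (intro allI impI)
        fix y assume "y < ereal t"
        show "\<forall>\<^sub>F k in sequentially. y < ereal (arrival_time \<omega> k)"
          using True[unfolded finite_arrivals_iff]
        proof eventually_elim
          case (elim k)
          then have "ereal t \<le> ereal (arrival_time \<omega> k)" by simp
          with \<open>y < ereal t\<close> show ?case by (rule less_le_trans)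
        qed
      qed
      moreover have "liminf (\<lambda>k. ereal (arrival_time \<omega> k)) \<le> ereal t"
      proof (rule ccontr)
        assume "\<not> ?thesis"
        then obtain z where "ereal t < z" "z < liminf (\<lambda>k. ereal (arrival_time \<omega> k))"
          using dense by (auto simp: not_le)
        then obtain q where q: "ereal t < ereal q" "ereal q < liminf (\<lambda>k. ereal (arrival_time \<omega> k))"
          using ereal_dense2 by (metis less_trans)
        have "\<forall>\<^sub>F k in sequentially. q < arrival_time \<omega> k"
          using less_LiminfD[OF q(2)] by simp
        then have "finite (?K q)"
          unfolding finite_arrivals_iff .
        then show False using inf q by auto
      qed
      ultimately have "liminf (\<lambda>k. ereal (arrival_time \<omega> k)) = ereal t"
        by (rule antisym[rotated])
      then have "explosion_time \<omega> = t"
        unfolding explosion_time_def by simp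
      then show ?thesis using t by simp
    next
      case False
      \<comment> \<open>Infinitely many arrivals already by \<open>t\<close>: the sum has its
        default value 0 at \<open>t\<close> and at any later time.\<close>
      obtain q where q: "q \<in> \<rat>" "t < q" "q < u"
        using Rats_dense_in_real[OF t(2)] by blast
      have "infinite (?K q)" using inf q by blast
      then have "work_arrived \<omega> q = work_arrived \<omega> t"
        using False by (simp add: work_arrived_def)
      then show ?thesis using q t by (intro disjI1 bexI[of _ q]) auto
    qed
  qed
qed auto

lemma measurable_busy_cycle:
  "busy_cycle \<in> borel_measurable (PiM UNIV (\<lambda>_. borel \<Otimes>\<^sub>M borel))"
proof (subst borel_measurable_iff_less, intro allI)
  let ?Q = "PiM UNIV (\<lambda>_. borel \<Otimes>\<^sub>M borel) :: (nat \<Rightarrow> real \<times> real) measure"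
  let ?S = "\<lambda>\<omega>. {t. 0 < t \<and> work_arrived \<omega> t \<le> t}"
  define R where "R u \<omega> \<longleftrightarrow> (\<exists>q\<in>\<rat> \<inter> {0<..<u}. work_arrived \<omega> q \<le> q) \<or>
    (0 < explosion_time \<omega> \<and> explosion_time \<omega> < u \<and> work_arrived \<omega> (explosion_time \<omega>) \<le> explosion_time \<omega>)" for u \<omega>
  have R: "R u \<omega> \<longleftrightarrow> (\<exists>t\<in>?S \<omega>. t < u)" for u \<omega>
    unfolding R_def work_arrived_le_iff[symmetric] by blast
  have meas_R: "{\<omega> \<in> space ?Q. R u \<omega>} \<in> sets ?Q" for u
  proof -
    have W: "{\<omega> \<in> space ?Q. work_arrived \<omega> (f \<omega>) \<le> f \<omega>} \<in> sets ?Q" if "f \<in> borel_measurable ?Q" for f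
      using measurable_work_arrived[OF that] that by (rule borel_measurable_le)
    have c: "countable (\<rat> \<inter> {0<..<u})"
      using countable_rat by blast
    have "{\<omega> \<in> space ?Q. \<exists>q\<in>\<rat> \<inter> {0<..<u}. work_arrived \<omega> q \<le> q} \<in> sets ?Q"
      by (rule sets_Collect_Bex_countable[OF c]) (rule W, simp)
    moreover have "{\<omega> \<in> space ?Q. 0 < explosion_time \<omega> \<and> explosion_time \<omega> < u \<and> work_arrived \<omega> (explosion_time \<omega>) \<le> explosion_time \<omega>} \<in> sets ?Q"
      by (intro sets.sets_Collect_conj W measurable_explosion_time) measurable
    ultimately show ?thesis
      unfolding R_def by (intro sets.sets_Collect_disj)
  qed
  fix u
  \<comment> \<open>The second alternative covers an empty set of idle times, where the infimum is
    \<open>Inf {}\<close>; emptiness shows in the failure of \<open>R\<close> at every natural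
    number.\<close>
  have "busy_cycle \<omega> < u \<longleftrightarrow> R u \<omega> \<or> (\<not> (\<exists>n. R (real n) \<omega>) \<and> Inf {} < u)" for \<omega>
  proof (cases "?S \<omega> = {}")
    case True
    then show ?thesis
      unfolding R busy_cycle_def True by simp
  next
    case False
    then obtain t where t: "t \<in> ?S \<omega>" by blast
    obtain n where "t < real n" using reals_Archimedean2 by blast
    with t have "\<exists>n. R (real n) \<omega>" unfolding R by blast
    moreover have "bdd_below (?S \<omega>)"
      by (rule bdd_belowI[of _ 0]) auto
    ultimately show ?thesis
      using cInf_less_iff[OF False, of u] unfolding R busy_cycle_def by simp
  qed
  then have "{\<omega> \<in> space ?Q. busy_cycle \<omega> < u} =
    {\<omega> \<in> space ?Q. R u \<omega>} \<union> (if Inf {} < u then space ?Q - (\<Union>n. {\<omega> \<in> space ?Q. R (real n) \<omega>}) else {})"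
    by auto
  also have "\<dots> \<in> sets ?Q"
    using meas_R by auto
  finally show "{\<omega> \<in> space ?Q. busy_cycle \<omega> < u} \<in> sets ?Q" .
qed

section \<open>The first passage time is a busy cycle\<close>

lemma (in stationary_process) passage_le_iff:
  assumes "\<omega> \<in> space M" "reaches k \<omega>" "0 \<le> t" and mono: "\<And>u v. 0 \<le> u \<Longrightarrow> u \<le> v \<Longrightarrow> Y u \<omega> \<le> Y v \<omega>"
  shows "passage k \<omega> \<le> t \<longleftrightarrow> int k \<le> Y t \<omega>"
proof
  assume "passage k \<omega> \<le> t"
  then show "int k \<le> Y t \<omega>"
    using mono[OF passage_nonneg[OF assms(2)]] Y_passage[OF assms(1,2)] by simp
qed (use passage_le assms in blast)

context poisson_matching
begin

text \<open>A single count cast as an instance of the abstract process: its passage times are the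
  points themselves and its gaps their spacings.\<close>

definition cnt :: "bool \<Rightarrow> bool \<Rightarrow> real \<Rightarrow> 'a \<Rightarrow> int" where
  "cnt s c = (if c then comb 0 1 s else comb 1 0 s)"

lemma cnt_eq: "cnt s c t \<omega> = int (pcount s c t \<omega>)"
  by (simp add: cnt_def comb_def)

text \<open>For a nondecreasing count every \<open>z\<close> in (0,1) gives a negative rate; 1/2 is
  one choice.\<close>

lemma transient_cnt: "transient_process M (cnt s c)"
  unfolding cnt_def using l_pos m_pos
  by (cases c) (auto intro!: transient_process_comb[where z="1 / 2"])

interpretation C: transient_process M "cnt s c" for s c
  by (rule transient_cnt)

definition point :: "bool \<Rightarrow> bool \<Rightarrow> nat \<Rightarrow> 'a \<Rightarrow> real" where
  "point s c k = stationary_process.passage (cnt s c) k"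

definition pgap :: "bool \<Rightarrow> bool \<Rightarrow> nat \<Rightarrow> 'a \<Rightarrow> real" where
  "pgap s c k = stationary_process.gap (cnt s c) k"

definition infinitely_many :: "'a \<Rightarrow> bool" where
  "infinitely_many \<omega> \<longleftrightarrow> (\<forall>s c k. stationary_process.reaches (cnt s c) k \<omega>)"

lemma AE_infinitely_many: "AE \<omega> in M. infinitely_many \<omega>"
  unfolding infinitely_many_def by (simp add: AE_all_countable C.AE_reaches)

lemma measurable_cnt_hist: "cnt s c t \<in> measurable (hist {(s, c)}) (count_space UNIV)"
  unfolding cnt_def by (auto intro!: measurable_comb_hist)

lemma measurable_pgap_hist: "pgap s c k \<in> borel_measurable (hist {(s, c)})"
  unfolding pgap_def
  by (rule C.measurable_past_subset[OF measurable_cnt_hist _ C.measurable_gap_past]) simp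

lemma measurable_point_hist: "point s c k \<in> borel_measurable (hist {(s, c)})"
  unfolding point_def
  by (rule C.measurable_past_subset[OF measurable_cnt_hist _ C.measurable_passage_past]) simp

lemma measurable_pgap [measurable]: "pgap s c k \<in> borel_measurable M"
  unfolding pgap_def by (rule C.measurable_gap)

lemma measurable_point [measurable]: "point s c k \<in> borel_measurable M"
  unfolding point_def by (rule C.measurable_passage)

lemma sum_pgap: "(\<Sum>i<k. pgap s c i \<omega>) = point s c k \<omega>"
  unfolding pgap_def point_def by (rule C.sum_gap)

lemma point_le_iff:
  assumes "\<omega> \<in> space M" "infinitely_many \<omega>" "0 \<le> t"
  shows "point s c k \<omega> \<le> t \<longleftrightarrow> k \<le> pcount s c t \<omega>"
proof -
  have "stationary_process.reaches (cnt s c) k \<omega>"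
    using assms(2) by (simp add: infinitely_many_def)
  from C.passage_le_iff[OF assms(1) this assms(3)] show ?thesis
    unfolding point_def using pcount_mono[OF assms(1)] by (simp add: cnt_eq)
qed

text \<open>The first point lies beyond \<open>a\<close> exactly if (0,a] is empty, which has
  probability exp (- a * rate c). The other gaps share the law of the first.\<close>

lemma distr_pgap: "distr M borel (pgap s c k) = exp_meas (rate c)"
proof -
  have "emeasure M {\<omega> \<in> space M. pgap s c 0 \<omega> \<le> a} = 1 - exp (- a * rate c)" if a: "0 \<le> a" for a
  proof -
    have "prob {\<omega> \<in> space M. pgap s c 0 \<omega> \<le> a} = prob {\<omega> \<in> space M. \<not> pcount s c a \<omega> = 0}"
    proof (rule measure_eq_AE)
      show "AE \<omega> in M. (\<omega> \<in> {\<omega> \<in> space M. pgap s c 0 \<omega> \<le> a}) = (\<omega> \<in> {\<omega> \<in> space M. \<not> pcount s c a \<omega> = 0})"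
        using AE_infinitely_many
      proof (rule AE_mp, intro AE_I2 impI)
        fix \<omega> assume w: "\<omega> \<in> space M" "infinitely_many \<omega>"
        have "pgap s c 0 \<omega> = point s c 1 \<omega>"
          using sum_pgap[of s c \<omega> 1] by simp
        then show "(\<omega> \<in> {\<omega> \<in> space M. pgap s c 0 \<omega> \<le> a}) = (\<omega> \<in> {\<omega> \<in> space M. \<not> pcount s c a \<omega> = 0})"
          using point_le_iff[OF w a, of s c 1] by auto
      qed
    qed measurable
    also have "\<dots> = 1 - prob {\<omega> \<in> space M. pcount s c a \<omega> = 0}"
      by (rule prob_neg) measurable
    also have "prob {\<omega> \<in> space M. pcount s c a \<omega> = 0} = exp (- a * rate c)"
    proof (cases "a = 0")
      case True
      then show ?thesis by (simp add: pcount_def prob_space)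
    next
      case False
      then show ?thesis
        using prob_half[of 0 a s c 0] a rate_pos[of c] by (simp add: pcount_def mult.commute)
    qed
    finally show ?thesis
      by (simp add: emeasure_eq_measure ennreal_minus[symmetric])
  qed
  then have "distributed M lborel (pgap s c 0) (exponential_density (rate c))"
    by (intro exponential_distributedI rate_pos) (auto simp: ennreal_minus ennreal_1[symmetric] simp del: ennreal_1)
  from distributed_distr_eq_density[OF this] have "distr M borel (pgap s c 0) = exp_meas (rate c)"
    unfolding exp_meas_def by (metis distr_cong sets_lborel)
  moreover have "distr M borel (pgap s c k) = distr M borel (pgap s c 0)"
    unfolding pgap_def by (rule C.distr_gap)
  ultimately show ?thesis by simp
qed

lemma indep_pgap: "indep_vars (\<lambda>_. borel) (\<lambda>j. pgap (fst (fst j)) (snd (fst j)) (snd j)) UNIV"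
proof -
  have "indep_vars (\<lambda>j. borel) (\<lambda>j. pgap (fst (fst j)) (snd (fst j)) (snd j)) (UNIV \<times> UNIV)"
  proof (rule indep_vars_blocks[where F="\<lambda>p. hist {p}" and X="\<lambda>p. pgap (fst p) (snd p)"])
    show "indep_sets (\<lambda>p. sets (hist {p})) UNIV"
      by (rule indep_hist) (auto simp: disjoint_family_on_def)
    show "pgap (fst p) (snd p) i \<in> borel_measurable (hist {p})" for p i
      using measurable_pgap_hist[of "fst p" "snd p" i] by simp
    show "indep_vars (\<lambda>_. borel) (pgap (fst p) (snd p)) UNIV" for p
      unfolding pgap_def by (rule C.indep_gap)
  qed simp
  then show ?thesis by simp
qed

text \<open>The inter-arrival time with index 0 does not influence the busy cycle. It is filled with
the first blue gap on the opposite side, which is independent of everything on side s.\<close>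

definition queue :: "bool \<Rightarrow> 'a \<Rightarrow> nat \<Rightarrow> real \<times> real" where
  "queue s \<omega> i = (if i = 0 then pgap (\<not> s) True 0 \<omega> else pgap s True (i - 1) \<omega>, pgap s False i \<omega>)"

lemma sets_queue_space: "sets (queue_space l' m') = sets (PiM UNIV (\<lambda>_. borel \<Otimes>\<^sub>M borel))"
  unfolding queue_space_def exp_meas_def by (intro sets_PiM_cong sets_pair_measure_cong) auto

text \<open>The coordinates of the queue are distinct point gaps, hence independent exponential
  variables of rate \<open>l\<close> for blue and \<open>m\<close> for red; they are then grouped
  into pairs.\<close>

lemma distr_queue: "queue s \<in> measurable M (PiM UNIV (\<lambda>_. borel \<Otimes>\<^sub>M borel))"
    "distr M (PiM UNIV (\<lambda>_. borel \<Otimes>\<^sub>M borel)) (queue s) = queue_space l m"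
proof -
  \<comment> \<open>Sends a coordinate of the queue (\<open>True\<close> for interarrival,
    \<open>False\<close> for service) to the gap that fills it. The shift by 1 leaves index 0 free
    for the gap from the other side and keeps \<open>h\<close> injective.\<close>
  define h where "h j = (if fst j then (if snd j = 0 then ((\<not> s, True), 0) else ((s, True), snd j - 1)) else ((s, False), snd j))"
    for j :: "bool \<times> nat"
  have inj: "inj h"
    by (auto intro!: injI simp: h_def prod_eq_iff split: if_splits)
  define H where "H j = (\<lambda>j. pgap (fst (fst j)) (snd (fst j)) (snd j)) (h j)" for j
  have indH: "indep_vars (\<lambda>_. borel) H UNIV"
    unfolding H_def by (rule indep_vars_reindex[OF indep_vars_subset[OF indep_pgap] inj]) auto
  have distrH: "distr M borel (H j) = exp_meas (rate (fst j))" for j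
    unfolding H_def distr_pgap by (simp add: h_def)
  have rvH [measurable]: "H j \<in> borel_measurable M" for j
    unfolding H_def by measurable
  have queue_eq: "queue s \<omega> i = (H (True, i) \<omega>, H (False, i) \<omega>)" for \<omega> i
    by (simp add: queue_def H_def h_def)
  have pairs: "indep_vars (\<lambda>_. borel \<Otimes>\<^sub>M borel) (\<lambda>i \<omega>. queue s \<omega> i) UNIV"
  proof -
    let ?K = "\<lambda>i :: nat. {(True, i), (False, i)}"
    have "indep_vars (\<lambda>i. PiM (?K i) (\<lambda>_. borel)) (\<lambda>i \<omega>. restrict (\<lambda>j. H j \<omega>) (?K i)) UNIV"
      by (rule indep_vars_restrict[OF indH]) (auto simp: disjoint_family_on_def)
    then have "indep_vars (\<lambda>_. borel \<Otimes>\<^sub>M borel)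
        (\<lambda>i \<omega>. (\<lambda>f. (f (True, i), f (False, i))) (restrict (\<lambda>j. H j \<omega>) (?K i))) UNIV"
    proof (rule indep_vars_compose2)
      fix i
      have "(\<lambda>f. f j) \<in> measurable (PiM (?K i) (\<lambda>_. borel)) (borel :: real measure)" if "j \<in> ?K i" for j
        using that by (rule measurable_component_singleton)
      then show "(\<lambda>f. (f (True, i), f (False, i))) \<in> measurable (PiM (?K i) (\<lambda>_. borel)) (borel \<Otimes>\<^sub>M (borel :: real measure))"
        by (intro measurable_Pair) auto
    qed
    then show ?thesis
      by (simp add: queue_eq)
  qed
  have pair: "distr M (borel \<Otimes>\<^sub>M borel) (\<lambda>\<omega>. queue s \<omega> i) = exp_meas l \<Otimes>\<^sub>M exp_meas m" for i
  proof -
    have "indep_vars (\<lambda>_. borel) (\<lambda>b. H (b, i)) UNIV"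
      by (rule indep_vars_reindex[OF indep_vars_subset[OF indH], of "\<lambda>b. (b, i)"]) (auto intro: injI)
    moreover have "case_bool borel borel = (\<lambda>_. borel :: real measure)" "case_bool (H (True, i)) (H (False, i)) = (\<lambda>b. H (b, i))"
      by (auto split: bool.split)
    ultimately have "indep_var borel (H (True, i)) borel (H (False, i))"
      unfolding indep_var_def by simp
    then have "distr M borel (H (True, i)) \<Otimes>\<^sub>M distr M borel (H (False, i)) = distr M (borel \<Otimes>\<^sub>M borel) (\<lambda>\<omega>. (H (True, i) \<omega>, H (False, i) \<omega>))"
      by (simp add: indep_var_distribution_eq)
    then show ?thesis
      by (simp add: queue_eq distrH rate_def)
  qed
  have rvq: "(\<lambda>\<omega>. queue s \<omega> i) \<in> measurable M (borel \<Otimes>\<^sub>M borel)" for i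
    unfolding queue_eq by measurable
  have "distr M (PiM UNIV (\<lambda>_. borel \<Otimes>\<^sub>M borel)) (\<lambda>\<omega>. \<lambda>i\<in>UNIV. queue s \<omega> i) = PiM UNIV (\<lambda>i. distr M (borel \<Otimes>\<^sub>M borel) (\<lambda>\<omega>. queue s \<omega> i))"
    using indep_vars_iff_distr_eq_PiM[where I=UNIV and M'="\<lambda>_. borel \<Otimes>\<^sub>M borel" and X="\<lambda>i \<omega>. queue s \<omega> i"] rvq pairs by simp
  then show "distr M (PiM UNIV (\<lambda>_. borel \<Otimes>\<^sub>M borel)) (queue s) = queue_space l m"
    by (simp add: pair queue_space_def restrict_def)
  have "(\<lambda>\<omega>. \<lambda>i\<in>UNIV. queue s \<omega> i) \<in> measurable M (PiM UNIV (\<lambda>_. borel \<Otimes>\<^sub>M borel))"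
    using rvq by (intro measurable_restrict)
  then show "queue s \<in> measurable M (PiM UNIV (\<lambda>_. borel \<Otimes>\<^sub>M borel))"
    by (simp add: restrict_def)
qed

text \<open>With \<open>A\<close> blue points up to \<open>t\<close> there are \<open>A + 1\<close>
  customers, including the one at time 0. Their services are the first \<open>A + 1\<close> red
  spacings, so the work equals the position of red point number \<open>A + 1\<close>; it is at most
  \<open>t\<close> exactly if red leads by one.\<close>

lemma work_arrived_queue_le_iff:
  assumes w: "\<omega> \<in> space M" "infinitely_many \<omega>" and t: "0 < t"
  shows "work_arrived (queue s \<omega>) t \<le> t \<longleftrightarrow> 1 \<le> comb 1 (- 1) s t \<omega>"
proof -
  have arr: "arrival_time (queue s \<omega>) k = point s True k \<omega>" for k
  proof -
    have "arrival_time (queue s \<omega>) k = (\<Sum>i\<in>{1..k}. pgap s True (i - 1) \<omega>)"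
      unfolding arrival_time_def by (intro sum.cong) (auto simp: queue_def)
    also have "\<dots> = (\<Sum>i<k. pgap s True i \<omega>)"
      by (rule sum.reindex_bij_witness[of _ Suc "\<lambda>i. i - 1"]) auto
    finally show ?thesis by (simp add: sum_pgap)
  qed
  let ?A = "pcount s True t \<omega>"
  have "{k. 1 \<le> k \<and> arrival_time (queue s \<omega>) k \<le> t} = {1..?A}"
    using point_le_iff[OF w] t by (auto simp: arr)
  then have "work_arrived (queue s \<omega>) t = pgap s False 0 \<omega> + (\<Sum>k\<in>{1..?A}. pgap s False k \<omega>)"
    by (simp add: work_arrived_def queue_def)
  also have "\<dots> = (\<Sum>k<Suc ?A. pgap s False k \<omega>)"
    by (simp add: sum.lessThan_Suc_shift sum.atLeast1_atMost_eq del: sum.lessThan_Suc)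
  also have "\<dots> = point s False (Suc ?A) \<omega>"
    by (rule sum_pgap)
  finally show ?thesis
    using point_le_iff[OF w, of t s False "Suc ?A"] t by (auto simp: comb_def)
qed

text \<open>Both are infima of the same set of times: \<open>t = 0\<close> belongs to neither, as
  the excess is 0 there.\<close>

lemma busy_cycle_queue:
  assumes w: "\<omega> \<in> space M" "infinitely_many \<omega>"
  shows "busy_cycle (queue s \<omega>) = stationary_process.passage (comb 1 (- 1) s) 1 \<omega>"
proof -
  interpret S: stationary_process M "comb 1 (- 1) s"
    by (rule stationary_process_comb) auto
  have "t \<in> {t. 0 < t \<and> work_arrived (queue s \<omega>) t \<le> t} \<longleftrightarrow> t \<in> {t. 0 \<le> t \<and> int 1 \<le> comb 1 (- 1) s t \<omega>}" for t
  proof (cases "t = 0")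
    case True
    then show ?thesis by (simp add: comb_def pcount_def)
  next
    case False
    then show ?thesis using work_arrived_queue_le_iff[OF w, of t s] by auto
  qed
  then have "{t. 0 < t \<and> work_arrived (queue s \<omega>) t \<le> t} = {t. 0 \<le> t \<and> int 1 \<le> comb 1 (- 1) s t \<omega>}"
    by blast
  then show ?thesis
    by (simp only: busy_cycle_def S.passage_def)
qed

lemma distr_first_passage:
  "distr M borel (stationary_process.passage (comb 1 (- 1) s) 1) = busy_dist l m"
proof -
  interpret S: stationary_process M "comb 1 (- 1) s"
    by (rule stationary_process_comb) auto
  let ?Q = "PiM UNIV (\<lambda>_. borel \<Otimes>\<^sub>M borel) :: (nat \<Rightarrow> real \<times> real) measure"
  have "distr M borel (S.passage 1) = distr M borel (\<lambda>\<omega>. busy_cycle (queue s \<omega>))"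
  proof (rule distr_cong_AE)
    show "AE \<omega> in M. S.passage 1 \<omega> = busy_cycle (queue s \<omega>)"
      using AE_infinitely_many by (rule AE_mp) (auto simp: busy_cycle_queue intro!: AE_I2)
    show "(\<lambda>\<omega>. busy_cycle (queue s \<omega>)) \<in> borel_measurable M"
      by (rule measurable_compose[OF distr_queue(1) measurable_busy_cycle])
  qed auto
  also have "\<dots> = distr (distr M ?Q (queue s)) borel busy_cycle"
    by (subst distr_distr[OF measurable_busy_cycle distr_queue(1)]) (simp add: comp_def)
  finally show ?thesis
    by (simp only: distr_queue(2) busy_dist_def)
qed

end

section \<open>The last record\<close>

context stationary_process
begin

text \<open>For \<open>j\<close> at least 1, almost surely the event N > j of the overview: a visit
  to level \<open>j\<close> or higher is followed by a return to 0 or below.\<close>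

definition drops :: "nat \<Rightarrow> 'a \<Rightarrow> bool" where
  "drops j \<omega> \<longleftrightarrow> (\<exists>u v. 0 \<le> u \<and> u < v \<and> int j \<le> Y u \<omega> \<and> Y v \<omega> \<le> 0)"

lemma drops_antimono: "i \<le> j \<Longrightarrow> drops j \<omega> \<Longrightarrow> drops i \<omega>"
  unfolding drops_def by (meson order_trans of_nat_le_iff)

lemma drops_iff_rational:
  assumes w: "\<omega> \<in> space M"
  shows "drops j \<omega> \<longleftrightarrow> (\<exists>p\<in>{(u, v). u \<in> \<rat> \<and> v \<in> \<rat> \<and> 0 \<le> u \<and> u < v}. int j \<le> Y (fst p) \<omega> \<and> Y (snd p) \<omega> \<le> 0)"
proof
  assume "drops j \<omega>"
  then obtain u v where uv: "0 \<le> u" "u < v" "int j \<le> Y u \<omega>" "Y v \<omega> \<le> 0"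
    by (auto simp: drops_def)
  obtain q where q: "q \<in> \<rat>" "u < q" "q < v" "Y q \<omega> = Y u \<omega>"
    using right_rational[OF w uv(1,2)] by blast
  obtain r where r: "r \<in> \<rat>" "v < r" "Y r \<omega> = Y v \<omega>"
    using right_rational[OF w, of v "v + 1"] uv by auto
  show "\<exists>p\<in>{(u, v). u \<in> \<rat> \<and> v \<in> \<rat> \<and> 0 \<le> u \<and> u < v}. int j \<le> Y (fst p) \<omega> \<and> Y (snd p) \<omega> \<le> 0"
    by (rule bexI[of _ "(q, r)"]) (use uv q r in auto)
qed (auto simp: drops_def)

lemma sets_drops: "{\<omega> \<in> space M. drops j \<omega>} \<in> sets (past {0..})"
proof -
  let ?P = "{(u, v). u \<in> \<rat> \<and> v \<in> \<rat> \<and> 0 \<le> u \<and> u < v} :: (real \<times> real) set"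
  have "{\<omega> \<in> space M. drops j \<omega>} = {\<omega> \<in> space (past {0..}). \<exists>p\<in>?P. int j \<le> Y (fst p) \<omega> \<and> Y (snd p) \<omega> \<le> 0}"
    using drops_iff_rational by auto
  also have "\<dots> \<in> sets (past {0..})"
  proof (rule sets_Collect_Bex_countable)
    have "?P \<subseteq> \<rat> \<times> \<rat>" by auto
    then show "countable ?P"
      by (rule countable_subset) (intro countable_SIGMA countable_rat)
    fix p assume p: "p \<in> ?P"
    have "Y t -` K \<inter> space M \<in> sets (past {0..})" if "0 \<le> t" for t and K :: "int set"
      using measurable_sets[OF measurable_past[of t "{0..}"], of K] that by simp
    from this[of "fst p" "{int j..}"] this[of "snd p" "{..0}"] p
    have "(Y (fst p) -` {int j..} \<inter> space M) \<inter> (Y (snd p) -` {..0} \<inter> space M) \<in> sets (past {0..})"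
      by auto
    moreover have "(Y (fst p) -` {int j..} \<inter> space M) \<inter> (Y (snd p) -` {..0} \<inter> space M) = {\<omega> \<in> space (past {0..}). int j \<le> Y (fst p) \<omega> \<and> Y (snd p) \<omega> \<le> 0}"
      by auto
    ultimately show "{\<omega> \<in> space (past {0..}). int j \<le> Y (fst p) \<omega> \<and> Y (snd p) \<omega> \<le> 0} \<in> sets (past {0..})"
      by simp
  qed
  finally show ?thesis .
qed

lemma events_drops: "{\<omega> \<in> space M. drops j \<omega>} \<in> events"
  using sets_drops sets_past_events by blast

text \<open>N of the overview, at least 1 by construction. If the path drops from every level the
  value is unspecified; \<open>distr_last_record\<close> shows that this is a null event.\<close>

definition last_record :: "'a \<Rightarrow> nat" where
  "last_record \<omega> = (LEAST j. 1 \<le> j \<and> \<not> drops j \<omega>)"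

lemma measurable_last_record_past: "last_record \<in> measurable (past {0..}) (count_space UNIV)"
proof -
  have "Measurable.pred (past {0..}) (drops j)" for j
    using sets_drops[of j] by (simp add: pred_def)
  then show ?thesis
    unfolding last_record_def[abs_def] by measurable
qed

lemma measurable_last_record [measurable]: "last_record \<in> measurable M (count_space UNIV)"
  by (rule measurable_from_past[OF measurable_last_record_past])

text \<open>At the passage the path equals the level itself, which is at least 1; a later value of 0
  or below would be a drop from that level.\<close>

lemma last_record_ge:
  assumes w: "\<omega> \<in> space M" and r: "\<And>k. reaches k \<omega>" and ex: "\<not> drops j \<omega>" "1 \<le> j"
  shows "1 \<le> last_record \<omega>" and "passage (last_record \<omega>) \<omega> \<le> t \<Longrightarrow> 1 \<le> Y t \<omega>"
proof -
  have L: "1 \<le> last_record \<omega> \<and> \<not> drops (last_record \<omega>) \<omega>"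
    unfolding last_record_def by (rule LeastI[where P="\<lambda>j. 1 \<le> j \<and> \<not> drops j \<omega>"]) (use ex in auto)
  then show "1 \<le> last_record \<omega>" by simp
  note Y = Y_passage[OF w r, of "last_record \<omega>"]
  assume t: "passage (last_record \<omega>) \<omega> \<le> t"
  show "1 \<le> Y t \<omega>"
  proof (cases "t = passage (last_record \<omega>) \<omega>")
    case True
    then show ?thesis using Y L by simp
  next
    case False
    with t have less: "passage (last_record \<omega>) \<omega> < t" by simp
    have "drops (last_record \<omega>) \<omega>" if "Y t \<omega> \<le> 0"
      unfolding drops_def using passage_nonneg[OF r, of "last_record \<omega>"] less that Y by (metis order_refl)
    then show ?thesis
      using L by linarith
  qed
qed

text \<open>The events \<open>drops j\<close> decrease in \<open>j\<close>, so the last record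
  exceeds \<open>j\<close> exactly when the path drops from \<open>j\<close>. The tail
  \<open>q ^ j\<close> is that of the geometric law on 1, 2, ... with success probability
  \<open>1 - q\<close>.\<close>

lemma distr_last_record:
  assumes p: "\<And>j. 1 \<le> j \<Longrightarrow> prob {\<omega> \<in> space M. drops j \<omega>} = q ^ j" and q: "0 < q" "q < 1"
  shows "AE \<omega> in M. \<exists>j\<ge>1. \<not> drops j \<omega>" "distr M (count_space UNIV) last_record = geom1 (1 - q)"
proof -
  \<comment> \<open>\<open>D 0\<close> is the whole space, so that the value \<open>Suc i\<close>
    corresponds to \<open>D i - D (Suc i)\<close> also for \<open>i = 0\<close>.\<close>
  define D where "D j = (if j = 0 then space M else {\<omega> \<in> space M. drops j \<omega>})" for j
  have D: "D j \<in> events" "prob (D j) = q ^ j" for j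
    using events_drops p[of j] by (auto simp: D_def prob_space)
  have D_mono: "D j \<subseteq> D i" if "i \<le> j" for i j
    using drops_antimono[OF that] that by (auto simp: D_def)
  let ?N = "\<Inter>j. D j"
  have N: "?N \<in> events" using D by auto
  have "prob ?N \<le> q ^ j" for j
    unfolding D(2)[symmetric] using D(1) by (intro finite_measure_mono) auto
  moreover have "(\<lambda>j. q ^ j) \<longlonglongrightarrow> 0" using q by (intro LIMSEQ_power_zero) auto
  ultimately have "prob ?N \<le> 0"
    by (intro LIMSEQ_le_const) auto
  then have N0: "emeasure M ?N = 0"
    by (simp add: emeasure_eq_measure measure_le_0_iff)
  show ex: "AE \<omega> in M. \<exists>j\<ge>1. \<not> drops j \<omega>"
  proof (rule AE_I[OF _ N0 N])
    show "{\<omega> \<in> space M. \<not> (\<exists>j\<ge>1. \<not> drops j \<omega>)} \<subseteq> ?N"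
      by (auto simp: D_def)
  qed
  show "distr M (count_space UNIV) last_record = geom1 (1 - q)"
  proof (rule measure_eqI_countable[where A=UNIV])
    fix k :: nat
    have L: "1 \<le> last_record \<omega> \<and> \<not> drops (last_record \<omega>) \<omega>" if ex: "\<exists>j\<ge>1. \<not> drops j \<omega>" for \<omega>
    proof -
      from ex obtain j where "1 \<le> j \<and> \<not> drops j \<omega>" by blast
      then show ?thesis
        unfolding last_record_def by (rule LeastI[where P="\<lambda>j. 1 \<le> j \<and> \<not> drops j \<omega>"])
    qed
    have L_le: "last_record \<omega> \<le> j" if "1 \<le> j" "\<not> drops j \<omega>" for j \<omega>
      unfolding last_record_def by (rule Least_le) (use that in auto)
    have "prob {\<omega> \<in> space M. last_record \<omega> = k} = pmf (map_pmf Suc (geometric_pmf (1 - q))) k"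
    proof (cases k)
      case 0
      have "prob {\<omega> \<in> space M. last_record \<omega> = 0} = prob {}"
      proof (rule measure_eq_AE)
        show "AE \<omega> in M. (\<omega> \<in> {\<omega> \<in> space M. last_record \<omega> = 0}) = (\<omega> \<in> {})"
          using ex
        proof (rule AE_mp, intro AE_I2 impI)
          fix \<omega> assume "\<exists>j\<ge>1. \<not> drops j \<omega>"
          from L[OF this] show "(\<omega> \<in> {\<omega> \<in> space M. last_record \<omega> = 0}) = (\<omega> \<in> {})" by simp
        qed
      qed measurable
      moreover have "pmf (map_pmf Suc (geometric_pmf (1 - q))) 0 = 0"
        by (rule pmf_map_outside) auto
      ultimately show ?thesis using 0 by simp
    next
      case (Suc i)
      have "prob {\<omega> \<in> space M. last_record \<omega> = Suc i} = prob (D i - D (Suc i))"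
      proof (rule measure_eq_AE)
        show "AE \<omega> in M. (\<omega> \<in> {\<omega> \<in> space M. last_record \<omega> = Suc i}) = (\<omega> \<in> D i - D (Suc i))"
          using ex
        proof (rule AE_mp, intro AE_I2 impI)
          fix \<omega> assume w: "\<omega> \<in> space M" "\<exists>j\<ge>1. \<not> drops j \<omega>"
          note L = L[OF w(2)]
          show "(\<omega> \<in> {\<omega> \<in> space M. last_record \<omega> = Suc i}) = (\<omega> \<in> D i - D (Suc i))"
          proof
            assume "\<omega> \<in> {\<omega> \<in> space M. last_record \<omega> = Suc i}"
            then have e: "last_record \<omega> = Suc i" by simp
            have "drops i \<omega>" if "1 \<le> i"
              using L_le[OF that, of \<omega>] e by auto
            then show "\<omega> \<in> D i - D (Suc i)"
              using w L e by (auto simp: D_def)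
          next
            assume d: "\<omega> \<in> D i - D (Suc i)"
            then have nd: "\<not> drops (Suc i) \<omega>" using w by (auto simp: D_def)
            then have "last_record \<omega> \<le> Suc i" by (intro L_le) auto
            moreover have "\<not> last_record \<omega> \<le> i"
            proof
              assume le: "last_record \<omega> \<le> i"
              then have "drops i \<omega>" using d L by (auto simp: D_def split: if_splits)
              with drops_antimono[OF le] L show False by blast
            qed
            ultimately show "\<omega> \<in> {\<omega> \<in> space M. last_record \<omega> = Suc i}"
              using w by simp
          qed
        qed
      qed (use D in measurable)
      also have "\<dots> = q ^ i - q ^ Suc i"
        using D D_mono[of i "Suc i"] by (simp add: finite_measure_Diff)
      also have "\<dots> = pmf (map_pmf Suc (geometric_pmf (1 - q))) (Suc i)"
        using q by (simp add: pmf_map_inj' algebra_simps)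
      finally show ?thesis using Suc by simp
    qed
    then show "emeasure (distr M (count_space UNIV) last_record) {k} = emeasure (geom1 (1 - q)) {k}"
      unfolding geom1_def
      by (simp add: emeasure_distr emeasure_eq_measure emeasure_pmf_single vimage_def Int_def conj_commute)
  qed (auto simp: geom1_def)
qed

end

text \<open>A drop from \<open>j\<close> takes place after the first passage to \<open>j\<close>,
  which occurs almost surely and at which the path equals \<open>j\<close>. By the strong Markov
  property it is a descent by \<open>j\<close> of the restarted path.\<close>

lemma (in transient_process) prob_drops:
  assumes j: "1 \<le> j"
  shows "prob {\<omega> \<in> space M. drops j \<omega>} = prob {\<omega> \<in> space M. \<exists>s\<ge>0. Y s \<omega> \<le> - int j}"
proof -
  let ?Q = "\<rat> \<inter> {0<..} :: real set"
  let ?E = "{\<omega> \<in> space M. reaches j \<omega>}"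
  have Q: "countable ?Q" "?Q \<subseteq> {0<..}"
    using countable_rat by auto
  have past: "?E \<inter> {\<omega>. passage j \<omega> < u} \<in> sets (past {..u})" for u
  proof -
    have "?E \<inter> {\<omega>. passage j \<omega> < u} = {\<omega> \<in> space M. reaches j \<omega> \<and> passage j \<omega> < u}" by auto
    then show ?thesis using sets_passage_less[of u "{..u}" j] by (auto simp: subset_iff)
  qed
  let ?H = "?E \<inter> {\<omega> \<in> space M. \<exists>s\<in>?Q. Y (passage j \<omega> + s) \<omega> - Y (passage j \<omega>) \<omega> \<in> {..- int j}}"
  have hit: "prob ?H = prob ?E * prob {\<omega> \<in> space M. \<exists>s\<in>?Q. Y s \<omega> \<in> {..- int j}}" "?H \<in> events"
    by (rule strong_markov_hit[OF events_reaches _ past Q]; use passage_nonneg in auto)+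
  have "prob {\<omega> \<in> space M. drops j \<omega>} = prob ?H"
  proof -
    have "{\<omega> \<in> space M. drops j \<omega>} = ?H"
    proof (intro set_eqI iffI)
      fix \<omega> assume "\<omega> \<in> {\<omega> \<in> space M. drops j \<omega>}"
      then obtain u v where w: "\<omega> \<in> space M" and uv: "0 \<le> u" "u < v" "int j \<le> Y u \<omega>" "Y v \<omega> \<le> 0"
        by (auto simp: drops_def)
      have r: "reaches j \<omega>" using uv by (auto simp: reaches_def)
      have T: "passage j \<omega> < v" using passage_le[OF uv(1,3)] uv by simp
      obtain e where e: "e > 0" "\<And>s. v \<le> s \<Longrightarrow> s < v + e \<Longrightarrow> Y s \<omega> = Y v \<omega>"
        using Y_right[OF w, of v] uv by auto
      obtain q where q: "q \<in> \<rat>" "v - passage j \<omega> < q" "q < v - passage j \<omega> + e"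
        using Rats_dense_in_real[of "v - passage j \<omega>" "v - passage j \<omega> + e"] e by auto
      have "Y (passage j \<omega> + q) \<omega> = Y v \<omega>"
        by (rule e(2)) (use q in auto)
      then show "\<omega> \<in> ?H"
        using w r q T uv Y_passage[OF w r] by (auto intro!: bexI[of _ q])
    next
      fix \<omega> assume "\<omega> \<in> ?H"
      then obtain s where w: "\<omega> \<in> space M" "reaches j \<omega>" and s: "0 < s" "Y (passage j \<omega> + s) \<omega> - Y (passage j \<omega>) \<omega> \<le> - int j"
        by auto
      then have "0 \<le> passage j \<omega>" "passage j \<omega> < passage j \<omega> + s" "int j \<le> Y (passage j \<omega>) \<omega>" "Y (passage j \<omega> + s) \<omega> \<le> 0"
        using Y_passage[OF w] passage_nonneg[OF w(2)] by auto
      then show "\<omega> \<in> {\<omega> \<in> space M. drops j \<omega>}"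
        unfolding drops_def using w(1) by blast
    qed
    then show ?thesis by simp
  qed
  also have "\<dots> = prob {\<omega> \<in> space M. \<exists>s\<in>?Q. Y s \<omega> \<in> {..- int j}}"
    unfolding hit(1) using AE_reaches[of j] by (simp add: prob_Collect_eq_1)
  also have "{\<omega> \<in> space M. \<exists>s\<in>?Q. Y s \<omega> \<in> {..- int j}} = {\<omega> \<in> space M. \<exists>s\<ge>0. Y s \<omega> \<le> - int j}"
  proof (intro set_eqI iffI)
    fix \<omega> assume "\<omega> \<in> {\<omega> \<in> space M. \<exists>s\<ge>0. Y s \<omega> \<le> - int j}"
    then obtain s where w: "\<omega> \<in> space M" and s: "0 \<le> s" "Y s \<omega> \<le> - int j" by auto
    obtain q where "q \<in> \<rat>" "s < q" "Y q \<omega> = Y s \<omega>"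
      using right_rational[OF w s(1), of "s + 1"] by auto
    then show "\<omega> \<in> {\<omega> \<in> space M. \<exists>s\<in>?Q. Y s \<omega> \<in> {..- int j}}"
      using w s by (auto intro!: bexI[of _ q])
  next
    fix \<omega> assume "\<omega> \<in> {\<omega> \<in> space M. \<exists>s\<in>?Q. Y s \<omega> \<in> {..- int j}}"
    then obtain q where "\<omega> \<in> space M" "0 < q" "Y q \<omega> \<le> - int j" by auto
    then show "\<omega> \<in> {\<omega> \<in> space M. \<exists>s\<ge>0. Y s \<omega> \<le> - int j}"
      using less_imp_le by blast
  qed
  finally show ?thesis .
qed

locale subcritical_matching = poisson_matching +
  assumes l_less_m: "l < m"
begin

text \<open>With m = l y^2 the rate in the third claim is - l (y - 1)^2. The value z = 1/y minimises
  m (z - 1) + l (1/z - 1), which makes it the natural choice both for transience and for the decay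
  in optional stopping.\<close>

lemma sqrt_ratio: "1 < sqrt (m / l)" "(sqrt (m / l))\<^sup>2 = m / l"
    "m * (1 / sqrt (m / l) - 1) + l * (sqrt (m / l) - 1) < 0"
proof -
  define y where "y = sqrt (m / l)"
  show y1: "1 < sqrt (m / l)" "(sqrt (m / l))\<^sup>2 = m / l"
    using l_less_m l_pos m_pos by auto
  then have y: "1 < y" "m = l * y\<^sup>2"
    using l_pos by (auto simp: y_def)
  have "m * (1 / y - 1) + l * (y - 1) = - (l * (y - 1)\<^sup>2)"
    unfolding y(2) using y(1) by (simp add: power2_eq_square field_simps)
  also have "\<dots> < 0"
    using y(1) l_pos by simp
  finally show "m * (1 / sqrt (m / l) - 1) + l * (sqrt (m / l) - 1) < 0"
    by (simp add: y_def)
qed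

lemma transient_excess: "transient_process M (comb 1 (- 1) s)"
proof (rule transient_process_comb[where z="1 / sqrt (m / l)"])
  show "m * ((1 / sqrt (m / l)) powi 1 - 1) + l * ((1 / sqrt (m / l)) powi - 1 - 1) < 0"
    using sqrt_ratio by (simp add: power_int_minus)
qed (use sqrt_ratio l_pos m_pos in auto)

text \<open>The negative excess reaches \<open>j\<close> with probability (1/y^2)^j, where y^2 = m/l
  is the base whose powers form a martingale: m (l/m - 1) + l (m/l - 1) = 0.\<close>

lemma prob_excess_reaches:
  "prob {\<omega> \<in> space M. \<exists>t\<ge>0. comb 1 (- 1) s t \<omega> \<le> - int j} = (l / m) ^ j"
proof -
  interpret Z: stationary_process M "comb (- 1) 1 s"
    by (rule stationary_process_comb) auto
  define y where "y = sqrt (m / l)"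
  have y: "1 < y" "y\<^sup>2 = m / l" "m * (1 / y - 1) + l * (y - 1) < 0"
    using sqrt_ratio by (auto simp: y_def)
  have "prob {\<omega> \<in> space M. Z.reaches j \<omega>} = (1 / y\<^sup>2) ^ j"
  \<comment> \<open>The negative excess is at most the blue count, which is monotone; its value at
    \<open>N\<close> yields an integrable majorant on [0,N].\<close>
  proof (rule Z.prob_reaches[where w="\<lambda>N \<omega>. ennreal (y\<^sup>2 powi comb 0 1 s (real N) \<omega>)"])
    show "1 \<le> y" using y by simp
    show "(\<integral>\<^sup>+ \<omega>. ennreal (y\<^sup>2 powi comb (- 1) 1 s d \<omega>) \<partial>M) = 1" if "0 < d" for d
      using that l_pos m_pos by (subst nn_integral_comb) (auto simp: y(2) power_int_minus field_simps)
    show "(\<integral>\<^sup>+ \<omega>. ennreal (y\<^sup>2 powi comb 0 1 s (real N) \<omega>) \<partial>M) < \<infinity>" for N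
    proof (cases "N = 0")
      case True
      then show ?thesis by (simp add: comb_def pcount_def emeasure_space_1)
    next
      case False
      then show ?thesis using y l_pos m_pos by (subst nn_integral_comb) auto
    qed
    show "ennreal (y\<^sup>2 powi comb (- 1) 1 s t \<omega>) \<le> ennreal (y\<^sup>2 powi comb 0 1 s (real N) \<omega>)"
      if "\<omega> \<in> space M" "0 \<le> t" "t \<le> real N" for N \<omega> t
    proof (intro ennreal_leI power_int_increasing)
      show "comb (- 1) 1 s t \<omega> \<le> comb 0 1 s (real N) \<omega>"
        using pcount_mono[OF that, of s True] by (simp add: comb_def)
    qed (use y l_pos l_less_m in auto)
    show "(\<lambda>N. \<integral>\<^sup>+ \<omega>. ennreal (y powi comb (- 1) 1 s (real N) \<omega>) \<partial>M) \<longlonglongrightarrow> 0"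
      using y by (intro nn_integral_comb_decay) (auto simp: power_int_minus inverse_eq_divide)
  qed measurable
  moreover have "Z.reaches j \<omega> \<longleftrightarrow> (\<exists>t\<ge>0. comb 1 (- 1) s t \<omega> \<le> - int j)" for \<omega>
    unfolding Z.reaches_def comb_def by (intro ex_cong) auto
  ultimately show ?thesis
    by (simp add: y(2))
qed

end

section \<open>Absence of ties and bounds on the matching distance\<close>

text \<open>Fubini: for each value of \<open>W\<close> the section of the diagonal is a single
  point, which \<open>X\<close> hits with probability 0.\<close>

lemma (in prob_space) AE_neq_indep_atomless:
  fixes X W :: "'a \<Rightarrow> real"
  assumes ind: "indep_var borel X borel W" and atomless: "\<And>x. AE \<omega> in M. X \<omega> \<noteq> x"
  shows "AE \<omega> in M. X \<omega> \<noteq> W \<omega>"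
proof -
  have [measurable]: "X \<in> borel_measurable M" "W \<in> borel_measurable M"
    using ind by (auto dest: indep_var_rv1 indep_var_rv2)
  interpret DX: prob_space "distr M borel X" by (rule prob_space_distr) simp
  interpret DW: prob_space "distr M borel W" by (rule prob_space_distr) simp
  interpret P: pair_prob_space "distr M borel X" "distr M borel W" ..
  let ?D = "{p. fst p = snd p} :: (real \<times> real) set"
  have D: "?D \<in> sets (borel \<Otimes>\<^sub>M borel)"
  proof -
    have "{p \<in> space (borel \<Otimes>\<^sub>M borel). fst p = (snd p :: real)} \<in> sets (borel \<Otimes>\<^sub>M borel)" by measurable
    then show ?thesis by (simp add: space_pair_measure)
  qed
  have "emeasure (distr M borel X) ((\<lambda>x. (x, w)) -` ?D) = 0" for w
  proof -
    have "(\<lambda>x. (x, w)) -` ?D = {w}" by auto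
    moreover have "emeasure M {\<omega> \<in> space M. X \<omega> = w} = 0"
      using atomless[of w] by (subst (asm) AE_iff_measurable[OF _ refl]) auto
    ultimately show ?thesis
      by (simp add: emeasure_distr vimage_def Int_def conj_commute)
  qed
  then have "emeasure (distr M borel X \<Otimes>\<^sub>M distr M borel W) ?D = 0"
    using D by (subst P.emeasure_pair_measure_alt2) (auto cong: sets_pair_measure_cong)
  then have "emeasure (distr M (borel \<Otimes>\<^sub>M borel) (\<lambda>\<omega>. (X \<omega>, W \<omega>))) ?D = 0"
    using ind by (simp add: indep_var_distribution_eq)
  then have "emeasure M {\<omega> \<in> space M. X \<omega> = W \<omega>} = 0"
    using D by (simp add: emeasure_distr vimage_def Int_def conj_commute)
  then show ?thesis
    by (intro AE_I[where N="{\<omega> \<in> space M. X \<omega> = W \<omega>}"]) auto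
qed

context poisson_matching
begin

interpretation C: transient_process M "cnt s c" for s c
  by (rule transient_cnt)

text \<open>A point at \<open>x\<close> would lie in (x - 1/(n+1), x] for every \<open>n\<close>,
  and the chance that this interval is nonempty tends to 0.\<close>

lemma AE_not_in_half: "AE \<omega> in M. x \<notin> half s c \<omega>"
proof -
  let ?A = "\<lambda>n. {\<omega> \<in> space M. card (half s c \<omega> \<inter> {x - 1 / real (Suc n)<..x}) \<noteq> 0}"
  have A: "?A n \<in> events" for n by measurable
  have "prob (?A n) = 1 - exp (- (rate c * (1 / real (Suc n))))" for n
  proof -
    have "prob (?A n) = 1 - prob {\<omega> \<in> space M. card (half s c \<omega> \<inter> {x - 1 / real (Suc n)<..x}) = 0}"
      by (rule prob_neg) measurable
    also have "prob {\<omega> \<in> space M. card (half s c \<omega> \<inter> {x - 1 / real (Suc n)<..x}) = 0} = exp (- (rate c * (1 / real (Suc n))))"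
      using prob_half[of "x - 1 / real (Suc n)" x s c 0] rate_pos[of c] by simp
    finally show ?thesis .
  qed
  moreover have "(\<lambda>n. 1 - exp (- (rate c * (1 / real (Suc n))))) \<longlonglongrightarrow> 1 - exp (- (rate c * 0))"
    using LIMSEQ_inverse_real_of_nat by (intro tendsto_intros) (simp add: inverse_eq_divide)
  ultimately have lim: "(\<lambda>n. prob (?A n)) \<longlonglongrightarrow> 0" by simp
  have "prob (\<Inter>n. ?A n) \<le> prob (?A n)" for n
    by (rule finite_measure_mono) (use A in auto)
  then have "prob (\<Inter>n. ?A n) \<le> 0"
    using lim by (intro LIMSEQ_le_const) auto
  then have null: "emeasure M (\<Inter>n. ?A n) = 0"
    by (simp add: emeasure_eq_measure measure_le_0_iff)
  have ev: "(\<Inter>n. ?A n) \<in> events" using A by auto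
  show ?thesis
  proof (rule AE_I[OF _ null ev], rule subsetI)
    fix \<omega> assume "\<omega> \<in> {\<omega> \<in> space M. \<not> x \<notin> half s c \<omega>}"
    then have w: "\<omega> \<in> space M" and x: "x \<in> half s c \<omega>" by auto
    have "card (half s c \<omega> \<inter> {x - 1 / real (Suc n)<..x}) \<noteq> 0" for n
    proof
      assume c0: "card (half s c \<omega> \<inter> {x - 1 / real (Suc n)<..x}) = 0"
      have "finite (half s c \<omega> \<inter> {x - 1 / real (Suc n)<..x})"
        by (rule finite_locally_finite_Ioo(2)[OF locally_finite_half[OF w]])
      with c0 have "half s c \<omega> \<inter> {x - 1 / real (Suc n)<..x} = {}" by simp
      moreover have "x \<in> half s c \<omega> \<inter> {x - 1 / real (Suc n)<..x}" using x by simp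
      ultimately show False by blast
    qed
    then show "\<omega> \<in> (\<Inter>n. ?A n)" using w by blast
  qed
qed

lemma point_pos:
  assumes "\<omega> \<in> space M" "infinitely_many \<omega>"
  shows "0 < point s c (Suc k) \<omega>"
  using C.passage_nonneg[of s c k \<omega>] C.passage_strict_mono[OF assms(1), of s c k] assms(2)
  by (auto simp: point_def infinitely_many_def intro: le_less_trans)

lemma point_in_half:
  assumes w: "\<omega> \<in> space M" "infinitely_many \<omega>"
  shows "point s c (Suc k) \<omega> \<in> half s c \<omega>"
proof (rule ccontr)
  let ?t = "point s c (Suc k) \<omega>"
  assume n: "?t \<notin> half s c \<omega>"
  note t = point_pos[OF w, of s c k]
  obtain e where e: "e > 0" "half s c \<omega> \<inter> {?t - e<..<?t} = {}"
    using locally_finite_left_gap[OF locally_finite_half[OF w(1)]] by blast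
  obtain y where y: "max 0 (?t - e) < y" "y < ?t"
    using dense[of "max 0 (?t - e)" ?t] t e(1) by auto
  have "half s c \<omega> \<inter> {y<..?t} = {}"
    using e(2) n y by (auto simp: order_le_less)
  then have "pcount s c ?t \<omega> = pcount s c y \<omega>"
    using pcount_add[OF w(1), of y ?t s c] y by simp
  moreover have "Suc k \<le> pcount s c ?t \<omega>"
    using point_le_iff[OF w, of ?t s c "Suc k"] t by simp
  ultimately have "?t \<le> y"
    using point_le_iff[OF w, of y s c "Suc k"] y by simp
  then show False using y by simp
qed

lemma half_eq_point:
  assumes w: "\<omega> \<in> space M" "infinitely_many \<omega>" and x: "x \<in> half s c \<omega>" "0 < x"
  shows "\<exists>k. x = point s c (Suc k) \<omega>"
proof -
  let ?n = "pcount s c x \<omega>"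
  have jump: "pcount s c y \<omega> < ?n" if "0 \<le> y" "y < x" for y
  proof -
    have "x \<in> half s c \<omega> \<inter> {y<..x}" using x that by simp
    then have "0 < card (half s c \<omega> \<inter> {y<..x})"
      using finite_locally_finite_Ioo(2)[OF locally_finite_half[OF w(1)]] card_gt_0_iff by blast
    then show ?thesis
      using pcount_add[OF w(1), of y x s c] that by simp
  qed
  obtain k where k: "?n = Suc k"
    using jump[of 0] x by (cases ?n) auto
  have "point s c ?n \<omega> \<le> x"
    using point_le_iff[OF w, of x s c ?n] x by simp
  moreover have "\<not> point s c ?n \<omega> < x"
  proof
    assume less: "point s c ?n \<omega> < x"
    have p: "0 \<le> point s c ?n \<omega>"
      using point_pos[OF w, of s c k] k by simp
    from jump[OF p less] point_le_iff[OF w p, of s c ?n] show False by simp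
  qed
  ultimately show ?thesis
    using k by (intro exI[of _ k]) simp
qed

text \<open>Position on the whole line of a point of colour \<open>c\<close>, negative on the left
  side. \<open>Suc\<close> skips the passage to level 0, which is not a point.\<close>

definition spoint :: "bool \<Rightarrow> bool \<Rightarrow> nat \<Rightarrow> 'a \<Rightarrow> real" where
  "spoint c s k \<omega> = (if s then 1 else - 1) * point s c (Suc k) \<omega>"

lemma colour_eq_spoint:
  assumes w: "\<omega> \<in> space M" "infinitely_many \<omega>" and x: "x \<in> colour c \<omega>" "x \<noteq> 0"
  shows "\<exists>s k. x = spoint c s k \<omega>"
proof (cases "0 < x")
  case True
  then have "x \<in> half True c \<omega>" using x by (simp add: half_def)
  from half_eq_point[OF w this True] show ?thesis
    by (auto simp: spoint_def intro!: exI[of _ True])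
next
  case False
  then have "- x \<in> half False c \<omega>" "0 < - x" using x by (auto simp: half_def)
  from half_eq_point[OF w this] obtain k where "- x = point False c (Suc k) \<omega>" by blast
  then have "x = spoint c False k \<omega>" by (simp add: spoint_def)
  then show ?thesis by blast
qed

lemma measurable_spoint_hist: "(s, c) \<in> J \<Longrightarrow> spoint c s k \<in> borel_measurable (hist J)"
proof -
  assume "(s, c) \<in> J"
  then have "sets (hist {(s, c)}) \<subseteq> sets (hist J)"
    unfolding sets_hist by (intro sigma_sets_mono') auto
  then have "point s c (Suc k) \<in> borel_measurable (hist J)"
    using measurable_point_hist[of s c "Suc k"] by (auto simp: measurable_def)
  then show ?thesis
    unfolding spoint_def[abs_def] by measurable
qed

lemma AE_spoint_neq: "AE \<omega> in M. spoint c s k \<omega> \<noteq> x"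
  using AE_infinitely_many AE_not_in_half[of "(if s then 1 else - 1) * x" s c] AE_space
proof eventually_elim
  case (elim \<omega>)
  show ?case
  proof
    assume "spoint c s k \<omega> = x"
    then have "point s c (Suc k) \<omega> = (if s then 1 else - 1) * x"
      by (auto simp: spoint_def)
    with point_in_half[OF elim(3,1), of s c k] elim(2) show False by simp
  qed
qed

text \<open>A single point has an atomless law and is independent of what the other half processes
  determine. The factor \<open>a\<close> serves relations such as 2u = v + v' and
  reflections.\<close>

lemma AE_spoint_neq_hist:
  assumes "(s, c) \<in> J" "W \<in> borel_measurable (hist J')" "J \<inter> J' = {}" "a \<noteq> 0"
  shows "AE \<omega> in M. a * spoint c s k \<omega> \<noteq> W \<omega>"
proof (rule AE_neq_indep_atomless)
  have "indep_vars (case_bool borel borel) (case_bool (\<lambda>\<omega>. a * spoint c s k \<omega>) W) UNIV"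
  proof (rule indep_vars_hist[where J="case_bool J J'"])
    show "disjoint_family_on (case_bool J J') UNIV"
      using assms(3) by (auto simp: disjoint_family_on_def split: bool.splits)
    show "case_bool (\<lambda>\<omega>. a * spoint c s k \<omega>) W b \<in> measurable (hist (case b of True \<Rightarrow> J | False \<Rightarrow> J')) (case b of True \<Rightarrow> borel | False \<Rightarrow> borel)" for b
      using assms(2) measurable_spoint_hist[OF assms(1)] by (cases b) auto
  qed
  then show "indep_var borel (\<lambda>\<omega>. a * spoint c s k \<omega>) borel W"
    by (simp add: indep_var_def)
  show "AE \<omega> in M. a * spoint c s k \<omega> \<noteq> x" for x
    by (rule eventually_mono[OF AE_spoint_neq[of c s k "x / a"]]) (use assms(4) in \<open>auto simp: field_simps\<close>)
qed

text \<open>Equal distances |u - x| = |u - y| with x and y distinct mean 2u = x + y. All ties and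
  coincidences thus become countably many linear relations among signed points and 0, and each is
  excluded almost surely.\<close>

lemma AE_generic:
  "AE \<omega> in M. insert 0 (Bl \<omega>) \<inter> Rd \<omega> = {} \<and> no_ties (insert 0 (Bl \<omega>)) (Rd \<omega>) \<and> no_ties (Rd \<omega>) (insert 0 (Bl \<omega>))"
proof -
  let ?J = "\<lambda>c. UNIV \<times> {c} :: (bool \<times> bool) set"
  have [measurable]: "spoint c s k \<in> borel_measurable (hist (?J c))" for c s k
    by (rule measurable_spoint_hist) simp
  have "AE \<omega> in M. spoint True s k \<omega> \<noteq> spoint False s' k' \<omega>" for s k s' k'
    using AE_spoint_neq_hist[of s True "?J True" "spoint False s' k'" "?J False" 1 k] by auto
  then have A1: "AE \<omega> in M. \<forall>s k s' k'. spoint True s k \<omega> \<noteq> spoint False s' k' \<omega>"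
    by (simp add: AE_all_countable)
  \<comment> \<open>Symmetric red points would tie for the blue point at 0. Here both points are
    red, and independence comes from the two sides.\<close>
  have "AE \<omega> in M. - 1 * spoint False True k \<omega> \<noteq> spoint False False k' \<omega>" for k k'
    by (rule AE_spoint_neq_hist[where J="{(True, False)}" and J'="{(False, False)}"]) (auto intro: measurable_spoint_hist)
  then have A2: "AE \<omega> in M. \<forall>k k'. - spoint False True k \<omega> \<noteq> spoint False False k' \<omega>"
    by (simp add: AE_all_countable)
  \<comment> \<open>Excludes a midpoint of two points of the other colour; independence comes from
    the colours, so the two points may lie on any sides.\<close>
  have "AE \<omega> in M. 2 * spoint c s k \<omega> \<noteq> spoint (\<not> c) s1 k1 \<omega> + spoint (\<not> c) s2 k2 \<omega>" for c s k s1 k1 s2 k2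
    by (rule AE_spoint_neq_hist[where J="?J c" and J'="?J (\<not> c)"]) auto
  then have A3: "AE \<omega> in M. \<forall>c s k s1 k1 s2 k2. 2 * spoint c s k \<omega> \<noteq> spoint (\<not> c) s1 k1 \<omega> + spoint (\<not> c) s2 k2 \<omega>"
    by (simp add: AE_all_countable)
  \<comment> \<open>Excludes a red point midway between 0 and another blue point.\<close>
  have "AE \<omega> in M. 2 * spoint False s k \<omega> \<noteq> spoint True s1 k1 \<omega>" for s k s1 k1
    by (rule AE_spoint_neq_hist[where J="?J False" and J'="?J True"]) auto
  then have A4: "AE \<omega> in M. \<forall>s k s1 k1. 2 * spoint False s k \<omega> \<noteq> spoint True s1 k1 \<omega>"
    by (simp add: AE_all_countable)
  have zero: "AE \<omega> in M. 0 \<notin> half True c \<omega>" for c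
    by (rule AE_not_in_half)
  show ?thesis
    using A1 A2 A3 A4 zero[of False] AE_infinitely_many AE_space
  proof eventually_elim
    case (elim \<omega>)
    note w = elim(7) elim(6)
    have col: "colour True \<omega> = Bl \<omega>" "colour False \<omega> = Rd \<omega>" "half True False \<omega> = Rd \<omega>"
      by (auto simp: colour_def half_def)
    have V: "\<exists>s k. v = spoint False s k \<omega>" if "v \<in> Rd \<omega>" for v
      using colour_eq_spoint[OF w, of v False] that elim(5) by (auto simp: col)
    have U: "u = 0 \<or> (\<exists>s k. u = spoint True s k \<omega>)" if "u \<in> insert 0 (Bl \<omega>)" for u
      using colour_eq_spoint[OF w, of u True] that by (auto simp: col)
    have V0: "v \<noteq> 0" if "v \<in> Rd \<omega>" for v
      using that elim(5) by (auto simp: col)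
    have pos: "0 < spoint c True k \<omega>" "spoint c False k \<omega> < 0" for c k
      using point_pos[OF w] by (auto simp: spoint_def)
    have tie: "x = y \<or> 2 * u = x + y" if "\<bar>u - x\<bar> = \<bar>u - y\<bar>" for u x y :: real
      using that by (auto simp: abs_if split: if_splits)
    have dj: "insert 0 (Bl \<omega>) \<inter> Rd \<omega> = {}"
    proof (rule equals0I)
      fix x assume x: "x \<in> insert 0 (Bl \<omega>) \<inter> Rd \<omega>"
      then obtain s k where "x = spoint False s k \<omega>" using V by blast
      moreover obtain s' k' where "x = spoint True s' k' \<omega>" using x U[of x] V0[of x] by auto
      ultimately show False using elim(1)[rule_format, of s' k' s k] by simp
    qed
    have opp: "v + v' \<noteq> 0" if v: "v \<in> Rd \<omega>" "v' \<in> Rd \<omega>" for v v'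
    proof -
      obtain s k s' k' where e: "v = spoint False s k \<omega>" "v' = spoint False s' k' \<omega>"
        using V v by blast
      show ?thesis
      proof (cases s; cases s')
        assume "s" "s'"
        then show ?thesis using pos(1)[of False k] pos(1)[of False k'] e by simp
      next
        assume "\<not> s" "\<not> s'"
        then show ?thesis using pos(2)[of False k] pos(2)[of False k'] e by simp
      next
        assume "s" "\<not> s'"
        then show ?thesis using elim(2)[rule_format, of k k'] e by simp
      next
        assume "\<not> s" "s'"
        then show ?thesis using elim(2)[rule_format, of k' k] e by simp
      qed
    qed
    have "no_ties (insert 0 (Bl \<omega>)) (Rd \<omega>)"
      unfolding no_ties_def
    proof (intro ballI impI)
      fix u v v' assume u: "u \<in> insert 0 (Bl \<omega>)" and v: "v \<in> Rd \<omega>" "v' \<in> Rd \<omega>" and t: "\<bar>u - v\<bar> = \<bar>u - v'\<bar>"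
      have "2 * u \<noteq> v + v'"
      proof -
        obtain s k s' k' where e: "v = spoint False s k \<omega>" "v' = spoint False s' k' \<omega>"
          using V v by blast
        from U[OF u] show ?thesis
        proof
          assume "u = 0"
          then show ?thesis using opp[OF v] by simp
        next
          assume "\<exists>s k. u = spoint True s k \<omega>"
          then obtain s2 k2 where "u = spoint True s2 k2 \<omega>" by blast
          then show ?thesis
            using elim(3)[rule_format, of True s2 k2 s k s' k'] e by simp
        qed
      qed
      with tie[OF t] show "v = v'" by blast
    qed
    moreover have "no_ties (Rd \<omega>) (insert 0 (Bl \<omega>))"
      unfolding no_ties_def
    proof (intro ballI impI)
      fix v u u' assume v: "v \<in> Rd \<omega>" and u: "u \<in> insert 0 (Bl \<omega>)" "u' \<in> insert 0 (Bl \<omega>)" and t: "\<bar>v - u\<bar> = \<bar>v - u'\<bar>"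
      obtain s k where e: "v = spoint False s k \<omega>" using V v by blast
      have "2 * v \<noteq> u + u'"
      proof -
        have d: "2 * v \<noteq> spoint True s1 k1 \<omega> + spoint True s2 k2 \<omega>" "2 * v \<noteq> spoint True s1 k1 \<omega>" for s1 k1 s2 k2
          unfolding e using elim(3)[rule_format, of False s k s1 k1 s2 k2] elim(4) by simp_all
        from U[OF u(1)] U[OF u(2)] show ?thesis
          by (elim disjE exE) (use d V0[OF v] in simp_all)
      qed
      with tie[OF t] show "u = u'" by blast
    qed
    ultimately show ?case using dj by blast
  qed
qed

end

section \<open>The cycles and the almost sure bounds\<close>

context subcritical_matching
begin

interpretation S: transient_process M "comb 1 (- 1) s" for s
  by (rule transient_excess)

lemma excess_comb:
  "comb 1 (- 1) True t \<omega> = excess (Bl \<omega>) (Rd \<omega>) t"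
  "comb 1 (- 1) False t \<omega> = excess (uminus ` Bl \<omega>) (uminus ` Rd \<omega>) t"
  by (simp_all add: comb_def pcount_def excess_def half_def colour_def)

text \<open>B_i of the overview on the right for \<open>True\<close>, on the left for
  \<open>False\<close>. The subtraction adapts indices starting at 1 to gaps starting at level
  0.\<close>

definition cycle :: "bool \<Rightarrow> nat \<Rightarrow> 'a \<Rightarrow> real" where
  "cycle s i = stationary_process.gap (comb 1 (- 1) s) (i - 1)"

definition cycles :: "bool \<Rightarrow> 'a \<Rightarrow> nat" where
  "cycles s = stationary_process.last_record (comb 1 (- 1) s)"

lemma measurable_excess_hist: "comb 1 (- 1) s t \<in> measurable (hist {(s, False), (s, True)}) (count_space UNIV)"
  by (rule measurable_comb_hist) auto

lemma disjoint_sides: "disjoint_family_on (\<lambda>s :: bool. {(s, False), (s, True)}) UNIV"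
  by (auto simp: disjoint_family_on_def)

lemma measurable_cycle [measurable]: "cycle s i \<in> borel_measurable M"
  unfolding cycle_def by (rule S.measurable_gap)

lemma measurable_cycles [measurable]: "cycles s \<in> measurable M (count_space UNIV)"
  unfolding cycles_def by (rule S.measurable_last_record)

lemma indep_cycle: "indep_vars (\<lambda>_. borel) (\<lambda>j. cycle (fst j) (snd j)) (UNIV \<times> {1..})"
proof (rule indep_vars_blocks[where N="\<lambda>_. borel" and X=cycle, OF indep_hist[OF disjoint_sides]])
  show "cycle s i \<in> borel_measurable (hist {(s, False), (s, True)})" for s i
    unfolding cycle_def
    by (rule S.measurable_past_subset[OF measurable_excess_hist _ S.measurable_gap_past]) simp
  show "indep_vars (\<lambda>_. borel) (cycle s) {1..}" for s
  proof -
    have "inj_on (\<lambda>i :: nat. i - 1) {1..}" by (auto intro!: inj_onI)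
    from indep_vars_reindex[OF indep_vars_subset[OF S.indep_gap] this]
    show ?thesis unfolding cycle_def[abs_def] by simp
  qed
qed simp

lemma indep_cycles: "indep_vars (\<lambda>_. count_space UNIV) cycles UNIV"
proof (rule indep_vars_hist[OF disjoint_sides])
  show "cycles s \<in> measurable (hist {(s, False), (s, True)}) (count_space UNIV)" for s
    unfolding cycles_def
    by (rule S.measurable_past_subset[OF measurable_excess_hist _ S.measurable_last_record_past]) simp
qed

lemma distr_cycle: "distr M borel (cycle s i) = busy_dist l m"
proof -
  have "S.gap s 0 = S.passage s 1"
    by (auto simp: S.gap_def S.passage_0)
  then show ?thesis
    using distr_first_passage[of s] S.distr_gap[of s "i - 1"] by (simp add: cycle_def)
qed

lemma prob_drops_excess: "1 \<le> j \<Longrightarrow> prob {\<omega> \<in> space M. S.drops s j \<omega>} = (l / m) ^ j"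
  using S.prob_drops[of j s] prob_excess_reaches[of s j] by simp

lemma ratio: "0 < l / m" "l / m < 1"
  using l_pos m_pos l_less_m by auto

lemma distr_cycles: "distr M (count_space UNIV) (cycles s) = geom1 (1 - l / m)"
  unfolding cycles_def by (rule S.distr_last_record(2)[OF prob_drops_excess ratio])

lemma sum_cycle: "(\<Sum>i\<in>{1..n}. cycle s i \<omega>) = S.passage s n \<omega>"
proof -
  have "(\<Sum>i\<in>{1..n}. cycle s i \<omega>) = (\<Sum>i<n. S.gap s i \<omega>)"
    unfolding cycle_def by (rule sum.reindex_bij_witness[of _ Suc "\<lambda>i. i - 1"]) auto
  then show ?thesis by (simp add: S.sum_gap)
qed

text \<open>Before the passage to level 1 the excess is not 1, and after the passage to the last
  record level it stays positive. These are the hypotheses of the two deterministic bounds, on each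
  side.\<close>

lemma AE_mdist_bounds:
  "AE \<omega> in M. ereal (min (cycle True 1 \<omega>) (cycle False 1 \<omega>)) \<le> mdist_blue (Ms (insert 0 (Bl \<omega>)) (Rd \<omega>)) 0 \<and>
     mdist_blue (Ms (insert 0 (Bl \<omega>)) (Rd \<omega>)) 0 \<le>
       ereal (max (\<Sum>i\<in>{1..2 * cycles True \<omega> - 1}. cycle True i \<omega>) (\<Sum>i\<in>{1..2 * cycles False \<omega> - 1}. cycle False i \<omega>))"
proof -
  have reach: "AE \<omega> in M. \<forall>s k. S.reaches s k \<omega>"
    by (simp add: AE_all_countable S.AE_reaches)
  have last: "AE \<omega> in M. \<forall>s. \<exists>j\<ge>1. \<not> S.drops s j \<omega>"
    unfolding AE_all_countable by (intro allI S.distr_last_record(1)[OF prob_drops_excess ratio])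
  show ?thesis
    using AE_generic reach last AE_space
  proof eventually_elim
    case (elim \<omega>)
    have w: "\<omega> \<in> space M" by fact
    have fin: "locally_finite (Bl \<omega>)" "locally_finite (Rd \<omega>)"
      using locally_finite_colour[OF w, of True] locally_finite_colour[OF w, of False] by (simp_all add: colour_def)
    have r: "S.reaches s k \<omega>" for s k using elim(2) by blast
    have cyc: "1 \<le> cycles s \<omega>" "\<And>t. S.passage s (cycles s \<omega>) \<omega> \<le> t \<Longrightarrow> 1 \<le> comb 1 (- 1) s t \<omega>" for s
    proof -
      obtain j where "1 \<le> j" "\<not> S.drops s j \<omega>" using elim(3) by blast
      from S.last_record_ge[OF w r this(2,1)]
      show "1 \<le> cycles s \<omega>" "\<And>t. S.passage s (cycles s \<omega>) \<omega> \<le> t \<Longrightarrow> 1 \<le> comb 1 (- 1) s t \<omega>"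
        unfolding cycles_def by blast+
    qed
    have mono: "S.passage s i \<omega> \<le> S.passage s j \<omega>" if "i \<le> j" for s i j
      using that S.Y_passage[OF w r, of s j] S.passage_nonneg[OF r, of s j] by (intro S.passage_le) auto
    have pos: "0 < S.passage s (cycles s \<omega>) \<omega>" for s
      using S.passage_strict_mono[OF w r, of s 0] mono[OF cyc(1)[of s], of s] by (simp add: S.passage_0)
    have first: "cycle s 1 \<omega> = S.passage s 1 \<omega>" for s
      by (simp add: cycle_def S.gap_def S.passage_0)
    note gen = conjunct1[OF elim(1)] conjunct1[OF conjunct2[OF elim(1)]] conjunct2[OF conjunct2[OF elim(1)]]
    have "ereal (min (cycle True 1 \<omega>) (cycle False 1 \<omega>)) \<le> mdist_blue (Ms (insert 0 (Bl \<omega>)) (Rd \<omega>)) 0"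
    proof (rule mdist_blue_ge[OF fin gen])
      show "cycle True 1 \<omega> \<le> t" if "0 < t" "excess (Bl \<omega>) (Rd \<omega>) t = 1" for t
        unfolding first using that by (intro S.passage_le) (auto simp: excess_comb)
      show "cycle False 1 \<omega> \<le> t" if "0 < t" "excess (uminus ` Bl \<omega>) (uminus ` Rd \<omega>) t = 1" for t
        unfolding first using that by (intro S.passage_le) (auto simp: excess_comb)
    qed
    moreover have "mdist_blue (Ms (insert 0 (Bl \<omega>)) (Rd \<omega>)) 0 \<le>
        ereal (max (S.passage True (cycles True \<omega>) \<omega>) (S.passage False (cycles False \<omega>) \<omega>))"
    proof (rule mdist_blue_le[OF fin gen pos pos])
      show "1 \<le> excess (Bl \<omega>) (Rd \<omega>) t" if "S.passage True (cycles True \<omega>) \<omega> \<le> t" for t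
        using cyc(2)[OF that] excess_comb(1)[of t \<omega>] by simp
      show "1 \<le> excess (uminus ` Bl \<omega>) (uminus ` Rd \<omega>) t" if "S.passage False (cycles False \<omega>) \<omega> \<le> t" for t
        using cyc(2)[OF that] excess_comb(2)[of t \<omega>] by simp
    qed
    \<comment> \<open>N \<le> 2N - 1 because N \<ge> 1, and passage times increase with the
      level.\<close>
    moreover have "S.passage s (cycles s \<omega>) \<omega> \<le> (\<Sum>i\<in>{1..2 * cycles s \<omega> - 1}. cycle s i \<omega>)" for s
      unfolding sum_cycle using cyc(1)[of s] by (intro mono) simp
    from max.mono[OF this[of True] this[of False]]
    have "ereal (max (S.passage True (cycles True \<omega>) \<omega>) (S.passage False (cycles False \<omega>) \<omega>)) \<le>
       ereal (max (\<Sum>i\<in>{1..2 * cycles True \<omega> - 1}. cycle True i \<omega>) (\<Sum>i\<in>{1..2 * cycles False \<omega> - 1}. cycle False i \<omega>))"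
      by (simp only: ereal_less_eq)
    ultimately show ?case
      using order_trans by blast
  qed
qed

end

section \<open>Transfer along a measure-preserving map\<close>

lemma indep_vars_comp:
  assumes "prob_space Q" "prob_space M" and f: "f \<in> measurable Q M" "distr Q M f = M"
    and ind: "prob_space.indep_vars M N X I"
  shows "prob_space.indep_vars Q N (\<lambda>i \<omega>. X i (f \<omega>)) I"
proof -
  interpret Q: prob_space Q by fact
  interpret M: prob_space M by fact
  have X: "X i \<in> measurable M (N i)" if "i \<in> I" for i
    using ind that by (auto simp: M.indep_vars_def2)
  have P: "Q.prob (f -` A \<inter> space Q) = M.prob A" if "A \<in> M.events" for A
    using measure_distr[OF f(1) that] f(2) by simp
  show ?thesis
    unfolding Q.indep_vars_def2
  proof (intro conjI ballI Q.indep_setsI)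
    show rv: "(\<lambda>\<omega>. X i (f \<omega>)) \<in> measurable Q (N i)" if "i \<in> I" for i
      using measurable_compose[OF f(1) X[OF that]] .
    show "{(\<lambda>\<omega>. X i (f \<omega>)) -` A \<inter> space Q |A. A \<in> sets (N i)} \<subseteq> Q.events" if "i \<in> I" for i
      using measurable_sets[OF rv[OF that]] by auto
    fix A J assume J: "J \<noteq> {}" "J \<subseteq> I" "finite J" and A: "\<forall>j\<in>J. A j \<in> {(\<lambda>\<omega>. X j (f \<omega>)) -` A \<inter> space Q |A. A \<in> sets (N j)}"
    then have "\<forall>j\<in>J. \<exists>B. A j = (\<lambda>\<omega>. X j (f \<omega>)) -` B \<inter> space Q \<and> B \<in> sets (N j)" by auto
    from bchoice[OF this] obtain B where B: "\<And>j. j \<in> J \<Longrightarrow> A j = (\<lambda>\<omega>. X j (f \<omega>)) -` B j \<inter> space Q" "\<And>j. j \<in> J \<Longrightarrow> B j \<in> sets (N j)" by blast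
    have ev: "X j -` B j \<inter> space M \<in> M.events" if "j \<in> J" for j
      using measurable_sets[OF X B(2)] that J by auto
    have A_eq: "A j = f -` (X j -` B j \<inter> space M) \<inter> space Q" if "j \<in> J" for j
      using B(1)[OF that] measurable_space[OF f(1)] by auto
    have "(\<Inter>j\<in>J. A j) = f -` (\<Inter>j\<in>J. X j -` B j \<inter> space M) \<inter> space Q"
      using A_eq J(1) by auto
    then have "Q.prob (\<Inter>j\<in>J. A j) = M.prob (\<Inter>j\<in>J. X j -` B j \<inter> space M)"
      using ev J by (simp only:) (intro P sets.finite_INT, auto)
    also have "\<dots> = (\<Prod>j\<in>J. M.prob (X j -` B j \<inter> space M))"
      by (rule M.indep_varsD[OF ind]) (use J B in auto)
    also have "\<dots> = (\<Prod>j\<in>J. Q.prob (A j))"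
      using A_eq P[OF ev] by (intro prod.cong) auto
    finally show "Q.prob (\<Inter>j\<in>J. A j) = (\<Prod>j\<in>J. Q.prob (A j))" .
  qed
qed

theorem theorem4p5:
  fixes M :: "'a measure" and l m :: real
    and Bl Rd :: "'a \<Rightarrow> real set"
  assumes "0 < l" and "l < m"
    and "poisson_matching_problem M l m Bl Rd"
  defines "X \<equiv> (\<lambda>\<omega>. mdist_blue (Ms (insert 0 (Bl \<omega>)) (Rd \<omega>)) 0)"
  shows "\<exists>(Q :: ('a \<times> (nat \<Rightarrow> real)) measure)
            (B :: nat \<Rightarrow> 'a \<times> (nat \<Rightarrow> real) \<Rightarrow> real) (B' :: nat \<Rightarrow> 'a \<times> (nat \<Rightarrow> real) \<Rightarrow> real)
            (N :: 'a \<times> (nat \<Rightarrow> real) \<Rightarrow> nat) (N' :: 'a \<times> (nat \<Rightarrow> real) \<Rightarrow> nat).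
           prob_space Q \<and>
           fst \<in> measurable Q M \<and> distr Q M fst = M \<and>
           prob_space.indep_vars Q (\<lambda>_. borel)
             (\<lambda>(c, i). if c then B i else B' i) (UNIV \<times> {1..}) \<and>
           (\<forall>i\<ge>1. distr Q borel (B i) = busy_dist l m \<and> distr Q borel (B' i) = busy_dist l m) \<and>
           prob_space.indep_vars Q (\<lambda>_. count_space UNIV)
             (\<lambda>c. if c then N else N') UNIV \<and>
           distr Q (count_space UNIV) N = geom1 (1 - l / m) \<and>
           distr Q (count_space UNIV) N' = geom1 (1 - l / m) \<and>
           (AE q in Q.
              ereal (min (B 1 q) (B' 1 q)) \<le> X (fst q) \<and>
              X (fst q) \<le> ereal (max (\<Sum>i\<in>{1..2 * N q - 1}. B i q) (\<Sum>i\<in>{1..2 * N' q - 1}. B' i q)))"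
proof -
  interpret subcritical_matching M l m Bl Rd
    using assms by unfold_locales auto
  \<comment> \<open>\<open>Q\<close> has room for a sequence of extra random reals. All variables
    are functions of the first coordinate, so the second is frozen at the zero sequence.\<close>
  define R where "R = return (count_space UNIV) (\<lambda>_ :: nat. 0 :: real)"
  interpret R: prob_space R
    unfolding R_def by (rule prob_space_return) simp
  define Q where "Q = M \<Otimes>\<^sub>M R"
  interpret P: pair_prob_space M R ..
  have Q: "prob_space Q"
    unfolding Q_def by (rule P.prob_space_axioms)
  have fst: "fst \<in> measurable Q M" "distr Q M fst = M"
    unfolding Q_def by (simp_all add: R.distr_pair_fst)
  have distr: "distr Q L (\<lambda>q. f (fst q)) = distr M L f" if "f \<in> measurable M L" for f :: "'a \<Rightarrow> 'b" and L
    using distr_distr[OF that fst(1)] by (simp add: fst(2) comp_def)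
  let ?B = "\<lambda>s i q. cycle s i (fst q)" and ?N = "\<lambda>s q. cycles s (fst q)"
  have "prob_space.indep_vars Q (\<lambda>_. borel) (\<lambda>j q. cycle (fst j) (snd j) (fst q)) (UNIV \<times> {1..})"
    by (rule indep_vars_comp[OF Q prob_space_axioms fst indep_cycle])
  also have "(\<lambda>j q. cycle (fst j) (snd j) (fst q)) = (\<lambda>(c, i). if c then ?B True i else ?B False i)"
    by (auto simp: fun_eq_iff)
  finally have indB: "prob_space.indep_vars Q (\<lambda>_. borel) (\<lambda>(c, i). if c then ?B True i else ?B False i) (UNIV \<times> {1..})" .
  have "prob_space.indep_vars Q (\<lambda>_. count_space UNIV) (\<lambda>s q. cycles s (fst q)) UNIV"
    by (rule indep_vars_comp[OF Q prob_space_axioms fst indep_cycles])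
  also have "(\<lambda>s q. cycles s (fst q)) = (\<lambda>c. if c then ?N True else ?N False)"
    by (auto simp: fun_eq_iff)
  finally have indN: "prob_space.indep_vars Q (\<lambda>_. count_space UNIV) (\<lambda>c. if c then ?N True else ?N False) UNIV" .
  have bounds: "AE q in Q. ereal (min (?B True 1 q) (?B False 1 q)) \<le> X (fst q) \<and>
     X (fst q) \<le> ereal (max (\<Sum>i\<in>{1..2 * ?N True q - 1}. ?B True i q) (\<Sum>i\<in>{1..2 * ?N False q - 1}. ?B False i q))"
    unfolding X_def using AE_mdist_bounds by (intro AE_distrD[OF fst(1)]) (simp only: fst(2))
  show ?thesis
  proof (intro exI conjI)
    show "prob_space Q" "fst \<in> measurable Q M" "distr Q M fst = M"
      by (fact Q fst)+
    show "prob_space.indep_vars Q (\<lambda>_. borel) (\<lambda>(c, i). if c then ?B True i else ?B False i) (UNIV \<times> {1..})"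
      by (rule indB)
    show "\<forall>i\<ge>1. distr Q borel (?B True i) = busy_dist l m \<and> distr Q borel (?B False i) = busy_dist l m"
      by (simp add: distr distr_cycle)
    show "prob_space.indep_vars Q (\<lambda>_. count_space UNIV) (\<lambda>c. if c then ?N True else ?N False) UNIV"
      by (rule indN)
    show "distr Q (count_space UNIV) (?N True) = geom1 (1 - l / m)" "distr Q (count_space UNIV) (?N False) = geom1 (1 - l / m)"
      by (simp_all add: distr distr_cycles)
    show "AE q in Q. ereal (min (?B True 1 q) (?B False 1 q)) \<le> X (fst q) \<and>
     X (fst q) \<le> ereal (max (\<Sum>i\<in>{1..2 * ?N True q - 1}. ?B True i q) (\<Sum>i\<in>{1..2 * ?N False q - 1}. ?B False i q))"
      by (rule bounds)
  qed
qed

end
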